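(* Let $\mathcal{H}$ be a Hilbert space, let $A\in\mathcal{B}(\mathcal{H})$ satisfy $0\le A\le 1$ and $\ker A=\{0\}$, and let $Q_0\in Gr_A$. Then the orbit $\mathbb{G}_A\cdot Q_0=\{GQ_0G^{-1}: G\in\mathbb{G}_A\}$ is a complemented $C^\infty$ submanifold of $\mathcal{B}^A_s(\mathcal{H})$, and the map $\pi_{Q_0}:\mathbb{G}_A\to\mathbb{G}_A\cdot Q_0$, $\pi_{Q_0}(G)=GQ_0G^{-1}$, is a $C^\infty$ submersion. Moreover, the orbit $\mathbb{G}_A\cdot Q_0$ is a union of connected components of $Gr_A$, and therefore $Gr_A$ is a complemented submanifold of $\mathcal{B}^A_s(\mathcal{H})$.
   Context: $\mathcal{H}$ is a complex Hilbert space; $\mathcal{B}(\mathcal{H})$ carries the operator norm and adjoints are taken with respect to the original inner product of $\mathcal{H}$. $\mathcal{B}^A_s(\mathcal{H})=\{B\in\mathcal{B}(\mathcal{H}): B^*A=AB\}$ (the $A$-symmetric operators) and $\mathcal{B}^A_{as}(\mathcal{H})=\{B\in\mathcal{B}(\mathcal{H}): B^*A=-AB\}$ (the $A$-anti-symmetric operators) are real Banach spaces with the operator norm. $\mathbb{G}_A=\{G\in Gl(\mathcal{H}): G^*AG=A\}$, where $Gl(\mathcal{H})$ is the group of invertible operators in $\mathcal{B}(\mathcal{H})$; with the norm topology it is a Banach-Lie group with Banach-Lie algebra $\mathcal{B}^A_{as}(\mathcal{H})$. The compatible Grassmannian is $Gr_A=\{Q\in\mathcal{B}(\mathcal{H}):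 Q^2=Q,\ Q^*A=AQ\}$ with the norm topology; $\mathbb{G}_A$ acts on it by $G\cdot Q=GQG^{-1}$. A complemented submanifold is one whose tangent spaces are closed and complemented in the ambient Banach space. *)

theory Defs
  imports "HOL-Analysis.Analysis"
begin

section \<open>Complex Hilbert spaces\<close>

text \<open>A complex Hilbert space carries its underlying real Hilbert space: the real inner product is
  the real part of the complex one, so both induce the same norm.\<close>

class complex_hilbert = real_inner + complete_space +
  fixes scaleC :: "complex \<Rightarrow> 'a \<Rightarrow> 'a" (infixr "*\<^sub>C" 75)
    and cinner :: "'a \<Rightarrow> 'a \<Rightarrow> complex"
  assumes scaleC_add_right: "c *\<^sub>C (x + y) = c *\<^sub>C x + c *\<^sub>C y"
    and scaleC_add_left: "(c + d) *\<^sub>C x = c *\<^sub>C x + d *\<^sub>C x"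
    and scaleC_scaleC: "c *\<^sub>C (d *\<^sub>C x) = (c * d) *\<^sub>C x"
    and scaleC_of_real: "complex_of_real r *\<^sub>C x = r *\<^sub>R x"
    and cinner_commute: "cinner x y = cnj (cinner y x)"
    and cinner_add_left: "cinner (x + y) z = cinner x z + cinner y z"
    and cinner_scaleC_left: "cinner (c *\<^sub>C x) y = c * cinner x y"
    and inner_eq_Re_cinner: "inner x y = Re (cinner x y)"
begin

subclass banach ..

end

section \<open>Bounded operators\<close>

text \<open>\<open>'a \<Rightarrow>\<^sub>L 'a\<close> consists of the bounded real-linear operators with the operator norm; \<open>B(H)\<close> is its
  closed real subspace of complex-linear operators.\<close>

definition bounded_ops :: "('a::complex_hilbert \<Rightarrow>\<^sub>L 'a) set"
  where "bounded_ops = {T. \<forall>c x. blinfun_apply T (c *\<^sub>C x) = c *\<^sub>C blinfun_apply T x}"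

definition adj :: "('a::complex_hilbert \<Rightarrow>\<^sub>L 'a) \<Rightarrow> ('a \<Rightarrow>\<^sub>L 'a)"
  where "adj T = (THE S. \<forall>x y. cinner (blinfun_apply T x) y = cinner x (blinfun_apply S y))"

definition op_inv :: "('a::complex_hilbert \<Rightarrow>\<^sub>L 'a) \<Rightarrow> ('a \<Rightarrow>\<^sub>L 'a)"
  where "op_inv G = (THE K. G o\<^sub>L K = id_blinfun \<and> K o\<^sub>L G = id_blinfun)"

definition Gl :: "('a::complex_hilbert \<Rightarrow>\<^sub>L 'a) set"
  where "Gl = {G \<in> bounded_ops. \<exists>K\<in>bounded_ops. G o\<^sub>L K = id_blinfun \<and> K o\<^sub>L G = id_blinfun}"

definition op_le :: "('a::complex_hilbert \<Rightarrow>\<^sub>L 'a) \<Rightarrow> ('a \<Rightarrow>\<^sub>L 'a) \<Rightarrow> bool"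
  where "op_le S T \<longleftrightarrow>
    (\<forall>x. cinner (blinfun_apply (T - S) x) x \<in> \<real> \<and> 0 \<le> Re (cinner (blinfun_apply (T - S) x) x))"

definition A_symmetric :: "('a::complex_hilbert \<Rightarrow>\<^sub>L 'a) \<Rightarrow> ('a \<Rightarrow>\<^sub>L 'a) set"
  where "A_symmetric A = {B \<in> bounded_ops. adj B o\<^sub>L A = A o\<^sub>L B}"

definition A_group :: "('a::complex_hilbert \<Rightarrow>\<^sub>L 'a) \<Rightarrow> ('a \<Rightarrow>\<^sub>L 'a) set"
  where "A_group A = {G \<in> Gl. adj G o\<^sub>L A o\<^sub>L G = A}"

definition compat_Gr :: "('a::complex_hilbert \<Rightarrow>\<^sub>L 'a) \<Rightarrow> ('a \<Rightarrow>\<^sub>L 'a) set"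
  where "compat_Gr A = {Q \<in> bounded_ops. Q o\<^sub>L Q = Q \<and> adj Q o\<^sub>L A = A o\<^sub>L Q}"

definition orbit_map :: "('a::complex_hilbert \<Rightarrow>\<^sub>L 'a) \<Rightarrow> ('a \<Rightarrow>\<^sub>L 'a) \<Rightarrow> ('a \<Rightarrow>\<^sub>L 'a)"
  where "orbit_map Q G = G o\<^sub>L Q o\<^sub>L op_inv G"

definition orbit :: "('a::complex_hilbert \<Rightarrow>\<^sub>L 'a) \<Rightarrow> ('a \<Rightarrow>\<^sub>L 'a) \<Rightarrow> ('a \<Rightarrow>\<^sub>L 'a) set"
  where "orbit A Q = orbit_map Q ` A_group A"

section \<open>Smooth maps between Banach spaces\<close>

text \<open>The Banach spaces below are closed real subspaces \<open>E\<close> of an ambient complete normed space.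
  Since the type of an \<open>n\<close>-th derivative cannot depend on \<open>n\<close>, an \<open>n\<close>-linear map on \<open>E\<close> is
  represented by a function on lists over \<open>E\<close> of length \<open>n\<close>.\<close>

definition closed_subspace :: "'a::real_normed_vector set \<Rightarrow> bool"
  where "closed_subspace E \<longleftrightarrow> subspace E \<and> closed E"

definition bounded_multilinear_on ::
    "'a::real_normed_vector set \<Rightarrow> nat \<Rightarrow> ('a list \<Rightarrow> 'b::real_normed_vector) \<Rightarrow> bool"
  where "bounded_multilinear_on E n m \<longleftrightarrow>
    (\<forall>us vs. set us \<subseteq> E \<and> set vs \<subseteq> E \<and> Suc (length us + length vs) = n \<longrightarrow>
       (\<forall>x\<in>E. \<forall>y\<in>E. m (us @ (x + y) # vs) = m (us @ x # vs) + m (us @ y # vs)) \<and>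
       (\<forall>c. \<forall>x\<in>E. m (us @ (c *\<^sub>R x) # vs) = c *\<^sub>R m (us @ x # vs))) \<and>
    (\<exists>K. \<forall>vs. set vs \<subseteq> E \<and> length vs = n \<longrightarrow> norm (m vs) \<le> K * prod_list (map norm vs))"

text \<open>\<open>f\<close> is \<open>C\<^sup>\<infinity>\<close> on the relatively open subset \<open>U\<close> of \<open>E\<close>: \<open>D n x\<close> is the \<open>n\<close>-th Frechet derivative
  of \<open>f\<close> at \<open>x\<close>, and the last clause says that \<open>D (Suc n) x\<close> is the Frechet derivative of \<open>D n\<close> at \<open>x\<close>
  with respect to the norm of bounded \<open>n\<close>-linear maps on \<open>E\<close>. Each \<open>D n\<close> is differentiable, hence
  continuous.\<close>

definition smooth_on ::
    "'a::real_normed_vector set \<Rightarrow> 'a set \<Rightarrow> ('a \<Rightarrow> 'b::real_normed_vector) \<Rightarrow> bool"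
  where "smooth_on E U f \<longleftrightarrow>
    (\<exists>D :: nat \<Rightarrow> 'a \<Rightarrow> 'a list \<Rightarrow> 'b.
      (\<forall>x\<in>U. D 0 x [] = f x) \<and>
      (\<forall>n. \<forall>x\<in>U. bounded_multilinear_on E n (D n x)) \<and>
      (\<forall>n. \<forall>x\<in>U. \<forall>e>0. \<exists>d>0. \<forall>y\<in>U. norm (y - x) < d \<longrightarrow>
        (\<forall>vs. set vs \<subseteq> E \<and> length vs = n \<longrightarrow>
          norm (D n y vs - D n x vs - D (Suc n) x ((y - x) # vs))
            \<le> e * norm (y - x) * prod_list (map norm vs))))"

text \<open>A first derivative defined only on \<open>E\<close>; \<open>has_derivative\<close> is not suitable here, since it asks for
  a bounded linear map on the whole type and bounded linear maps on \<open>E\<close> need not extend.\<close>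

definition frechet_derivative_on ::
    "'a::real_normed_vector set \<Rightarrow> 'a set \<Rightarrow> ('a \<Rightarrow> 'b::real_normed_vector) \<Rightarrow> 'a \<Rightarrow> ('a \<Rightarrow> 'b) \<Rightarrow> bool"
  where "frechet_derivative_on E U f x L \<longleftrightarrow>
    (\<forall>v\<in>E. \<forall>w\<in>E. L (v + w) = L v + L w) \<and>
    (\<forall>c. \<forall>v\<in>E. L (c *\<^sub>R v) = c *\<^sub>R L v) \<and>
    (\<exists>K. \<forall>v\<in>E. norm (L v) \<le> K * norm v) \<and>
    (\<forall>e>0. \<exists>d>0. \<forall>y\<in>U. norm (y - x) < d \<longrightarrow> norm (f y - f x - L (y - x)) \<le> e * norm (y - x))"

section \<open>Submanifolds and submersions\<close>

definition complemented_in :: "'a::real_normed_vector set \<Rightarrow> 'a set \<Rightarrow> bool"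
  where "complemented_in E F \<longleftrightarrow> closed_subspace F \<and> F \<subseteq> E \<and>
    (\<exists>K. closed_subspace K \<and> K \<subseteq> E \<and> F \<inter> K = {0} \<and> {x + y |x y. x \<in> F \<and> y \<in> K} = E)"

text \<open>A \<open>C\<^sup>\<infinity>\<close> diffeomorphism \<open>\<phi>\<close> (with inverse \<open>\<psi>\<close>) between open sets \<open>U\<close>, \<open>V\<close> of \<open>E\<close> that straightens
  \<open>M \<inter> U\<close> to the model space \<open>F\<close>. The restriction of \<open>\<phi>\<close> is a chart of \<open>M\<close>. \<open>F\<close> is closed but need not be
  complemented; any two such charts of \<open>M\<close> are \<open>C\<^sup>\<infinity>\<close>-compatible, so a submanifold has exactly
  one manifold structure of this kind, and it carries the norm topology.\<close>

definition submanifold_chart ::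
    "'a::real_normed_vector set \<Rightarrow> 'a set \<Rightarrow> 'a set \<Rightarrow> 'a set \<Rightarrow> ('a \<Rightarrow> 'a) \<Rightarrow> ('a \<Rightarrow> 'a) \<Rightarrow> 'a set \<Rightarrow> bool"
  where "submanifold_chart E M U V \<phi> \<psi> F \<longleftrightarrow>
    openin (top_of_set E) U \<and> openin (top_of_set E) V \<and>
    homeomorphism U V \<phi> \<psi> \<and> smooth_on E U \<phi> \<and> smooth_on E V \<psi> \<and>
    closed_subspace F \<and> F \<subseteq> E \<and> \<phi> ` (U \<inter> M) = V \<inter> F"

definition submanifold :: "'a::real_normed_vector set \<Rightarrow> 'a set \<Rightarrow> bool"
  where "submanifold E M \<longleftrightarrow> closed_subspace E \<and> M \<subseteq> E \<and>
    (\<forall>p\<in>M. \<exists>U V \<phi> \<psi> F. p \<in> U \<and> submanifold_chart E M U V \<phi> \<psi> F)"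

definition tangent_space :: "'a::real_normed_vector set \<Rightarrow> 'a \<Rightarrow> 'a set"
  where "tangent_space M p = {v. \<exists>\<gamma> e. 0 < e \<and> smooth_on UNIV {-e<..<e} \<gamma> \<and>
    \<gamma> ` {-e<..<e} \<subseteq> M \<and> \<gamma> 0 = p \<and> (\<gamma> has_vector_derivative v) (at (0::real))}"

definition complemented_submanifold :: "'a::real_normed_vector set \<Rightarrow> 'a set \<Rightarrow> bool"
  where "complemented_submanifold E M \<longleftrightarrow>
    submanifold E M \<and> (\<forall>p\<in>M. complemented_in E (tangent_space M p))"

text \<open>\<open>f\<close> is a \<open>C\<^sup>\<infinity>\<close> submersion of the submanifold \<open>M\<close> of \<open>E\<close> into the submanifold \<open>N\<close> of \<open>E'\<close>: around every
  point the local representative \<open>\<phi>' \<circ> f \<circ> \<psi>\<close> from \<open>V \<inter> F\<close> to \<open>F'\<close> is \<open>C\<^sup>\<infinity>\<close>, and its derivative at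
  that point maps \<open>F\<close> onto \<open>F'\<close> with kernel complemented in \<open>F\<close>. All conditions are independent of
  the charts chosen.\<close>

definition smooth_submersion ::
    "'a::real_normed_vector set \<Rightarrow> 'a set \<Rightarrow> 'b::real_normed_vector set \<Rightarrow> 'b set \<Rightarrow> ('a \<Rightarrow> 'b) \<Rightarrow> bool"
  where "smooth_submersion E M E' N f \<longleftrightarrow>
    submanifold E M \<and> submanifold E' N \<and> f ` M \<subseteq> N \<and>
    (\<forall>p\<in>M. \<exists>U V \<phi> \<psi> F U' V' \<phi>' \<psi>' F'.
      p \<in> U \<and> submanifold_chart E M U V \<phi> \<psi> F \<and>
      f p \<in> U' \<and> submanifold_chart E' N U' V' \<phi>' \<psi>' F' \<and>
      f ` (U \<inter> M) \<subseteq> U' \<and>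
      smooth_on F (V \<inter> F) (\<phi>' \<circ> f \<circ> \<psi>) \<and>
      (\<exists>L. frechet_derivative_on F (V \<inter> F) (\<phi>' \<circ> f \<circ> \<psi>) (\<phi> p) L \<and>
        L ` F = F' \<and> complemented_in F {v \<in> F. L v = 0}))"

end

theory Submission
  imports Defs
begin

text \<open>Call \<open>S\<close> an adjoint of \<open>T\<close> for \<open>A\<close> if \<open>\<langle>A T x, y\<rangle> = \<langle>A x, S y\<rangle>\<close> for all \<open>x\<close>, \<open>y\<close>. This relation is compatible with
  sums, products and inverses, and with it every set of the theorem is described by equations in the
  operator algebra: \<open>A\<close>-symmetric operators are their own adjoint, the elements of the group have their
  inverse as adjoint, the elements of its Lie algebra (\<open>A_skew\<close>) their negative. All charts can
  therefore be written down, together with their inverses, as rational expressions in operators, and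
  these are smooth since sums, products and inverses of smooth operator-valued maps are smooth
  (\<open>smooth_on_add\<close>, \<open>smooth_on_compose\<close>, \<open>smooth_on_op_inv\<close>).

  The group: around \<open>p\<close> the Cayley transform \<open>X = (W - 1) (W + 1)\<^sup>-\<^sup>1\<close> of \<open>W = p\<^sup>-\<^sup>1 G\<close> is a chart, because
  \<open>W\<close> has adjoint \<open>W\<^sup>-\<^sup>1\<close> exactly if \<open>X\<close> has adjoint \<open>- X\<close> (\<open>A_group_chart\<close>).

  The Grassmannian: an operator \<open>B\<close> near \<open>Q\<close> factors as \<open>(1 + K) (M + N) (1 + L)\<close>, where with respect to the
  decomposition of the identity into \<open>Q\<close> and \<open>1 - Q\<close> the factors \<open>K\<close> and \<open>L\<close> are off-diagonal and \<open>M\<close>, \<open>N\<close> are the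
  two diagonal blocks. If \<open>B\<close> is \<open>A\<close>-symmetric, then \<open>K\<close> and \<open>L\<close> are adjoint to each other, and \<open>B\<close> is
  idempotent exactly if \<open>N = 0\<close> and \<open>M\<close> is the inverse of \<open>1 + L K\<close>. Hence
  \<open>B \<mapsto> K + L + (M - (1 + L K)\<^sup>-\<^sup>1) + N\<close> straightens the Grassmannian to the codiagonal \<open>A\<close>-symmetric operators
  (\<open>gr_submanifold_chart\<close>), which are complemented by the diagonal ones and are the tangent space
  (\<open>tangent_space_eq\<close>).

  The orbits: two points \<open>P\<close>, \<open>Q\<close> of the Grassmannian at distance at most \<open>1/2\<close> are conjugate under the group,
  by \<open>N = P Q + (1 - P) (1 - Q)\<close> divided by the square root of \<open>1 - (P - Q)\<^sup>2\<close>
  (\<open>near_projections_same_orbit\<close>). So orbits are open and closed in the Grassmannian, are unions of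
  components, and share its charts.

  The submersion: at \<open>p\<close> the derivative of the orbit map is \<open>X \<mapsto> 2 p (X Q\<^sub>0 - Q\<^sub>0 X) p\<^sup>-\<^sup>1\<close> in the charts. Its kernel
  is the commutant of \<open>Q\<^sub>0\<close> in the Lie algebra, and it is onto because the commutator with \<open>Q\<^sub>0\<close>, applied twice, is the
  identity on codiagonal operators (\<open>orbit_map_submersion\<close>).\<close>

text \<open>The composition of operators binds more weakly than addition in its standard notation; the notation
  below lets it bind like a product.\<close>

notation blinfun_compose (infixl "\<odot>" 70)

section \<open>Invertible operators\<close>

definition op_invertible :: "('a::complex_hilbert \<Rightarrow>\<^sub>L 'a) \<Rightarrow> bool"
  where "op_invertible G \<longleftrightarrow> (\<exists>K. G \<odot> K = id_blinfun \<and> K \<odot> G = id_blinfun)"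

lemma blinfun_compose_id [simp]: "id_blinfun \<odot> T = T" "T \<odot> id_blinfun = T"
  by (simp_all add: blinfun_eqI)

lemma blinfun_compose_assoc: "(R \<odot> S) \<odot> T = R \<odot> (S \<odot> T)"
  by (simp add: blinfun_eqI)

interpretation op_mult: bounded_bilinear "(\<odot>)"
  by (rule bounded_bilinear_blinfun_compose)

lemmas op_ring = blinfun_compose_assoc op_mult.add_left op_mult.add_right op_mult.diff_left
  op_mult.diff_right op_mult.minus_left op_mult.minus_right op_mult.scaleR_left op_mult.scaleR_right

lemma op_inv_unique:
  assumes "G \<odot> K = id_blinfun" "K \<odot> G = id_blinfun"
  shows "op_inv G = K"
  unfolding op_inv_def
proof (rule the_equality)
  show "G \<odot> K = id_blinfun \<and> K \<odot> G = id_blinfun" using assms by simp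
  fix K' assume "G \<odot> K' = id_blinfun \<and> K' \<odot> G = id_blinfun"
  then show "K' = K"
    using assms by (metis blinfun_compose_assoc blinfun_compose_id)
qed

lemma op_invertibleI:
  "G \<odot> K = id_blinfun \<Longrightarrow> K \<odot> G = id_blinfun \<Longrightarrow> op_invertible G"
  by (auto simp: op_invertible_def)

lemma op_inv_right: "op_invertible G \<Longrightarrow> G \<odot> op_inv G = id_blinfun"
  and op_inv_left: "op_invertible G \<Longrightarrow> op_inv G \<odot> G = id_blinfun"
  using op_inv_unique unfolding op_invertible_def by metis+

lemma op_inv_right_assoc: "op_invertible G \<Longrightarrow> G \<odot> (op_inv G \<odot> X) = X"
  and op_inv_left_assoc: "op_invertible G \<Longrightarrow> op_inv G \<odot> (G \<odot> X) = X"
  by (metis blinfun_compose_assoc blinfun_compose_id(1) op_inv_right op_inv_left)+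

lemmas op_cancel = op_inv_right op_inv_left op_inv_right_assoc op_inv_left_assoc

lemma op_inv_diff:
  assumes "op_invertible G" "op_invertible H"
  shows "op_inv G - op_inv H = op_inv H \<odot> (H - G) \<odot> op_inv G"
  using assms by (simp add: op_ring op_cancel)

text \<open>In \<open>H\<^sup>-\<^sup>1 = G\<^sup>-\<^sup>1 + G\<^sup>-\<^sup>1 (G - H) H\<^sup>-\<^sup>1\<close> the last term has at most half the norm of the left side.\<close>

lemma norm_op_inv_le_near:
  assumes G: "op_invertible G" and H: "op_invertible H" and near: "norm (op_inv G) * norm (H - G) \<le> 1 / 2"
  shows "norm (op_inv H) \<le> 2 * norm (op_inv G)"
proof -
  have "norm (op_inv H) = norm (op_inv G + op_inv G \<odot> (G - H) \<odot> op_inv H)"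
    by (simp flip: op_inv_diff[OF H G])
  also have "\<dots> \<le> norm (op_inv G) + norm (op_inv G) * norm (H - G) * norm (op_inv H)"
    by (intro order_trans[OF norm_triangle_ineq] add_left_mono order_trans[OF norm_blinfun_compose]
        mult_right_mono) (auto simp: norm_minus_commute intro!: order_trans[OF norm_blinfun_compose])
  also have "\<dots> \<le> norm (op_inv G) + 1 / 2 * norm (op_inv H)"
    by (intro add_left_mono mult_right_mono near) simp
  finally show ?thesis by simp
qed

lemma op_invertible_id: "op_invertible id_blinfun" and op_inv_id [simp]: "op_inv id_blinfun = id_blinfun"
  by (auto intro: op_invertibleI op_inv_unique)

lemma op_invertible_compose:
  "op_invertible G \<Longrightarrow> op_invertible H \<Longrightarrow> op_invertible (G \<odot> H)"
  and op_inv_compose: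
  "op_invertible G \<Longrightarrow> op_invertible H \<Longrightarrow> op_inv (G \<odot> H) = op_inv H \<odot> op_inv G"
  by (rule op_invertibleI[of _ "op_inv H \<odot> op_inv G"] op_inv_unique;
      simp add: blinfun_compose_assoc op_cancel)+

lemma op_invertible_op_inv: "op_invertible G \<Longrightarrow> op_invertible (op_inv G)"
  and op_inv_op_inv: "op_invertible G \<Longrightarrow> op_inv (op_inv G) = G"
  by (rule op_invertibleI[of _ G] op_inv_unique; simp add: op_cancel)+

lemma op_invertible_scaleR: "op_invertible G \<Longrightarrow> r \<noteq> 0 \<Longrightarrow> op_invertible (r *\<^sub>R G)"
  by (rule op_invertibleI[of _ "(1 / r) *\<^sub>R op_inv G"]) (simp_all add: op_ring op_cancel)

lemma op_inv_scaleR: "op_invertible G \<Longrightarrow> r \<noteq> 0 \<Longrightarrow> op_inv (r *\<^sub>R G) = (1 / r) *\<^sub>R op_inv G"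
  by (rule op_inv_unique) (simp_all add: op_ring op_cancel)

lemma op_inv_commute:
  assumes "op_invertible G" "G \<odot> T = T \<odot> G"
  shows "op_inv G \<odot> T = T \<odot> op_inv G"
  by (metis assms blinfun_compose_assoc blinfun_compose_id op_inv_right op_inv_left)

text \<open>The Neumann series as a fixed point: the map \<open>K \<mapsto> 1 + X K\<close> is a contraction, and looking for the fixed
  point among the operators that commute with \<open>X\<close> makes it a two-sided inverse.\<close>

lemma op_invertible_id_minus:
  fixes X :: "'a::complex_hilbert \<Rightarrow>\<^sub>L 'a"
  assumes "norm X < 1"
  shows "op_invertible (id_blinfun - X)"
proof -
  let ?S = "{K. K \<odot> X = X \<odot> K}"
  have "closed ?S"
    by (intro closed_Collect_eq continuous_intros)
  then have "\<exists>!K\<in>?S. id_blinfun + X \<odot> K = K"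
    using assms
  proof (intro Banach_fix[where c = "norm X"] ballI)
    fix K L :: "'a \<Rightarrow>\<^sub>L 'a"
    show "dist (id_blinfun + X \<odot> K) (id_blinfun + X \<odot> L) \<le> norm X * dist K L"
      by (simp add: dist_norm norm_blinfun_compose flip: op_mult.diff_right)
  qed (auto simp: complete_eq_closed op_ring)
  then obtain K where "K \<odot> X = X \<odot> K" "id_blinfun + X \<odot> K = K" by blast
  then show ?thesis
    by (intro op_invertibleI[of _ K]) (auto simp: op_ring algebra_simps)
qed

text \<open>\<open>H = G (1 - G\<^sup>-\<^sup>1 (G - H))\<close>, and the second factor is invertible for \<open>H\<close> near \<open>G\<close>.\<close>

lemma open_op_invertible: "open {G. op_invertible G}"
  unfolding open_dist
proof (intro ballI)
  fix G :: "'a \<Rightarrow>\<^sub>L 'a" assume "G \<in> {G. op_invertible G}"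
  then have G: "op_invertible G" by simp
  have "op_invertible H" if "dist H G < 1 / (norm (op_inv G) + 1)" for H
  proof -
    have "norm (op_inv G \<odot> (G - H)) \<le> norm (op_inv G) * norm (G - H)" by (rule norm_blinfun_compose)
    also have "\<dots> \<le> (norm (op_inv G) + 1) * norm (G - H)" by (simp add: mult_right_mono)
    also have "\<dots> < 1"
      using that by (simp add: dist_norm norm_minus_commute pos_less_divide_eq add_nonneg_pos mult.commute)
    finally have "op_invertible (G \<odot> (id_blinfun - op_inv G \<odot> (G - H)))"
      by (intro op_invertible_compose G op_invertible_id_minus)
    then show ?thesis using G by (simp add: op_ring op_cancel)
  qed
  then show "\<exists>e>0. \<forall>H. dist H G < e \<longrightarrow> H \<in> {G. op_invertible G}"
    by (intro exI[of _ "1 / (norm (op_inv G) + 1)"]) (auto simp: add_nonneg_pos)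
qed

text \<open>The operator \<open>1 - T\<close> is a square root of \<open>1 - X\<close> iff \<open>T = (X + T\<^sup>2) / 2\<close>, and the right side is a contraction of
  the ball of radius \<open>1/2\<close>, which it maps into itself as \<open>(3/4 + 1/4) / 2 = 1/2\<close>. The set \<open>C\<close> passes on to the root those properties of \<open>X\<close> that the
  iteration preserves, such as symmetry and commutation relations.\<close>

lemma op_sqrt_near_id:
  fixes X :: "'a::complex_hilbert \<Rightarrow>\<^sub>L 'a"
  assumes C: "closed C" "0 \<in> C" "\<And>T. T \<in> C \<Longrightarrow> (1 / 2) *\<^sub>R (X + T \<odot> T) \<in> C"
    and X: "norm X \<le> 3 / 4"
  obtains T where "T \<in> C" "norm T \<le> 1 / 2" "(id_blinfun - T) \<odot> (id_blinfun - T) = id_blinfun - X"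
proof -
  let ?S = "C \<inter> cball 0 (1 / 2)"
  have "\<exists>!T\<in>?S. (1 / 2) *\<^sub>R (X + T \<odot> T) = T"
  proof (intro Banach_fix[where c = "1 / 2"] ballI)
    show "complete ?S" using C(1) by (simp add: complete_eq_closed closed_Int)
    show "(\<lambda>T. (1 / 2) *\<^sub>R (X + T \<odot> T)) ` ?S \<subseteq> ?S"
    proof safe
      fix T :: "'a \<Rightarrow>\<^sub>L 'a" assume "T \<in> C" then show "(1 / 2) *\<^sub>R (X + T \<odot> T) \<in> C" by (rule C)
    next
      fix T :: "'a \<Rightarrow>\<^sub>L 'a" assume "T \<in> cball 0 (1 / 2)"
      then have "norm (T \<odot> T) \<le> 1 / 2 * (1 / 2)"
        by (intro order_trans[OF norm_blinfun_compose] mult_mono) auto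
      then have "norm (X + T \<odot> T) \<le> 1"
        using X norm_triangle_ineq[of X "T \<odot> T"] by linarith
      then show "(1 / 2) *\<^sub>R (X + T \<odot> T) \<in> cball 0 (1 / 2)" by simp
    qed
    fix T R assume T: "T \<in> ?S" and R: "R \<in> ?S"
    have "norm (T \<odot> T - R \<odot> R) = norm (T \<odot> (T - R) + (T - R) \<odot> R)"
      by (simp add: op_ring)
    also have "\<dots> \<le> 1 / 2 * norm (T - R) + norm (T - R) * (1 / 2)"
      using T R by (intro norm_triangle_mono order_trans[OF norm_blinfun_compose] mult_mono) auto
    finally show "dist ((1 / 2) *\<^sub>R (X + T \<odot> T)) ((1 / 2) *\<^sub>R (X + R \<odot> R)) \<le> 1 / 2 * dist T R"
      by (simp add: dist_norm flip: scaleR_diff_right)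
  qed (use C(2) in auto)
  then obtain T where T: "T \<in> ?S" "(1 / 2) *\<^sub>R (X + T \<odot> T) = T" by blast
  have "T + T = X + T \<odot> T" using arg_cong[OF T(2), of "\<lambda>Y. Y + Y"] by (simp flip: scaleR_left_distrib)
  then have "(id_blinfun - T) \<odot> (id_blinfun - T) = id_blinfun - X"
    by (simp add: op_ring algebra_simps)
  then show ?thesis using T(1) that by auto
qed

section \<open>Higher derivatives\<close>

text \<open>The constant in the definition may be negative (if there are no nonzero vectors); the estimates below
  multiply such bounds and need a nonnegative one.\<close>

lemma bounded_multilinear_on_bound:
  assumes "bounded_multilinear_on E n m"
  obtains K where "0 \<le> K"
    and "\<And>vs. set vs \<subseteq> E \<Longrightarrow> length vs = n \<Longrightarrow> norm (m vs) \<le> K * prod_list (map norm vs)"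
proof -
  obtain K where K: "\<And>vs. set vs \<subseteq> E \<and> length vs = n \<longrightarrow> norm (m vs) \<le> K * prod_list (map norm vs)"
    using assms unfolding bounded_multilinear_on_def by blast
  have "norm (m vs) \<le> max K 0 * prod_list (map norm vs)" if "set vs \<subseteq> E" "length vs = n" for vs
  proof -
    have "0 \<le> prod_list (map norm vs)"
      by (rule prod_list_nonneg) auto
    then show ?thesis
      using K[of vs] that by (smt (verit) mult_right_mono)
  qed
  then show ?thesis
    using that[of "max K 0"] by simp
qed

text \<open>One differentiation step of \<open>smooth_on\<close>, for arbitrary maps into \<open>n\<close>-linear maps, so that the rules of
  calculus can be stated for higher derivatives as well.\<close>

definition multi_derivative_on ::
    "'d::real_normed_vector set \<Rightarrow> 'd set \<Rightarrow> nat \<Rightarrow> ('d \<Rightarrow> 'd list \<Rightarrow> 'b::real_normed_vector)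
      \<Rightarrow> ('d \<Rightarrow> 'd list \<Rightarrow> 'b) \<Rightarrow> bool"
  where "multi_derivative_on E U n T T' \<longleftrightarrow>
    (\<forall>x\<in>U. \<forall>e>0. \<exists>d>0. \<forall>y\<in>U. norm (y - x) < d \<longrightarrow>
      (\<forall>vs. set vs \<subseteq> E \<and> length vs = n \<longrightarrow>
        norm (T y vs - T x vs - T' x ((y - x) # vs)) \<le> e * norm (y - x) * prod_list (map norm vs)))"

definition derivative_tower ::
    "'d::real_normed_vector set \<Rightarrow> 'd set \<Rightarrow> (nat \<Rightarrow> 'd \<Rightarrow> 'd list \<Rightarrow> 'b::real_normed_vector) \<Rightarrow> bool"
  where "derivative_tower E U D \<longleftrightarrow>
    (\<forall>n. \<forall>x\<in>U. bounded_multilinear_on E n (D n x)) \<and>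
    (\<forall>n. multi_derivative_on E U n (D n) (D (Suc n)))"

lemma smooth_on_iff_tower:
  "smooth_on E U f \<longleftrightarrow> (\<exists>D. derivative_tower E U D \<and> (\<forall>x\<in>U. D 0 x [] = f x))"
  unfolding smooth_on_def derivative_tower_def multi_derivative_on_def by blast

lemma multi_derivative_onD:
  assumes "multi_derivative_on E U n T T'" "x \<in> U" "0 < e"
  obtains d where "0 < d" "\<And>y vs. y \<in> U \<Longrightarrow> norm (y - x) < d \<Longrightarrow> set vs \<subseteq> E \<Longrightarrow> length vs = n \<Longrightarrow>
    norm (T y vs - T x vs - T' x ((y - x) # vs)) \<le> e * norm (y - x) * prod_list (map norm vs)"
  using assms unfolding multi_derivative_on_def by meson

text \<open>Continuity of \<open>T\<close> in the quantitative form in which it enters the remainders of the product rule and of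
  the rule for inverses.\<close>

lemma multi_derivative_on_locally_lipschitz:
  assumes E: "subspace E" "U \<subseteq> E"
    and T': "\<And>x. x \<in> U \<Longrightarrow> bounded_multilinear_on E (Suc n) (T' x)"
    and der: "multi_derivative_on E U n T T'" and x: "x \<in> U"
  obtains C d where "0 \<le> C" "0 < d"
    "\<And>y vs. y \<in> U \<Longrightarrow> norm (y - x) < d \<Longrightarrow> set vs \<subseteq> E \<Longrightarrow> length vs = n \<Longrightarrow>
      norm (T y vs - T x vs) \<le> C * norm (y - x) * prod_list (map norm vs)"
proof -
  obtain K where K: "0 \<le> K" "\<And>vs. set vs \<subseteq> E \<Longrightarrow> length vs = Suc n \<Longrightarrow> norm (T' x vs) \<le> K * prod_list (map norm vs)"
    using bounded_multilinear_on_bound[OF T'[OF x]] by metis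
  obtain d where d: "0 < d" "\<And>y vs. y \<in> U \<Longrightarrow> norm (y - x) < d \<Longrightarrow> set vs \<subseteq> E \<Longrightarrow> length vs = n \<Longrightarrow>
    norm (T y vs - T x vs - T' x ((y - x) # vs)) \<le> 1 * norm (y - x) * prod_list (map norm vs)"
    using multi_derivative_onD[OF der x zero_less_one] by metis
  have "norm (T y vs - T x vs) \<le> (1 + K) * norm (y - x) * prod_list (map norm vs)"
    if "y \<in> U" "norm (y - x) < d" "set vs \<subseteq> E" "length vs = n" for y vs
  proof -
    have "y - x \<in> E"
      using E x that(1) by (meson subspace_diff subsetD)
    then have "norm (T' x ((y - x) # vs)) \<le> K * prod_list (map norm ((y - x) # vs))"
      using that by (intro K) auto
    then show ?thesis
      using d(2)[OF that] norm_triangle_sub[of "T y vs - T x vs" "T' x ((y - x) # vs)"]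
      by (simp add: algebra_simps)
  qed
  then show ?thesis
    using that[of "1 + K" d] K(1) d(1) by simp
qed

text \<open>Every chart below is smooth on an open set of the whole operator space; this lemma restricts it to the
  Banach space in question.\<close>

lemma smooth_on_subset:
  assumes "smooth_on E U f" "E' \<subseteq> E" "U' \<subseteq> U"
  shows "smooth_on E' U' f"
proof -
  obtain D where D: "derivative_tower E U D" "\<forall>x\<in>U. D 0 x [] = f x"
    using assms(1) smooth_on_iff_tower by blast
  have "bounded_multilinear_on E' n m" if "bounded_multilinear_on E n m" for n and m :: "'a list \<Rightarrow> 'b"
    using that assms(2) unfolding bounded_multilinear_on_def
    by (smt (verit, best) subset_iff)
  moreover have "multi_derivative_on E' U' n T T'" if "multi_derivative_on E U n T T'" for n T and T' :: "'a \<Rightarrow> 'a list \<Rightarrow> 'b"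
    using that assms(2,3) unfolding multi_derivative_on_def
    by (smt (verit, best) subset_iff)
  ultimately have "derivative_tower E' U' D"
    using D(1) assms(3) unfolding derivative_tower_def by blast
  then show ?thesis
    using D(2) assms(3) smooth_on_iff_tower by (metis subset_iff)
qed

lemma smooth_on_cong:
  assumes "smooth_on E U f" "\<And>x. x \<in> U \<Longrightarrow> f x = g x"
  shows "smooth_on E U g"
  using assms unfolding smooth_on_iff_tower by metis

lemma smooth_on_imp_continuous_on:
  assumes "smooth_on UNIV U f"
  shows "continuous_on U f"
proof -
  obtain D where D: "derivative_tower UNIV U D" "\<forall>x\<in>U. D 0 x [] = f x"
    using assms smooth_on_iff_tower by blast
  have "\<exists>d>0. \<forall>y\<in>U. dist y x < d \<longrightarrow> dist (f y) (f x) < e" if x: "x \<in> U" and e: "0 < e" for x e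
  proof -
    obtain C d where C: "0 \<le> C" "0 < d"
      "\<And>y vs. y \<in> U \<Longrightarrow> norm (y - x) < d \<Longrightarrow> set vs \<subseteq> UNIV \<Longrightarrow> length vs = 0 \<Longrightarrow>
      norm (D 0 y vs - D 0 x vs) \<le> C * norm (y - x) * prod_list (map norm vs)"
      by (rule multi_derivative_on_locally_lipschitz[of UNIV U 0 "D (Suc 0)" "D 0" x])
        (use D(1) x in \<open>auto simp: derivative_tower_def\<close>)
    have "dist (f y) (f x) < e" if y: "y \<in> U" "dist y x < min d (e / (C + 1))" for y
    proof -
      have "norm (f y - f x) \<le> C * norm (y - x)"
        using C(3)[of y "[]"] y D(2) x by (simp add: dist_norm)
      also have "\<dots> \<le> (C + 1) * norm (y - x)"
        by (simp add: mult_right_mono)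
      also have "\<dots> < e"
        using y(2) C(1) by (simp add: dist_norm pos_less_divide_eq mult.commute)
      finally show ?thesis
        by (simp add: dist_norm)
    qed
    then show ?thesis
      using C(1,2) e by (intro exI[of _ "min d (e / (C + 1))"]) auto
  qed
  then show ?thesis
    by (auto simp: continuous_on_iff)
qed

lemma smooth_on_bounded_linear:
  fixes L :: "'d::real_normed_vector \<Rightarrow> 'b::real_normed_vector"
  assumes "bounded_linear L"
  shows "smooth_on UNIV U L"
proof -
  interpret bounded_linear L by fact
  define D where "D n x vs = (if n = 0 then L x else if n = 1 then L (hd vs) else 0)"
    for n :: nat and x :: 'd and vs :: "'d list"
  have "bounded_multilinear_on UNIV n (D n x)" for n x
    unfolding bounded_multilinear_on_def
  proof (intro conjI allI impI ballI)
    fix us vs :: "'d list" and x' y and c :: real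
    assume *: "set us \<subseteq> UNIV \<and> set vs \<subseteq> UNIV \<and> Suc (length us + length vs) = n"
    show "D n x (us @ (x' + y) # vs) = D n x (us @ x' # vs) + D n x (us @ y # vs)"
      "D n x (us @ (c *\<^sub>R x') # vs) = c *\<^sub>R D n x (us @ x' # vs)"
      using * by (auto simp: D_def add scaleR)
  next
    obtain K where K: "\<And>v. norm (L v) \<le> norm v * K" using bounded by blast
    consider "n = 0" | "n = 1" | "n > 1" by linarith
    then show "\<exists>K. \<forall>vs. set vs \<subseteq> UNIV \<and> length vs = n \<longrightarrow> norm (D n x vs) \<le> K * prod_list (map norm vs)"
    proof cases
      case 2
      then show ?thesis
        using K by (intro exI[of _ K]) (auto simp: D_def length_Suc_conv mult.commute)
    qed (auto simp: D_def intro: exI[of _ "norm (L x)"] exI[of _ 0])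
  qed
  moreover have "multi_derivative_on UNIV U n (D n) (D (Suc n))" for n
  proof -
    have "D n y vs - D n x vs - D (Suc n) x ((y - x) # vs) = 0" for x y vs
      by (simp add: D_def diff)
    then show ?thesis
      unfolding multi_derivative_on_def by (auto intro!: exI[of _ 1] mult_nonneg_nonneg prod_list_nonneg)
  qed
  ultimately have "derivative_tower UNIV U D"
    by (auto simp: derivative_tower_def)
  then show ?thesis
    unfolding smooth_on_iff_tower by (auto simp: D_def intro!: exI[of _ D])
qed

lemma derivative_tower_const:
  "derivative_tower E U (\<lambda>n x vs. if n = 0 then c else 0)"
proof -
  have "bounded_multilinear_on E n (\<lambda>vs. if n = 0 then c else 0)" for n
    unfolding bounded_multilinear_on_def
    by (auto intro!: exI[of _ "norm c"] mult_nonneg_nonneg prod_list_nonneg)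
  moreover have "multi_derivative_on E U n (\<lambda>x vs. if n = 0 then c else 0) (\<lambda>x vs. if Suc n = 0 then c else 0)" for n
    unfolding multi_derivative_on_def by (auto intro!: exI[of _ 1] mult_nonneg_nonneg prod_list_nonneg)
  ultimately show ?thesis
    by (auto simp: derivative_tower_def)
qed

lemma smooth_on_const: "smooth_on E U (\<lambda>x. c)"
  unfolding smooth_on_iff_tower using derivative_tower_const by fastforce

lemma smooth_on_id: "smooth_on UNIV U (\<lambda>x. x)"
  by (rule smooth_on_bounded_linear[OF bounded_linear_ident])

lemma multi_derivative_on_cong:
  assumes "multi_derivative_on E U n T T'" "subspace E" "U \<subseteq> E"
    "\<And>x vs. x \<in> U \<Longrightarrow> set vs \<subseteq> E \<Longrightarrow> length vs = Suc n \<Longrightarrow> T' x vs = T'' x vs"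
  shows "multi_derivative_on E U n T T''"
proof -
  have "T' x ((y - x) # vs) = T'' x ((y - x) # vs)" if "x \<in> U" "y \<in> U" "set vs \<subseteq> E" "length vs = n" for x y vs
    using that assms(2,3) by (intro assms(4)) (auto intro: subspace_diff)
  then show ?thesis
    using assms(1) unfolding multi_derivative_on_def by (smt (verit, del_insts))
qed

section \<open>Smoothness of sums, products and inverses\<close>

text \<open>The arguments of a product of two multilinear maps are dealt out by a list of labels, \<open>True\<close> for the
  left factor and \<open>False\<close> for the right one. A differentiation puts its direction in front of all
  arguments, whichever factor it concerns, so splitting the argument list into a prefix and a suffix
  would not be preserved.\<close>

definition pick :: "bool \<Rightarrow> bool list \<Rightarrow> 'd list \<Rightarrow> 'd list"
  where "pick b bs vs = map snd (filter (\<lambda>p. fst p = b) (zip bs vs))"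

lemma pick_Cons [simp]: "pick b (c # bs) (v # vs) = (if c = b then v # pick b bs vs else pick b bs vs)"
  and pick_Nil [simp]: "pick b [] vs = []"
  by (simp_all add: pick_def)

lemma length_pick: "length bs = length vs \<Longrightarrow> length (pick b bs vs) = count_list bs b"
  by (induction bs vs rule: list_induct2) auto

lemma set_pick: "set vs \<subseteq> E \<Longrightarrow> set (pick b bs vs) \<subseteq> E"
  using set_zip_rightD by (fastforce simp: pick_def)

lemma pick_append:
  "length bs = length us \<Longrightarrow> pick b (bs @ cs) (us @ vs) = pick b bs us @ pick b cs vs"
  by (simp add: pick_def)

lemma prod_list_pick:
  "length bs = length vs \<Longrightarrow>
    prod_list (map norm vs) = prod_list (map norm (pick True bs vs)) * prod_list (map norm (pick False bs vs))"
  by (induction bs vs rule: list_induct2) auto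

lemma count_list_bool: "count_list bs True + count_list bs False = length bs"
  by (induction bs) auto

definition op_product ::
    "bool list \<Rightarrow> ('d \<Rightarrow> 'd list \<Rightarrow> ('a::complex_hilbert \<Rightarrow>\<^sub>L 'a)) \<Rightarrow> ('d \<Rightarrow> 'd list \<Rightarrow> ('a \<Rightarrow>\<^sub>L 'a))
      \<Rightarrow> 'd \<Rightarrow> 'd list \<Rightarrow> ('a \<Rightarrow>\<^sub>L 'a)"
  where "op_product bs T S x vs = T x (pick True bs vs) \<odot> S x (pick False bs vs)"

lemma bounded_multilinear_on_op_product:
  assumes T: "bounded_multilinear_on E n (T x)" and S: "bounded_multilinear_on E m (S x)"
    and bs: "count_list bs True = n" "count_list bs False = m"
  shows "bounded_multilinear_on E (n + m) (op_product bs T S x)"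
proof -
  have len: "length bs = n + m" using bs count_list_bool[of bs] by simp
  have lin: "(\<forall>v\<in>E. \<forall>w\<in>E. op_product bs T S x (us @ (v + w) # vs) =
        op_product bs T S x (us @ v # vs) + op_product bs T S x (us @ w # vs)) \<and>
      (\<forall>c. \<forall>v\<in>E. op_product bs T S x (us @ (c *\<^sub>R v) # vs) = c *\<^sub>R op_product bs T S x (us @ v # vs))"
    if *: "set us \<subseteq> E" "set vs \<subseteq> E" "Suc (length us + length vs) = n + m" for us vs
  proof -
    obtain b1 b b2 where b: "bs = b1 @ b # b2" "length b1 = length us"
      using * len by (metis id_take_nth_drop length_take less_add_Suc1 min.absorb4)
    then have len2: "length b2 = length vs" using * len by simp
    note E = set_pick[OF *(1)] set_pick[OF *(2)]
    note l = length_pick[OF b(2)] length_pick[OF len2]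
    show ?thesis
    proof (cases b)
      case True
      then have "Suc (length (pick True b1 us) + length (pick True b2 vs)) = n"
        using bs b l by simp
      then have "(\<forall>v\<in>E. \<forall>w\<in>E. T x (pick True b1 us @ (v + w) # pick True b2 vs) =
          T x (pick True b1 us @ v # pick True b2 vs) + T x (pick True b1 us @ w # pick True b2 vs)) \<and>
          (\<forall>c. \<forall>v\<in>E. T x (pick True b1 us @ (c *\<^sub>R v) # pick True b2 vs) = c *\<^sub>R T x (pick True b1 us @ v # pick True b2 vs))"
        using T E unfolding bounded_multilinear_on_def by blast
      then show ?thesis
        using True b(2) by (simp add: op_product_def b(1) pick_append op_mult.add_left op_mult.scaleR_left)
    next
      case False
      then have "Suc (length (pick False b1 us) + length (pick False b2 vs)) = m"
        using bs b l by simp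
      then have "(\<forall>v\<in>E. \<forall>w\<in>E. S x (pick False b1 us @ (v + w) # pick False b2 vs) =
          S x (pick False b1 us @ v # pick False b2 vs) + S x (pick False b1 us @ w # pick False b2 vs)) \<and>
          (\<forall>c. \<forall>v\<in>E. S x (pick False b1 us @ (c *\<^sub>R v) # pick False b2 vs) = c *\<^sub>R S x (pick False b1 us @ v # pick False b2 vs))"
        using S E unfolding bounded_multilinear_on_def by blast
      then show ?thesis
        using False b(2) by (simp add: op_product_def b(1) pick_append op_mult.add_right op_mult.scaleR_right)
    qed
  qed
  obtain K where K: "0 \<le> K" "\<And>vs. set vs \<subseteq> E \<Longrightarrow> length vs = n \<Longrightarrow> norm (T x vs) \<le> K * prod_list (map norm vs)"
    using bounded_multilinear_on_bound[OF T] by metis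
  obtain L where L: "0 \<le> L" "\<And>vs. set vs \<subseteq> E \<Longrightarrow> length vs = m \<Longrightarrow> norm (S x vs) \<le> L * prod_list (map norm vs)"
    using bounded_multilinear_on_bound[OF S] by metis
  have "norm (op_product bs T S x vs) \<le> (K * L) * prod_list (map norm vs)" if "set vs \<subseteq> E" "length vs = n + m" for vs
  proof -
    have lv: "length bs = length vs" using that len by simp
    have "norm (op_product bs T S x vs) \<le> norm (T x (pick True bs vs)) * norm (S x (pick False bs vs))"
      unfolding op_product_def by (rule norm_blinfun_compose)
    also have "\<dots> \<le> (K * prod_list (map norm (pick True bs vs))) * (L * prod_list (map norm (pick False bs vs)))"
      using K L set_pick[OF that(1)] length_pick[OF lv] bs
      by (intro mult_mono) (auto intro!: mult_nonneg_nonneg prod_list_nonneg)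
    also have "\<dots> = (K * L) * prod_list (map norm vs)"
      by (simp add: prod_list_pick[OF lv])
    finally show ?thesis .
  qed
  then show ?thesis
    using lin unfolding bounded_multilinear_on_def by blast
qed

lemma bounded_multilinear_on_add:
  assumes "bounded_multilinear_on E n f" "bounded_multilinear_on E n g"
  shows "bounded_multilinear_on E n (\<lambda>vs. f vs + g vs)"
proof -
  obtain K where K: "\<And>vs. set vs \<subseteq> E \<Longrightarrow> length vs = n \<Longrightarrow> norm (f vs) \<le> K * prod_list (map norm vs)"
    using bounded_multilinear_on_bound[OF assms(1)] by metis
  obtain L where L: "\<And>vs. set vs \<subseteq> E \<Longrightarrow> length vs = n \<Longrightarrow> norm (g vs) \<le> L * prod_list (map norm vs)"
    using bounded_multilinear_on_bound[OF assms(2)] by metis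
  have "norm (f vs + g vs) \<le> (K + L) * prod_list (map norm vs)" if "set vs \<subseteq> E" "length vs = n" for vs
    using K[OF that] L[OF that] norm_triangle_ineq[of "f vs" "g vs"] by (simp add: distrib_right)
  moreover have "(\<forall>us vs. set us \<subseteq> E \<and> set vs \<subseteq> E \<and> Suc (length us + length vs) = n \<longrightarrow>
       (\<forall>x\<in>E. \<forall>y\<in>E. f (us @ (x + y) # vs) + g (us @ (x + y) # vs) = f (us @ x # vs) + g (us @ x # vs) + (f (us @ y # vs) + g (us @ y # vs))) \<and>
       (\<forall>c. \<forall>x\<in>E. f (us @ (c *\<^sub>R x) # vs) + g (us @ (c *\<^sub>R x) # vs) = c *\<^sub>R (f (us @ x # vs) + g (us @ x # vs))))"
    using assms unfolding bounded_multilinear_on_def by (auto simp: algebra_simps)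
  ultimately show ?thesis
    unfolding bounded_multilinear_on_def by blast
qed

lemma mult_quotient_le_half: "0 \<le> k \<Longrightarrow> 0 < e \<Longrightarrow> k * (e / 2 / (k + 1)) \<le> (e::real) / 2"
  by (simp add: field_simps)

text \<open>The Leibniz rule; the label of the new direction tells which factor is differentiated.\<close>

lemma multi_derivative_on_op_product:
  assumes E: "subspace E" "U \<subseteq> E"
    and T: "\<And>x. x \<in> U \<Longrightarrow> bounded_multilinear_on E n (T x)"
    and T': "\<And>x. x \<in> U \<Longrightarrow> bounded_multilinear_on E (Suc n) (T' x)"
    and dT: "multi_derivative_on E U n T T'"
    and S: "\<And>x. x \<in> U \<Longrightarrow> bounded_multilinear_on E m (S x)"
    and S': "\<And>x. x \<in> U \<Longrightarrow> bounded_multilinear_on E (Suc m) (S' x)"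
    and dS: "multi_derivative_on E U m S S'"
    and bs: "count_list bs True = n" "count_list bs False = m"
  shows "multi_derivative_on E U (n + m) (op_product bs T S)
    (\<lambda>x vs. op_product (True # bs) T' S x vs + op_product (False # bs) T S' x vs)"
  unfolding multi_derivative_on_def
proof (intro ballI allI impI)
  fix x and e :: real
  assume x: "x \<in> U" and e: "0 < e"
  obtain K where K: "0 \<le> K" "\<And>vs. set vs \<subseteq> E \<Longrightarrow> length vs = n \<Longrightarrow> norm (T x vs) \<le> K * prod_list (map norm vs)"
    using bounded_multilinear_on_bound[OF T[OF x]] by metis
  obtain L where L: "0 \<le> L" "\<And>vs. set vs \<subseteq> E \<Longrightarrow> length vs = m \<Longrightarrow> norm (S x vs) \<le> L * prod_list (map norm vs)"
    using bounded_multilinear_on_bound[OF S[OF x]] by metis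
  obtain C1 d1 where C1: "0 \<le> C1" "0 < d1"
    "\<And>y vs. y \<in> U \<Longrightarrow> norm (y - x) < d1 \<Longrightarrow> set vs \<subseteq> E \<Longrightarrow> length vs = n \<Longrightarrow>
      norm (T y vs - T x vs) \<le> C1 * norm (y - x) * prod_list (map norm vs)"
    using multi_derivative_on_locally_lipschitz[OF E T' dT x] by metis
  obtain C2 d2 where C2: "0 \<le> C2" "0 < d2"
    "\<And>y vs. y \<in> U \<Longrightarrow> norm (y - x) < d2 \<Longrightarrow> set vs \<subseteq> E \<Longrightarrow> length vs = m \<Longrightarrow>
      norm (S y vs - S x vs) \<le> C2 * norm (y - x) * prod_list (map norm vs)"
    using multi_derivative_on_locally_lipschitz[OF E S' dS x] by metis
  (* one half of e is for the two remainders of first order, the other half for the product of the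
     increments of T and S *)
  define e1 where "e1 = e / 2 / (K + L + 1)"
  have e1: "0 < e1" "e1 * (K + L) \<le> e / 2"
    using e K(1) L(1) by (auto simp: e1_def field_simps)
  obtain d3 where d3: "0 < d3" "\<And>y vs. y \<in> U \<Longrightarrow> norm (y - x) < d3 \<Longrightarrow> set vs \<subseteq> E \<Longrightarrow> length vs = n \<Longrightarrow>
    norm (T y vs - T x vs - T' x ((y - x) # vs)) \<le> e1 * norm (y - x) * prod_list (map norm vs)"
    using multi_derivative_onD[OF dT x e1(1)] by metis
  obtain d4 where d4: "0 < d4" "\<And>y vs. y \<in> U \<Longrightarrow> norm (y - x) < d4 \<Longrightarrow> set vs \<subseteq> E \<Longrightarrow> length vs = m \<Longrightarrow>
    norm (S y vs - S x vs - S' x ((y - x) # vs)) \<le> e1 * norm (y - x) * prod_list (map norm vs)"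
    using multi_derivative_onD[OF dS x e1(1)] by metis
  define d5 where "d5 = e / 2 / (C1 * C2 + 1)"
  have C12: "0 \<le> C1 * C2" using C1(1) C2(1) by simp
  have d5: "0 < d5" using e C12 by (simp add: d5_def)
  define d where "d = Min {d1, d2, d3, d4, d5}"
  show "\<exists>d>0. \<forall>y\<in>U. norm (y - x) < d \<longrightarrow> (\<forall>vs. set vs \<subseteq> E \<and> length vs = n + m \<longrightarrow>
      norm (op_product bs T S y vs - op_product bs T S x vs -
        (op_product (True # bs) T' S x ((y - x) # vs) + op_product (False # bs) T S' x ((y - x) # vs)))
      \<le> e * norm (y - x) * prod_list (map norm vs))"
  proof (intro exI[of _ d] conjI ballI allI impI)
    show "0 < d" using C1 C2 d3 d4 d5 by (simp add: d_def)
    fix y vs assume y: "y \<in> U" "norm (y - x) < d" and vs: "set vs \<subseteq> E \<and> length vs = n + m"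
    have lv: "length bs = length vs" using vs bs count_list_bool[of bs] by simp
    define a where "a = pick True bs vs"
    define b where "b = pick False bs vs"
    have a: "set a \<subseteq> E" "length a = n" and b: "set b \<subseteq> E" "length b = m"
      using set_pick[of vs E] vs length_pick[OF lv] bs by (simp_all add: a_def b_def)
    define \<alpha> where "\<alpha> = prod_list (map norm a)"
    define \<beta> where "\<beta> = prod_list (map norm b)"
    have ab: "0 \<le> \<alpha>" "0 \<le> \<beta>" unfolding \<alpha>_def \<beta>_def by (auto intro!: prod_list_nonneg)
    define h where "h = norm (y - x)"
    have h: "0 \<le> h" "C1 * C2 * h \<le> e / 2"
    proof -
      show "0 \<le> h" by (simp add: h_def)
      have "h \<le> d5" using y(2) by (simp add: h_def d_def)
      then have "C1 * C2 * h \<le> C1 * C2 * d5" using C12 by (rule mult_left_mono)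
      also have "\<dots> \<le> e / 2" unfolding d5_def by (rule mult_quotient_le_half[OF C12 e])
      finally show "C1 * C2 * h \<le> e / 2" .
    qed
    have eq: "op_product bs T S y vs - op_product bs T S x vs -
        (op_product (True # bs) T' S x ((y - x) # vs) + op_product (False # bs) T S' x ((y - x) # vs))
      = (T y a - T x a - T' x ((y - x) # a)) \<odot> S x b + T x a \<odot> (S y b - S x b - S' x ((y - x) # b))
        + (T y a - T x a) \<odot> (S y b - S x b)"
      by (simp add: op_product_def a_def b_def op_ring)
    have "norm (\<dots>) \<le> (e1 * h * \<alpha>) * (L * \<beta>) + (K * \<alpha>) * (e1 * h * \<beta>) + (C1 * h * \<alpha>) * (C2 * h * \<beta>)"
      using y d3(2)[OF _ _ a, of y] d4(2)[OF _ _ b, of y] K(2)[OF a] L(2)[OF b] C1(3)[OF _ _ a, of y] C2(3)[OF _ _ b, of y]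
      unfolding \<alpha>_def[symmetric] \<beta>_def[symmetric] h_def[symmetric]
      by (intro norm_triangle_mono order_trans[OF norm_blinfun_compose] mult_mono)
        (auto simp: d_def ab h K L e1 C1 C2 less_imp_le intro!: mult_nonneg_nonneg)
    also have "\<dots> = (e1 * (K + L) + C1 * C2 * h) * (h * (\<alpha> * \<beta>))"
      by (simp add: algebra_simps)
    also have "\<dots> \<le> e * (h * (\<alpha> * \<beta>))"
      using e1(2) h(2) by (intro mult_right_mono) (auto simp: h(1) ab)
    finally show "norm (op_product bs T S y vs - op_product bs T S x vs -
        (op_product (True # bs) T' S x ((y - x) # vs) + op_product (False # bs) T S' x ((y - x) # vs)))
      \<le> e * norm (y - x) * prod_list (map norm vs)"
      unfolding eq by (simp add: prod_list_pick[OF lv] a_def b_def \<alpha>_def \<beta>_def h_def mult.assoc)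
  qed
qed

lemma multi_derivative_on_add:
  assumes "multi_derivative_on E U n T T'" "multi_derivative_on E U n S S'"
  shows "multi_derivative_on E U n (\<lambda>x vs. T x vs + S x vs) (\<lambda>x vs. T' x vs + S' x vs)"
  unfolding multi_derivative_on_def
proof (intro ballI allI impI)
  fix x and e :: real
  assume x: "x \<in> U" and e: "0 < e"
  then have e2: "0 < e / 2" by simp
  obtain d1 where d1: "0 < d1" "\<And>y vs. y \<in> U \<Longrightarrow> norm (y - x) < d1 \<Longrightarrow> set vs \<subseteq> E \<Longrightarrow> length vs = n \<Longrightarrow>
    norm (T y vs - T x vs - T' x ((y - x) # vs)) \<le> e / 2 * norm (y - x) * prod_list (map norm vs)"
    using multi_derivative_onD[OF assms(1) x e2] by metis
  obtain d2 where d2: "0 < d2" "\<And>y vs. y \<in> U \<Longrightarrow> norm (y - x) < d2 \<Longrightarrow> set vs \<subseteq> E \<Longrightarrow> length vs = n \<Longrightarrow>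
    norm (S y vs - S x vs - S' x ((y - x) # vs)) \<le> e / 2 * norm (y - x) * prod_list (map norm vs)"
    using multi_derivative_onD[OF assms(2) x e2] by metis
  have "norm (T y vs + S y vs - (T x vs + S x vs) - (T' x ((y - x) # vs) + S' x ((y - x) # vs)))
      \<le> e * norm (y - x) * prod_list (map norm vs)"
    if "y \<in> U" "norm (y - x) < min d1 d2" "set vs \<subseteq> E \<and> length vs = n" for y vs
  proof -
    have "norm ((T y vs - T x vs - T' x ((y - x) # vs)) + (S y vs - S x vs - S' x ((y - x) # vs)))
      \<le> e / 2 * norm (y - x) * prod_list (map norm vs) + e / 2 * norm (y - x) * prod_list (map norm vs)"
      using that by (intro norm_triangle_mono d1 d2) auto
    then show ?thesis by (simp add: algebra_simps)
  qed
  then show "\<exists>d>0. \<forall>y\<in>U. norm (y - x) < d \<longrightarrow> (\<forall>vs. set vs \<subseteq> E \<and> length vs = n \<longrightarrow>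
      norm (T y vs + S y vs - (T x vs + S x vs) - (T' x ((y - x) # vs) + S' x ((y - x) # vs)))
      \<le> e * norm (y - x) * prod_list (map norm vs))"
    using d1(1) d2(1) by (intro exI[of _ "min d1 d2"]) auto
qed

text \<open>The derivative of \<open>T\<^sup>-\<^sup>1\<close> is \<open>- T\<^sup>-\<^sup>1 T' T\<^sup>-\<^sup>1\<close>. With \<open>\<Delta> = T y - T x\<close> the remainder is
  \<open>T x\<^sup>-\<^sup>1 (T' - \<Delta>) T x\<^sup>-\<^sup>1 + T y\<^sup>-\<^sup>1 \<Delta> T x\<^sup>-\<^sup>1 \<Delta> T x\<^sup>-\<^sup>1\<close>: the first term is small by differentiability of \<open>T\<close>, the second
  one is quadratic in \<open>\<Delta>\<close>.\<close>

lemma multi_derivative_on_op_inv: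
  assumes E: "subspace E" "U \<subseteq> E"
    and T': "\<And>x. x \<in> U \<Longrightarrow> bounded_multilinear_on E (Suc 0) (T' x)"
    and dT: "multi_derivative_on E U 0 T T'"
    and inv: "\<And>x. x \<in> U \<Longrightarrow> op_invertible (T x [])"
  shows "multi_derivative_on E U 0 (\<lambda>x vs. op_inv (T x []))
    (\<lambda>x vs. - (op_inv (T x []) \<odot> T' x vs \<odot> op_inv (T x [])))"
  unfolding multi_derivative_on_def
proof (intro ballI allI impI)
  fix x and e :: real
  assume x: "x \<in> U" and e: "0 < e"
  let ?g = "\<lambda>x. op_inv (T x [])"
  define c where "c = norm (?g x)"
  have c: "0 \<le> c" by (simp add: c_def)
  obtain C d1 where C: "0 \<le> C" "0 < d1"
    "\<And>y vs. y \<in> U \<Longrightarrow> norm (y - x) < d1 \<Longrightarrow> set vs \<subseteq> E \<Longrightarrow> length vs = 0 \<Longrightarrow>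
      norm (T y vs - T x vs) \<le> C * norm (y - x) * prod_list (map norm vs)"
    using multi_derivative_on_locally_lipschitz[OF E T' dT x] by metis
  define e1 where "e1 = e / 2 / (c * c + 1)"
  have e1: "0 < e1"
    using e c by (simp add: e1_def add_nonneg_pos)
  have e1': "c * c * e1 \<le> e / 2"
    unfolding e1_def by (rule mult_quotient_le_half) (use e in auto)
  obtain d2 where d2: "0 < d2" "\<And>y vs. y \<in> U \<Longrightarrow> norm (y - x) < d2 \<Longrightarrow> set vs \<subseteq> E \<Longrightarrow> length vs = 0 \<Longrightarrow>
    norm (T y vs - T x vs - T' x ((y - x) # vs)) \<le> e1 * norm (y - x) * prod_list (map norm vs)"
    using multi_derivative_onD[OF dT x e1(1)] by metis
  define M where "M = 2 * c * C * c * C * c"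
  have M: "0 \<le> M" using c C(1) by (simp add: M_def)
  define d where "d = Min {d1, d2, 1 / 2 / (c * C + 1), e / 2 / (M + 1)}"
  have cC: "0 \<le> c * C" using c C(1) by simp
  show "\<exists>d>0. \<forall>y\<in>U. norm (y - x) < d \<longrightarrow> (\<forall>vs. set vs \<subseteq> E \<and> length vs = 0 \<longrightarrow>
      norm (?g y - ?g x - - (?g x \<odot> T' x ((y - x) # vs) \<odot> ?g x)) \<le> e * norm (y - x) * prod_list (map norm vs))"
  proof (intro exI[of _ d] conjI ballI allI impI)
    show "0 < d" using C(2) d2(1) e M cC by (simp add: d_def)
    fix y vs assume y: "y \<in> U" "norm (y - x) < d" and vs: "set vs \<subseteq> E \<and> length vs = 0"
    define h where "h = norm (y - x)"
    define \<Delta> where "\<Delta> = T y [] - T x []"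
    define t where "t = T' x [y - x]"
    have h: "0 \<le> h" "c * (C * h) \<le> 1 / 2" "M * h \<le> e / 2"
    proof -
      show h0: "0 \<le> h" by (simp add: h_def)
      have "h \<le> 1 / 2 / (c * C + 1)" using y(2) by (simp add: h_def d_def)
      then have "c * C * h \<le> c * C * (1 / 2 / (c * C + 1))" using cC by (rule mult_left_mono)
      also have "\<dots> \<le> 1 / 2" by (rule mult_quotient_le_half[OF cC zero_less_one])
      finally show "c * (C * h) \<le> 1 / 2" by (simp add: mult.assoc)
      have "h \<le> e / 2 / (M + 1)" using y(2) by (simp add: h_def d_def)
      then have "M * h \<le> M * (e / 2 / (M + 1))" using M by (rule mult_left_mono)
      also have "\<dots> \<le> e / 2" by (rule mult_quotient_le_half[OF M e])
      finally show "M * h \<le> e / 2" .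
    qed
    have \<Delta>: "norm \<Delta> \<le> C * h"
      using C(3)[of y "[]"] y by (simp add: \<Delta>_def h_def d_def)
    have t: "norm (t - \<Delta>) \<le> e1 * h"
      using d2(2)[of y "[]"] y by (simp add: \<Delta>_def h_def d_def t_def norm_minus_commute)
    have gy: "norm (?g y) \<le> 2 * c"
      unfolding c_def
    proof (rule norm_op_inv_le_near[OF inv[OF x] inv[OF y(1)]])
      have "norm (?g x) * norm (T y [] - T x []) \<le> c * (C * h)"
        using \<Delta> c by (intro mult_mono) (auto simp: c_def \<Delta>_def)
      then show "norm (?g x) * norm (T y [] - T x []) \<le> 1 / 2" using h(2) by linarith
    qed
    have "?g x - ?g y = ?g y \<odot> \<Delta> \<odot> ?g x"
      using op_inv_diff[OF inv[OF x] inv[OF y(1)]] by (simp add: \<Delta>_def)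
    then have eq: "?g y - ?g x - - (?g x \<odot> t \<odot> ?g x)
      = ?g x \<odot> (t - \<Delta>) \<odot> ?g x + ?g y \<odot> \<Delta> \<odot> ?g x \<odot> \<Delta> \<odot> ?g x"
    proof -
      assume *: "?g x - ?g y = ?g y \<odot> \<Delta> \<odot> ?g x"
      have "?g y \<odot> \<Delta> \<odot> ?g x \<odot> \<Delta> \<odot> ?g x = (?g x - ?g y) \<odot> \<Delta> \<odot> ?g x"
        by (simp add: *)
      also have "\<dots> = ?g x \<odot> \<Delta> \<odot> ?g x - (?g x - ?g y)"
        by (simp add: op_mult.diff_left *[symmetric])
      finally show ?thesis by (simp add: op_ring)
    qed
    have "norm (\<dots>) \<le> c * (e1 * h) * c + 2 * c * (C * h) * c * (C * h) * c"
      by (intro norm_triangle_mono order_trans[OF norm_blinfun_compose] mult_mono mult_nonneg_nonneg)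
        (auto simp: t \<Delta> gy c h C e1 less_imp_le c_def[symmetric] intro!: mult_nonneg_nonneg)
    also have "\<dots> = (c * c * e1 + M * h) * h"
      by (simp add: M_def algebra_simps)
    also have "\<dots> \<le> e * h"
      using e1' h by (intro mult_right_mono) auto
    finally show "norm (?g y - ?g x - - (?g x \<odot> T' x ((y - x) # vs) \<odot> ?g x)) \<le> e * norm (y - x) * prod_list (map norm vs)"
      using vs eq by (simp add: h_def t_def)
  qed
qed

text \<open>A class of multilinear expressions that is closed under differentiation: the derivative of an inverse
  is again a product of expressions of the class. Hence its members have derivatives of all orders; the
  towers for products and inverses are obtained in this way instead of by closed formulas.\<close>

inductive smooth_expr ::
    "'d::real_normed_vector set \<Rightarrow> 'd set \<Rightarrow> nat \<Rightarrow> ('d \<Rightarrow> 'd list \<Rightarrow> ('a::complex_hilbert \<Rightarrow>\<^sub>L 'a)) \<Rightarrow> bool"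
  for E U where
    tower: "derivative_tower E U D \<Longrightarrow> smooth_expr E U n (D n)"
  | inverse: "derivative_tower E U D \<Longrightarrow> (\<forall>x\<in>U. op_invertible (D 0 x [])) \<Longrightarrow>
      smooth_expr E U 0 (\<lambda>x vs. op_inv (D 0 x []))"
  | sum: "smooth_expr E U n T \<Longrightarrow> smooth_expr E U n S \<Longrightarrow> smooth_expr E U n (\<lambda>x vs. T x vs + S x vs)"
  | product: "smooth_expr E U n T \<Longrightarrow> smooth_expr E U m S \<Longrightarrow> count_list bs True = n \<Longrightarrow>
      count_list bs False = m \<Longrightarrow> smooth_expr E U (n + m) (op_product bs T S)"

lemma smooth_expr_multilinear:
  "smooth_expr E U n T \<Longrightarrow> x \<in> U \<Longrightarrow> bounded_multilinear_on E n (T x)"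
proof (induction rule: smooth_expr.induct)
  case (inverse D)
  then show ?case
    by (auto simp: bounded_multilinear_on_def)
next
  case (product n T m S bs)
  then show ?case
    by (intro bounded_multilinear_on_op_product)
qed (auto simp: derivative_tower_def bounded_multilinear_on_add)

lemma smooth_expr_derivative:
  fixes T :: "'d::real_normed_vector \<Rightarrow> 'd list \<Rightarrow> ('a::complex_hilbert \<Rightarrow>\<^sub>L 'a)"
  assumes E: "subspace E" "U \<subseteq> E"
  shows "smooth_expr E U n T \<Longrightarrow> \<exists>T'. smooth_expr E U (Suc n) T' \<and> multi_derivative_on E U n T T'"
proof (induction rule: smooth_expr.induct)
  case (tower D n)
  then show ?case
    using smooth_expr.tower[OF tower, of "Suc n"] by (auto simp: derivative_tower_def)
next
  case (inverse D)
  let ?g = "\<lambda>x vs. op_inv (D 0 x [])"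
  let ?c = "\<lambda>(n::nat) (x::'d) (vs::'d list). if n = 0 then - id_blinfun else 0 :: 'a \<Rightarrow>\<^sub>L 'a"
  have g: "smooth_expr E U 0 ?g" using inverse smooth_expr.inverse by blast
  have c: "derivative_tower E U ?c"
    by (rule derivative_tower_const)
  (* minus one as a constant factor: the class has no clause for negatives *)
  let ?T = "op_product [False] (?c 0) (op_product [True] (op_product [False] ?g (D 1)) ?g)"
  have "smooth_expr E U (0 + 1) (op_product [True] (op_product [False] ?g (D 1)) ?g)"
    using smooth_expr.product[OF smooth_expr.product[OF g smooth_expr.tower[OF inverse(1), of 1], of "[False]"] g, of "[True]"]
    by simp
  then have "smooth_expr E U (Suc 0) ?T"
    using smooth_expr.product[OF smooth_expr.tower[OF c, of 0], of 1 _ "[False]"] by simp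
  moreover have "multi_derivative_on E U 0 ?g ?T"
    by (rule multi_derivative_on_cong[OF multi_derivative_on_op_inv[where T = "D 0" and T' = "D (Suc 0)"]])
      (use inverse E in \<open>auto simp: derivative_tower_def op_product_def length_Suc_conv op_mult.minus_left\<close>)
  ultimately show ?case by blast
next
  case (sum n T S)
  then show ?case
    using multi_derivative_on_add smooth_expr.sum by blast
next
  case (product n T m S bs)
  then obtain T' S' where T': "smooth_expr E U (Suc n) T'" "multi_derivative_on E U n T T'"
    and S': "smooth_expr E U (Suc m) S'" "multi_derivative_on E U m S S'" by blast
  have "smooth_expr E U (Suc n + m) (op_product (True # bs) T' S)"
    using product by (intro smooth_expr.product T') auto
  moreover have "smooth_expr E U (n + Suc m) (op_product (False # bs) T S')"
    using product by (intro smooth_expr.product S') auto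
  ultimately have "smooth_expr E U (Suc (n + m)) (\<lambda>x vs. op_product (True # bs) T' S x vs + op_product (False # bs) T S' x vs)"
    by (intro smooth_expr.sum) auto
  moreover have "multi_derivative_on E U (n + m) (op_product bs T S)
      (\<lambda>x vs. op_product (True # bs) T' S x vs + op_product (False # bs) T S' x vs)"
    using product T' S' E by (intro multi_derivative_on_op_product smooth_expr_multilinear) auto
  ultimately show ?case by blast
qed

lemma smooth_on_smooth_expr:
  assumes E: "subspace E" "U \<subseteq> E" and T: "smooth_expr E U 0 T"
  shows "smooth_on E U (\<lambda>x. T x [])"
proof -
  obtain D where D: "\<And>n. (smooth_expr E U n (D n) \<and> (n = 0 \<longrightarrow> D n = T)) \<and> multi_derivative_on E U n (D n) (D (Suc n))"
    using dependent_nat_choice[of "\<lambda>n S. smooth_expr E U n S \<and> (n = 0 \<longrightarrow> S = T)"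
        "\<lambda>n S S'. multi_derivative_on E U n S S'"] T smooth_expr_derivative[OF E]
    by (metis nat.distinct(1))
  then have "derivative_tower E U D"
    unfolding derivative_tower_def by (meson smooth_expr_multilinear)
  then show ?thesis
    unfolding smooth_on_iff_tower using D[of 0] by auto
qed

lemma smooth_on_add:
  fixes f g :: "'d::real_normed_vector \<Rightarrow> ('a::complex_hilbert \<Rightarrow>\<^sub>L 'a)"
  assumes "smooth_on UNIV U f" "smooth_on UNIV U g"
  shows "smooth_on UNIV U (\<lambda>x. f x + g x )"
proof -
  obtain D F where D: "derivative_tower UNIV U D" "\<forall>x\<in>U. D 0 x [] = f x"
    and F: "derivative_tower UNIV U F" "\<forall>x\<in>U. F 0 x [] = g x"
    using assms smooth_on_iff_tower by metis
  have "smooth_on UNIV U (\<lambda>x. D 0 x [] + F 0 x [])"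
    using smooth_on_smooth_expr[OF subspace_UNIV subset_UNIV
        smooth_expr.sum[OF smooth_expr.tower[OF D(1), of 0] smooth_expr.tower[OF F(1), of 0]]] .
  then show ?thesis
    by (rule smooth_on_cong) (simp add: D F)
qed

lemma smooth_on_compose:
  fixes f g :: "'d::real_normed_vector \<Rightarrow> ('a::complex_hilbert \<Rightarrow>\<^sub>L 'a)"
  assumes "smooth_on UNIV U f" "smooth_on UNIV U g"
  shows "smooth_on UNIV U (\<lambda>x. f x \<odot> g x )"
proof -
  obtain D F where D: "derivative_tower UNIV U D" "\<forall>x\<in>U. D 0 x [] = f x"
    and F: "derivative_tower UNIV U F" "\<forall>x\<in>U. F 0 x [] = g x"
    using assms smooth_on_iff_tower by metis
  have "smooth_expr UNIV U (0 + 0) (op_product [] (D 0) (F 0))"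
    by (intro smooth_expr.product smooth_expr.tower[OF D(1)] smooth_expr.tower[OF F(1)]) auto
  then have "smooth_on UNIV U (\<lambda>x. op_product [] (D 0) (F 0) x [])"
    by (intro smooth_on_smooth_expr) auto
  then show ?thesis
    by (rule smooth_on_cong) (simp add: D F op_product_def)
qed

lemma smooth_on_op_inv:
  assumes "smooth_on UNIV U f" "\<And>x. x \<in> U \<Longrightarrow> op_invertible (f x)"
  shows "smooth_on UNIV U (\<lambda>x. op_inv (f x))"
proof -
  obtain D where D: "derivative_tower UNIV U D" "\<forall>x\<in>U. D 0 x [] = f x"
    using assms smooth_on_iff_tower by metis
  have "smooth_on UNIV U (\<lambda>x. op_inv (D 0 x []))"
    by (rule smooth_on_smooth_expr) (auto intro!: smooth_expr.inverse[OF D(1)] simp: D assms)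
  then show ?thesis
    by (rule smooth_on_cong) (simp add: D)
qed

lemma smooth_on_diff:
  fixes f g :: "'d::real_normed_vector \<Rightarrow> ('a::complex_hilbert \<Rightarrow>\<^sub>L 'a)"
  assumes "smooth_on UNIV U f" "smooth_on UNIV U g"
  shows "smooth_on UNIV U (\<lambda>x. f x - g x )"
proof -
  have "smooth_on UNIV U (\<lambda>x. f x + (- id_blinfun) \<odot> g x)"
    by (intro smooth_on_add smooth_on_compose smooth_on_const assms)
  then show ?thesis
    by (simp add: op_mult.minus_left)
qed

lemmas smooth_on_intros = smooth_on_add smooth_on_diff smooth_on_compose smooth_on_op_inv smooth_on_const smooth_on_id

lemma open_op_invertible_preimage:
  assumes "open U" "continuous_on U f"
  shows "open {x \<in> U. op_invertible (f x)}"
proof -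
  have "open (U \<inter> f -` {G. op_invertible G})"
    using continuous_open_preimage[OF assms(2,1) open_op_invertible] .
  then show ?thesis by (simp add: vimage_def Int_def)
qed

lemma open_norm_less_preimage:
  fixes f :: "'d::topological_space \<Rightarrow> 'b::real_normed_vector"
  assumes "open U" "continuous_on U f"
  shows "open {x \<in> U. norm (f x) < r}"
proof -
  have "open (U \<inter> (\<lambda>x. norm (f x)) -` {..<r})"
    by (rule continuous_open_preimage) (auto intro!: assms continuous_intros)
  then show ?thesis by (simp add: vimage_def Int_def)
qed

section \<open>First derivatives of products and inverses\<close>

lemma has_derivative_op_inv:
  assumes G: "op_invertible G"
  shows "(op_inv has_derivative (\<lambda>v. - (op_inv G \<odot> v \<odot> op_inv G))) (at G)"
proof -
  let ?U = "{G :: 'a \<Rightarrow>\<^sub>L 'a. op_invertible G}"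
  have d: "multi_derivative_on UNIV ?U 0 (\<lambda>G vs. op_inv G) (\<lambda>G vs. - (op_inv G \<odot> hd vs \<odot> op_inv G))"
  proof (rule multi_derivative_on_op_inv)
    show "bounded_multilinear_on UNIV (Suc 0) (hd :: ('a \<Rightarrow>\<^sub>L 'a) list \<Rightarrow> 'a \<Rightarrow>\<^sub>L 'a)"
      by (auto simp: bounded_multilinear_on_def length_Suc_conv intro!: exI[of _ 1])
    show "multi_derivative_on UNIV ?U 0 (\<lambda>G vs. G) (\<lambda>G. hd)"
      by (auto simp: multi_derivative_on_def intro!: exI[of _ 1])
  qed auto
  have "(op_inv has_derivative (\<lambda>v. - (op_inv G \<odot> v \<odot> op_inv G))) (at G within ?U)"
    unfolding has_derivative_within_alt
  proof (intro conjI)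
    show "bounded_linear (\<lambda>v. - (op_inv G \<odot> v \<odot> op_inv G))"
      by (intro bounded_linear_minus bounded_linear_compose[OF op_mult.bounded_linear_left] op_mult.bounded_linear_right)
    show "\<forall>e>0. \<exists>d>0. \<forall>y\<in>?U. norm (y - G) < d \<longrightarrow>
        norm (op_inv y - op_inv G - - (op_inv G \<odot> (y - G) \<odot> op_inv G)) \<le> e * norm (y - G)"
      using d G unfolding multi_derivative_on_def by auto
  qed
  then show ?thesis
    using at_within_open[OF _ open_op_invertible, of G] G by simp
qed

lemmas has_derivative_compose_op = bounded_bilinear.FDERIV[OF bounded_bilinear_blinfun_compose]

lemma has_derivative_op_inv_fun:
  assumes "(f has_derivative f') (at x within S)" "op_invertible (f x)"
  shows "((\<lambda>x. op_inv (f x)) has_derivative (\<lambda>v. - (op_inv (f x) \<odot> f' v \<odot> op_inv (f x)))) (at x within S)"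
  using has_derivative_compose[OF assms(1) has_derivative_op_inv[OF assms(2)]] .

lemma frechet_derivative_on_if_has_derivative:
  assumes "(f has_derivative L) (at x)"
  shows "frechet_derivative_on E U f x L"
proof -
  have "(f has_derivative L) (at x within U)" using assms by (rule has_derivative_at_withinI)
  then have L: "bounded_linear L" and
    d: "\<forall>e>0. \<exists>d>0. \<forall>y\<in>U. norm (y - x) < d \<longrightarrow> norm (f y - f x - L (y - x)) \<le> e * norm (y - x)"
    unfolding has_derivative_within_alt by auto
  interpret bounded_linear L by (rule L)
  obtain K where "\<And>v. norm (L v) \<le> norm v * K" using bounded by blast
  then have "\<exists>K. \<forall>v\<in>E. norm (L v) \<le> K * norm v" by (metis mult.commute)
  then show ?thesis using d by (simp add: frechet_derivative_on_def add scaleR)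
qed

lemma has_vector_derivative_mem_closed_subspace:
  assumes E: "closed_subspace E" and e: "0 < e" and \<gamma>: "\<gamma> ` {-e<..<e} \<subseteq> E"
    and d: "(\<gamma> has_vector_derivative v) (at (0::real))"
  shows "v \<in> E"
proof -
  have E': "subspace E" "closed E" using E by (auto simp: closed_subspace_def)
  have "\<exists>w\<in>E. dist w v < r" if r: "0 < r" for r
  proof -
    obtain d where "0 < d"
      and d: "\<And>t. norm (t - 0) < d \<Longrightarrow> norm (\<gamma> t - \<gamma> 0 - (t - 0) *\<^sub>R v) \<le> r / 2 * norm (t - 0)"
      using d r unfolding has_vector_derivative_def has_derivative_at_alt by (meson half_gt_zero)
    define t where "t = min d e / 2"
    have t: "0 < t" "t < d" "t < e" using \<open>0 < d\<close> e by (auto simp: t_def)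
    define w where "w = (1 / t) *\<^sub>R (\<gamma> t - \<gamma> 0)"
    have "w \<in> E"
      unfolding w_def using t e \<gamma> by (intro subspace_mul subspace_diff E') (auto simp: image_subset_iff)
    moreover have "w - v = (1 / t) *\<^sub>R (\<gamma> t - \<gamma> 0 - t *\<^sub>R v)"
      using t by (simp add: w_def scaleR_diff_right)
    then have "dist w v \<le> r / 2"
      using d[of t] t by (simp add: dist_norm pos_divide_le_eq)
    ultimately show ?thesis using r by (intro bexI[of _ w]) auto
  qed
  then show ?thesis using closed_approachable[OF E'(2)] by blast
qed

section \<open>Adjoints in a complex Hilbert space\<close>

text \<open>The functional \<open>\<Phi> x = \<parallel>x\<parallel>\<^sup>2 - 2 f x\<close> is bounded below, by the parallelogram law its minimizing sequences
  are Cauchy, and at a minimizer its derivative vanishes.\<close>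

lemma riesz_representation:
  fixes f :: "'a::{real_inner, complete_space} \<Rightarrow> real"
  assumes f: "bounded_linear f"
  obtains z where "\<And>x. f x = inner x z"
proof -
  interpret bounded_linear f by fact
  obtain K where K: "\<And>x. norm (f x) \<le> norm x * K" using bounded by blast
  define \<Phi> where "\<Phi> x = inner x x - 2 * f x" for x
  have low: "- K\<^sup>2 \<le> \<Phi> x" for x
  proof -
    have "0 \<le> (norm x - K)\<^sup>2" by simp
    then have "2 * (norm x * K) - K\<^sup>2 \<le> inner x x"
      by (simp add: power2_diff dot_square_norm)
    then show ?thesis using K[of x] by (auto simp: \<Phi>_def)
  qed
  define m where "m = Inf (range \<Phi>)"
  have bdd: "bdd_below (range \<Phi>)" using low by (auto intro!: bdd_belowI)
  have m: "m \<le> \<Phi> x" for x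
    unfolding m_def using bdd by (auto intro!: cInf_lower)
  have "\<exists>x. \<Phi> x < m + 1 / real (Suc n)" for n
    using cInf_lessD[of "range \<Phi>" "m + 1 / real (Suc n)"] by (auto simp: m_def)
  then obtain X where X: "\<And>n. \<Phi> (X n) < m + 1 / real (Suc n)" by metis
  have par: "inner (x - y) (x - y) \<le> 2 * (\<Phi> x - m) + 2 * (\<Phi> y - m)" for x y
  proof -
    have "\<Phi> ((1 / 2) *\<^sub>R (x + y)) = (\<Phi> x + \<Phi> y) / 2 - inner (x - y) (x - y) / 4"
      by (simp add: \<Phi>_def scaleR add inner_add_left inner_add_right inner_diff_left inner_diff_right inner_commute field_simps)
    then show ?thesis using m[of "(1 / 2) *\<^sub>R (x + y)"] by (simp add: field_simps)
  qed
  have "Cauchy X"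
  proof (rule CauchyI)
    fix e :: real assume e: "0 < e"
    then obtain N where N: "4 / e\<^sup>2 < real N" using reals_Archimedean2 by blast
    then have "4 < e\<^sup>2 * real N" using e by (simp add: pos_divide_less_eq mult.commute)
    also have "\<dots> \<le> e\<^sup>2 * real (Suc N)" by (intro mult_left_mono) auto
    finally have N4: "4 / real (Suc N) < e\<^sup>2" by (simp add: pos_divide_less_eq)
    have "norm (X k - X l) < e" if "k \<ge> N" "l \<ge> N" for k l
    proof -
      have "1 / real (Suc k) \<le> 1 / real (Suc N)" "1 / real (Suc l) \<le> 1 / real (Suc N)"
        using that by (auto simp: frac_le)
      then have "inner (X k - X l) (X k - X l) < e\<^sup>2"
        using par[of "X k" "X l"] X[of k] X[of l] N4 by simp
      then have "(norm (X k - X l))\<^sup>2 < e\<^sup>2" by (simp add: dot_square_norm)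
      then show ?thesis using e by (simp add: power2_less_imp_less)
    qed
    then show "\<exists>M. \<forall>k\<ge>M. \<forall>l\<ge>M. norm (X k - X l) < e" by blast
  qed
  then obtain z where z: "X \<longlonglongrightarrow> z" using Cauchy_convergent convergent_def by blast
  have "(\<lambda>n. \<Phi> (X n)) \<longlonglongrightarrow> \<Phi> z"
    unfolding \<Phi>_def by (intro tendsto_intros tendsto z)
  moreover have "(\<lambda>n. m + 1 / real (Suc n)) \<longlonglongrightarrow> m + 0"
    by (intro tendsto_intros) (rule LIMSEQ_Suc[OF lim_1_over_n])
  ultimately have "\<Phi> z \<le> m"
    using X by (intro LIMSEQ_le[of "\<lambda>n. \<Phi> (X n)" _ "\<lambda>n. m + 1 / real (Suc n)"]) (auto intro: less_imp_le)
  have "f v = inner v z" for v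
  proof -
    define a where "a = inner v v"
    define b where "b = inner v z - f v"
    have a: "0 \<le> a" by (simp add: a_def)
    have q: "0 \<le> t * t * a + 2 * t * b" for t
    proof -
      have "\<Phi> (z + t *\<^sub>R v) = \<Phi> z + t * t * a + 2 * t * b"
        by (simp add: \<Phi>_def a_def b_def scaleR add inner_add_left inner_add_right inner_commute algebra_simps)
      then show ?thesis using m[of "z + t *\<^sub>R v"] \<open>\<Phi> z \<le> m\<close> by simp
    qed
    define s where "s = b / (a + 1)"
    (* the value at - s of the nonnegative quadratic polynomial is - s\<^sup>2 (a + 2) *)
    have b: "b = s * (a + 1)" using a by (simp add: s_def)
    have "0 \<le> - (s * s * (a + 2))"
      using q[of "- s"] unfolding b by (simp add: algebra_simps)
    moreover have "s * s \<le> s * s * (a + 2)"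
      using mult_left_mono[of 1 "a + 2" "s * s"] a by simp
    ultimately have "s * s \<le> 0" by linarith
    then have "s = 0" by (auto simp: mult_le_0_iff)
    then have "b = 0" by (simp add: b)
    then show ?thesis by (simp add: b_def)
  qed
  then show ?thesis using that by blast
qed

lemma cinner_scaleC_right: "cinner x (c *\<^sub>C y) = cnj c * cinner x y"
  by (metis cinner_commute cinner_scaleC_left complex_cnj_mult)

lemma norm_scaleC: "norm (c *\<^sub>C x) = cmod c * norm (x :: 'a::complex_hilbert)"
proof -
  have *: "Im (cinner x x) = 0"
    using cinner_commute[of x x] by (metis cnj.simps(2) neg_equal_zero)
  have "cinner (c *\<^sub>C x) (c *\<^sub>C x) = of_real ((cmod c)\<^sup>2) * cinner x x"
    by (simp add: cinner_scaleC_left cinner_scaleC_right complex_norm_square del: of_real_power)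
  then have "inner (c *\<^sub>C x) (c *\<^sub>C x) = (cmod c)\<^sup>2 * inner x x"
    by (simp add: inner_eq_Re_cinner)
  then have "(norm (c *\<^sub>C x))\<^sup>2 = (cmod c * norm x)\<^sup>2"
    by (simp add: dot_square_norm power_mult_distrib)
  then show ?thesis
    by (simp add: power2_eq_iff_nonneg)
qed

lemma bounded_linear_scaleC: "bounded_linear (\<lambda>x. c *\<^sub>C (x :: 'a::complex_hilbert))"
proof (rule bounded_linear_intro[where K = "cmod c"])
  show "c *\<^sub>C (r *\<^sub>R x) = r *\<^sub>R c *\<^sub>C x" for r and x :: 'a
    by (simp add: scaleC_scaleC mult.commute flip: scaleC_of_real)
qed (auto simp: scaleC_add_right norm_scaleC mult.commute)

text \<open>Since the real inner product determines the complex one, all computations with complex-linear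
  operators can be done with the former.\<close>

lemma cinner_eq_inner: "cinner x y = Complex (inner x y) (- inner (\<i> *\<^sub>C x) y)"
  by (simp add: complex_eq_iff inner_eq_Re_cinner cinner_scaleC_left)

lemma cinner_eq_if_inner_eq:
  assumes "S \<in> bounded_ops" "T \<in> bounded_ops"
    and "\<And>x. inner (blinfun_apply S x) v = inner (blinfun_apply T x) w"
  shows "cinner (blinfun_apply S x) v = cinner (blinfun_apply T x) w"
proof -
  have "\<i> *\<^sub>C S x = S (\<i> *\<^sub>C x)" "\<i> *\<^sub>C T x = T (\<i> *\<^sub>C x)"
    using assms(1,2) by (auto simp: bounded_ops_def)
  then show ?thesis
    unfolding cinner_eq_inner by (simp add: assms(3))
qed

lemma id_in_bounded_ops: "id_blinfun \<in> bounded_ops"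
  by (simp add: bounded_ops_def)

lemma compose_in_bounded_ops: "S \<in> bounded_ops \<Longrightarrow> T \<in> bounded_ops \<Longrightarrow> S \<odot> T \<in> bounded_ops"
  by (simp add: bounded_ops_def)

lemma op_inv_in_bounded_ops:
  assumes "T \<in> bounded_ops" "op_invertible T"
  shows "op_inv T \<in> bounded_ops"
proof -
  have "blinfun_apply (op_inv T) (c *\<^sub>C x) = c *\<^sub>C blinfun_apply (op_inv T) x" for c x
  proof -
    have r: "T (op_inv T y) = y" and l: "op_inv T (T y) = y" for y
      using assms(2) by (metis blinfun_apply_blinfun_compose blinfun_apply_id_blinfun op_inv_right op_inv_left)+
    have "c *\<^sub>C x = blinfun_apply T (c *\<^sub>C blinfun_apply (op_inv T) x)"
      using assms(1) r by (simp add: bounded_ops_def)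
    then show ?thesis using l by metis
  qed
  then show ?thesis by (simp add: bounded_ops_def)
qed

lemma subspace_bounded_ops: "subspace (bounded_ops :: ('a::complex_hilbert \<Rightarrow>\<^sub>L 'a) set)"
proof -
  have "c *\<^sub>C (0::'a) = 0" for c by (metis linear_0 bounded_linear.linear[OF bounded_linear_scaleC])
  moreover have "r *\<^sub>R c *\<^sub>C x = c *\<^sub>C r *\<^sub>R (x::'a)" for r c x
    by (metis linear_cmul bounded_linear.linear[OF bounded_linear_scaleC])
  ultimately show ?thesis
    by (auto simp: subspace_def bounded_ops_def blinfun.add_left blinfun.scaleR_left scaleC_add_right)
qed

lemma closed_bounded_ops: "closed (bounded_ops :: ('a::complex_hilbert \<Rightarrow>\<^sub>L 'a) set)"
proof -
  have eq: "bounded_ops = (\<Inter>c. \<Inter>x. {T. blinfun_apply T (c *\<^sub>C x) = c *\<^sub>C (blinfun_apply T x :: 'a)})"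
    by (auto simp: bounded_ops_def)
  have "closed {T. blinfun_apply T (c *\<^sub>C x) = c *\<^sub>C (blinfun_apply T x :: 'a)}" for c and x :: 'a
    by (intro closed_Collect_eq continuous_intros
        bounded_linear.continuous_on[OF bounded_linear_scaleC])
  then show ?thesis unfolding eq by (intro closed_INT ballI)
qed

text \<open>\<open>adj\<close> is a definite description, so its defining property has to be obtained from an operator with
  this property, which is given by the Riesz representation of \<open>x \<mapsto> \<langle>T x, y\<rangle>\<close>.\<close>

lemma cinner_adj:
  assumes T: "T \<in> bounded_ops"
  shows "cinner (blinfun_apply T x) y = cinner x (blinfun_apply (adj T) y)"
proof -
  have "\<exists>z. \<forall>x. inner (blinfun_apply T x) y = inner x z" for y
    by (rule riesz_representation[of "\<lambda>x. inner (blinfun_apply T x) y"]) (auto intro!: bounded_linear_intros)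
  then obtain S where S: "\<And>x y. inner (blinfun_apply T x) y = inner x (S y)" by metis
  have "bounded_linear S"
  proof (rule bounded_linear_intro[where K = "norm T"])
    show "S (x + y) = S x + S y" for x y
      by (rule vector_eq_rdot[THEN iffD1]) (simp add: inner_add_right inner_commute flip: S)
    show "S (r *\<^sub>R x) = r *\<^sub>R S x" for r x
      by (rule vector_eq_rdot[THEN iffD1]) (simp add: inner_commute flip: S)
    show "norm (S x) \<le> norm x * norm T" for x
    proof -
      have "norm (S x) * norm (S x) = inner (blinfun_apply T (S x)) x"
        by (simp add: S norm_eq_square flip: power2_eq_square dot_square_norm)
      also have "\<dots> \<le> norm (blinfun_apply T (S x)) * norm x" by (rule norm_cauchy_schwarz)
      also have "\<dots> \<le> norm T * norm (S x) * norm x"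
        by (intro mult_right_mono norm_blinfun) simp
      finally have "norm (S x) * norm (S x) \<le> (norm x * norm T) * norm (S x)" by (simp add: mult_ac)
      then show ?thesis
        by (cases "S x = 0") auto
    qed
  qed
  define S' where "S' = Blinfun S"
  have S': "blinfun_apply S' y = S y" for y
    using \<open>bounded_linear S\<close> by (simp add: S'_def bounded_linear_Blinfun_apply)
  have S'_adj: "cinner (blinfun_apply T x) y = cinner x (blinfun_apply S' y)" for x y
    using cinner_eq_if_inner_eq[OF T id_in_bounded_ops, of y "S y" x] S by (simp add: S')
  have "adj T = S'"
    unfolding adj_def
  proof (rule the_equality)
    show "\<forall>x y. cinner (blinfun_apply T x) y = cinner x (blinfun_apply S' y)" using S'_adj by blast
    fix R assume "\<forall>x y. cinner (blinfun_apply T x) y = cinner x (blinfun_apply R y)"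
    then have "inner x (blinfun_apply R y) = inner x (blinfun_apply S' y)" for x y
      using S'_adj by (metis inner_eq_Re_cinner)
    then show "R = S'"
      by (intro blinfun_eqI) (metis vector_eq_rdot inner_commute)
  qed
  then show ?thesis using S'_adj by simp
qed

section \<open>Adjoints for the form of a bounded operator\<close>

text \<open>A relation, because an operator need not have an adjoint for the form \<open>\<langle>A x, y\<rangle>\<close>.\<close>

definition A_adjoint :: "('a::complex_hilbert \<Rightarrow>\<^sub>L 'a) \<Rightarrow> ('a \<Rightarrow>\<^sub>L 'a) \<Rightarrow> ('a \<Rightarrow>\<^sub>L 'a) \<Rightarrow> bool"
  where "A_adjoint A T S \<longleftrightarrow> T \<in> bounded_ops \<and> S \<in> bounded_ops \<and>
    (\<forall>x y. inner (A (T x)) y = inner (A x) (S y))"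

lemma A_adjoint_id: "A_adjoint A id_blinfun id_blinfun"
  by (simp add: A_adjoint_def id_in_bounded_ops)

lemma A_adjoint_compose: "A_adjoint A T T' \<Longrightarrow> A_adjoint A S S' \<Longrightarrow> A_adjoint A (T \<odot> S) (S' \<odot> T')"
  by (simp add: A_adjoint_def compose_in_bounded_ops)

lemma A_adjoint_add: "A_adjoint A T T' \<Longrightarrow> A_adjoint A S S' \<Longrightarrow> A_adjoint A (T + S) (T' + S')"
  by (simp add: A_adjoint_def blinfun.add_left blinfun.add_right inner_add_left inner_add_right
      subspace_add[OF subspace_bounded_ops])

lemma A_adjoint_scaleR: "A_adjoint A T T' \<Longrightarrow> A_adjoint A (r *\<^sub>R T) (r *\<^sub>R T')"
  by (simp add: A_adjoint_def blinfun.scaleR_left blinfun.scaleR_right subspace_mul[OF subspace_bounded_ops])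

lemma A_adjoint_minus: "A_adjoint A T T' \<Longrightarrow> A_adjoint A (- T) (- T')"
  using A_adjoint_scaleR[of A T T' "-1"] by simp

lemma A_adjoint_diff: "A_adjoint A T T' \<Longrightarrow> A_adjoint A S S' \<Longrightarrow> A_adjoint A (T - S) (T' - S')"
  using A_adjoint_add[OF _ A_adjoint_minus] by fastforce

lemma A_adjoint_zero: "A_adjoint A 0 0"
  using A_adjoint_scaleR[OF A_adjoint_id, of A 0] by simp

lemma A_adjoint_op_inv:
  assumes "A_adjoint A T S" "op_invertible T" "op_invertible S"
  shows "A_adjoint A (op_inv T) (op_inv S)"
proof -
  have r: "G (op_inv G x) = x" if "op_invertible G" for G :: "'a \<Rightarrow>\<^sub>L 'a" and x
    using that by (metis blinfun_apply_blinfun_compose blinfun_apply_id_blinfun op_inv_right)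
  have "inner (A (op_inv T x)) y = inner (A x) (op_inv S y)" for x y
  proof -
    have "inner (A (op_inv T x)) y = inner (A (op_inv T x)) (S (op_inv S y))"
      using r[OF assms(3)] by simp
    also have "\<dots> = inner (A (T (op_inv T x))) (op_inv S y)"
      using assms(1) by (simp add: A_adjoint_def)
    finally show ?thesis using r[OF assms(2)] by simp
  qed
  then show ?thesis
    using assms op_inv_in_bounded_ops by (auto simp: A_adjoint_def)
qed

lemmas A_adjoint_intros = A_adjoint_id A_adjoint_compose A_adjoint_add A_adjoint_diff A_adjoint_scaleR
  A_adjoint_minus A_adjoint_op_inv

text \<open>For \<open>r = 1\<close> these are the \<open>A\<close>-symmetric, for \<open>r = - 1\<close> the \<open>A\<close>-anti-symmetric operators.\<close>

lemma closed_subspace_A_adjoint: "closed_subspace {T. A_adjoint A T (r *\<^sub>R T)}"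
proof -
  have "subspace {T. A_adjoint A T (r *\<^sub>R T)}"
    unfolding subspace_def
    using A_adjoint_scaleR[of A _ "r *\<^sub>R _"]
    by (auto simp: A_adjoint_zero A_adjoint_add scaleR_add_right mult.commute)
  moreover have "closed {T. A_adjoint A T (r *\<^sub>R T)}"
  proof -
    have "{T. A_adjoint A T (r *\<^sub>R T)} =
        bounded_ops \<inter> (\<Inter>x. \<Inter>y. {T. inner (A (blinfun_apply T x)) y = inner (A x) (r *\<^sub>R blinfun_apply T y)})"
      by (auto simp: A_adjoint_def blinfun.scaleR_left subspace_mul[OF subspace_bounded_ops])
    moreover have "closed {T. inner (A (blinfun_apply T x)) y = inner (A x) (r *\<^sub>R blinfun_apply T y)}" for x y
      by (intro closed_Collect_eq continuous_intros)
    ultimately show ?thesis using closed_bounded_ops by (auto intro!: closed_Int closed_INT)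
  qed
  ultimately show ?thesis by (simp add: closed_subspace_def)
qed

lemma compose_adj_eq_iff:
  assumes "B \<in> bounded_ops"
  shows "adj B \<odot> C = A \<longleftrightarrow> (\<forall>x y. inner (C x) (B y) = inner (A x) y)"
proof -
  have "adj B \<odot> C = A \<longleftrightarrow> (\<forall>x y. inner y (adj B (C x)) = inner y (A x))"
    by (auto simp: vector_eq_ldot intro!: blinfun_eqI dest: arg_cong[where f = blinfun_apply] fun_cong)
  also have "\<dots> \<longleftrightarrow> (\<forall>x y. inner (B y) (C x) = inner y (A x))"
    by (simp add: inner_eq_Re_cinner cinner_adj[OF assms])
  finally show ?thesis by (simp add: inner_commute)
qed

lemma A_symmetric_eq: "A_symmetric A = {B. A_adjoint A B B}"
proof -
  have "adj B \<odot> A = A \<odot> B \<longleftrightarrow> (\<forall>x y. inner (A (B x)) y = inner (A x) (B y))" if "B \<in> bounded_ops" for B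
    using compose_adj_eq_iff[OF that, of A "A \<odot> B"] by (auto simp: eq_commute)
  then show ?thesis by (auto simp: A_symmetric_def A_adjoint_def)
qed

lemma compat_Gr_eq: "compat_Gr A = {Q \<in> A_symmetric A. Q \<odot> Q = Q}"
  by (auto simp: compat_Gr_def A_symmetric_def)

lemma Gl_eq: "Gl = {G \<in> bounded_ops. op_invertible G}"
proof -
  have "op_invertible G \<Longrightarrow> G \<in> bounded_ops \<Longrightarrow> G \<in> Gl" for G :: "'a \<Rightarrow>\<^sub>L 'a"
    unfolding Gl_def using op_inv_in_bounded_ops op_inv_right op_inv_left by blast
  then show ?thesis by (auto simp: Gl_def op_invertible_def)
qed

lemma A_group_eq: "A_group A = {G. op_invertible G \<and> A_adjoint A G (op_inv G)}"
proof -
  have "adj G \<odot> A \<odot> G = A \<longleftrightarrow> (\<forall>x y. inner (A (G x)) y = inner (A x) (op_inv G y))"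
    if G: "G \<in> bounded_ops" "op_invertible G" for G
  proof -
    have r: "G (op_inv G x) = x" and l: "op_inv G (G x) = x" for x
      using G(2) by (metis blinfun_apply_blinfun_compose blinfun_apply_id_blinfun op_inv_right op_inv_left)+
    have "adj G \<odot> A \<odot> G = A \<longleftrightarrow> (\<forall>x y. inner (A (G x)) (G y) = inner (A x) y)"
      using compose_adj_eq_iff[OF G(1), of "A \<odot> G" A]
      by (simp add: blinfun_compose_assoc)
    also have "\<dots> \<longleftrightarrow> (\<forall>x y. inner (A (G x)) y = inner (A x) (op_inv G y))"
      using r l by metis
    finally show ?thesis .
  qed
  then show ?thesis
    using op_inv_in_bounded_ops by (auto simp: A_group_def Gl_eq A_adjoint_def)
qed

lemma A_group_compose:
  assumes "G \<in> A_group A" "H \<in> A_group A"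
  shows "G \<odot> H \<in> A_group A"
  using assms by (auto simp: A_group_eq op_invertible_compose op_inv_compose A_adjoint_compose)

lemma A_group_op_inv:
  assumes "G \<in> A_group A"
  shows "op_inv G \<in> A_group A"
  using assms by (auto simp: A_group_eq op_invertible_op_inv intro: A_adjoint_op_inv)

lemma A_group_id: "id_blinfun \<in> A_group A"
  by (simp add: A_group_eq op_invertible_id A_adjoint_id)

lemma A_symmetric_eq_scaleR: "A_symmetric A = {X. A_adjoint A X (1 *\<^sub>R X)}"
  by (simp add: A_symmetric_eq)

definition A_skew :: "('a::complex_hilbert \<Rightarrow>\<^sub>L 'a) \<Rightarrow> ('a \<Rightarrow>\<^sub>L 'a) set"
  where "A_skew A = {X. A_adjoint A X (- X)}"

lemma A_skew_eq_scaleR: "A_skew A = {T. A_adjoint A T ((- 1) *\<^sub>R T)}"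
  by (simp add: A_skew_def)

lemma commutator_in_A_skew:
  assumes "A_adjoint A X X" "A_adjoint A Q Q"
  shows "X \<odot> Q - Q \<odot> X \<in> A_skew A"
proof -
  have "A_adjoint A (X \<odot> Q - Q \<odot> X) (Q \<odot> X - X \<odot> Q)"
    by (intro A_adjoint_intros assms)
  then show ?thesis by (simp add: A_skew_def)
qed

section \<open>Orbits of projections\<close>

lemma orbit_map_compose:
  assumes "op_invertible G" "op_invertible H"
  shows "orbit_map Q (G \<odot> H) = orbit_map (orbit_map Q H) G"
  using assms by (simp add: orbit_map_def op_inv_compose op_ring)

lemma orbit_map_compat_Gr:
  assumes "Q \<in> compat_Gr A" "G \<in> A_group A"
  shows "orbit_map Q G \<in> compat_Gr A"
proof -
  have G: "op_invertible G" "A_adjoint A G (op_inv G)" using assms by (auto simp: A_group_eq)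
  have Q: "A_adjoint A Q Q" "Q \<odot> Q = Q" using assms by (auto simp: compat_Gr_eq A_symmetric_eq)
  have "A_adjoint A (G \<odot> Q \<odot> op_inv G) (op_inv (op_inv G) \<odot> (Q \<odot> op_inv G))"
    by (intro A_adjoint_intros G Q op_invertible_op_inv)
  moreover have "orbit_map Q G \<odot> orbit_map Q G = G \<odot> (Q \<odot> Q) \<odot> op_inv G"
    using G(1) by (simp add: orbit_map_def op_ring op_cancel)
  ultimately show ?thesis
    using G Q by (simp add: compat_Gr_eq A_symmetric_eq orbit_map_def op_inv_op_inv blinfun_compose_assoc)
qed

lemma orbit_eq_if_mem:
  assumes P: "P \<in> orbit A Q"
  shows "orbit A P = orbit A Q"
proof -
  obtain G where G: "G \<in> A_group A" "P = orbit_map Q G" using P by (auto simp: orbit_def)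
  have inv: "op_invertible H" if "H \<in> A_group A" for H using that by (simp add: A_group_eq)
  have Q: "Q = orbit_map P (op_inv G)"
    using inv[OF G(1)] by (simp add: G(2) orbit_map_def op_ring op_cancel op_inv_op_inv)
  have "orbit_map P H \<in> orbit A Q" if "H \<in> A_group A" for H
    using orbit_map_compose[OF inv[OF that] inv[OF G(1)]] A_group_compose[OF that G(1)] G(2)
    by (metis imageI orbit_def)
  moreover have "orbit_map Q H \<in> orbit A P" if "H \<in> A_group A" for H
    using orbit_map_compose[OF inv[OF that] inv[OF A_group_op_inv[OF G(1)]]]
      A_group_compose[OF that A_group_op_inv[OF G(1)]] Q
    by (metis imageI orbit_def)
  ultimately show ?thesis by (auto simp: orbit_def)
qed

text \<open>The operator \<open>N\<close> satisfies \<open>P N = N Q\<close>, but is not in the group in general: with its adjoint \<open>N'\<close> one has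
  \<open>N N' = N' N = 1 - (P - Q)\<^sup>2\<close>. This is invertible and has an \<open>A\<close>-symmetric square root \<open>W\<close> that commutes with \<open>P\<close>
  and \<open>Q\<close>, so \<open>N W\<^sup>-\<^sup>1\<close> is in the group and still intertwines \<open>Q\<close> and \<open>P\<close>.\<close>

lemma near_projections_same_orbit:
  fixes A P Q :: "'a::complex_hilbert \<Rightarrow>\<^sub>L 'a"
  assumes P: "P \<in> compat_Gr A" and Q: "Q \<in> compat_Gr A"
    and near: "norm (P - Q) \<le> 1 / 2"
  shows "P \<in> orbit A Q"
proof -
  have PP: "P \<odot> P = P" "\<And>X. P \<odot> (P \<odot> X) = P \<odot> X" and QQ: "Q \<odot> Q = Q" "\<And>X. Q \<odot> (Q \<odot> X) = Q \<odot> X"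
    using P Q by (auto simp: compat_Gr_eq simp flip: blinfun_compose_assoc)
  have adj: "A_adjoint A P P" "A_adjoint A Q Q"
    using P Q by (auto simp: compat_Gr_eq A_symmetric_eq)
  define X where "X = (P - Q) \<odot> (P - Q)"
  define N where "N = P \<odot> Q + (id_blinfun - P) \<odot> (id_blinfun - Q)"
  define N' where "N' = Q \<odot> P + (id_blinfun - Q) \<odot> (id_blinfun - P)"
  have X: "norm X \<le> 3 / 4"
  proof -
    have "norm X \<le> 1 / 2 * (1 / 2)"
      unfolding X_def using near by (intro order_trans[OF norm_blinfun_compose] mult_mono) auto
    then show ?thesis by simp
  qed
  have comm: "X \<odot> P = P \<odot> X" "X \<odot> Q = Q \<odot> X"
    by (simp_all add: X_def op_ring PP QQ algebra_simps)
  have X_adj: "A_adjoint A X X"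
    unfolding X_def by (intro A_adjoint_intros adj)
  (* the properties of X that its square root inherits *)
  define C where "C = {T. A_adjoint A T (1 *\<^sub>R T)} \<inter> {T. T \<odot> P = P \<odot> T} \<inter> {T. T \<odot> Q = Q \<odot> T}"
  obtain T where T: "T \<in> C" "norm T \<le> 1 / 2"
    and sq: "(id_blinfun - T) \<odot> (id_blinfun - T) = id_blinfun - X"
  proof (rule op_sqrt_near_id[of C X])
    show "closed C"
      unfolding C_def using closed_subspace_A_adjoint[of A 1, unfolded closed_subspace_def]
      by (intro closed_Int closed_Collect_eq continuous_intros) auto
    show "0 \<in> C" by (simp add: C_def A_adjoint_zero)
    show "(1 / 2) *\<^sub>R (X + T \<odot> T) \<in> C" if "T \<in> C" for T
    proof -
      have T: "A_adjoint A T T" "T \<odot> P = P \<odot> T" "T \<odot> Q = Q \<odot> T" using that by (auto simp: C_def)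
      then have "A_adjoint A ((1 / 2) *\<^sub>R (X + T \<odot> T)) ((1 / 2) *\<^sub>R (X + T \<odot> T))"
        by (intro A_adjoint_intros X_adj)
      moreover have "T \<odot> (T \<odot> P) = P \<odot> (T \<odot> T)" "T \<odot> (T \<odot> Q) = Q \<odot> (T \<odot> T)"
        using T by (metis blinfun_compose_assoc)+
      ultimately show ?thesis by (simp add: C_def op_ring comm)
    qed
  qed (use X in auto)
  define W where "W = id_blinfun - T"
  have W: "op_invertible W" unfolding W_def using T(2) by (intro op_invertible_id_minus) simp
  have W_adj: "A_adjoint A W W"
    unfolding W_def using T(1) by (intro A_adjoint_intros) (auto simp: C_def)
  have "W \<odot> P = P \<odot> W" "W \<odot> Q = Q \<odot> W"
    using T(1) by (auto simp: W_def C_def op_ring)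
  then have WP: "op_inv W \<odot> P = P \<odot> op_inv W" and WQ: "op_inv W \<odot> Q = Q \<odot> op_inv W"
    using op_inv_commute[OF W] by auto
  have N: "N \<odot> N' = W \<odot> W" "N' \<odot> N = W \<odot> W"
    unfolding W_def sq by (simp_all add: N_def N'_def X_def op_ring PP QQ algebra_simps)
  have WP': "op_inv W \<odot> (P \<odot> Z) = P \<odot> (op_inv W \<odot> Z)" and WQ': "op_inv W \<odot> (Q \<odot> Z) = Q \<odot> (op_inv W \<odot> Z)" for Z
    using WP WQ by (metis blinfun_compose_assoc)+
  have WN: "op_inv W \<odot> N = N \<odot> op_inv W" and WN': "op_inv W \<odot> N' = N' \<odot> op_inv W"
    by (simp_all add: N_def N'_def op_ring WP WQ WP' WQ')
  define G where "G = N \<odot> op_inv W"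
  define H where "H = op_inv W \<odot> N'"
  have GH: "G \<odot> H = id_blinfun" "H \<odot> G = id_blinfun"
  proof -
    have "G \<odot> H = op_inv W \<odot> (N \<odot> N') \<odot> op_inv W"
      unfolding G_def H_def using WN WN' by (metis blinfun_compose_assoc)
    then show "G \<odot> H = id_blinfun" using W by (simp add: N op_ring op_cancel)
    have "H \<odot> G = op_inv W \<odot> (N' \<odot> N) \<odot> op_inv W"
      unfolding G_def H_def by (simp add: op_ring)
    then show "H \<odot> G = id_blinfun" using W by (simp add: N op_ring op_cancel)
  qed
  have inv: "op_invertible G" "op_inv G = H"
    using GH op_invertibleI op_inv_unique by auto
  have "A_adjoint A G H"
    unfolding G_def H_def N_def N'_def by (intro A_adjoint_intros adj W W_adj)
  then have G: "G \<in> A_group A" using inv by (simp add: A_group_eq)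
  have "P \<odot> G = G \<odot> Q"
    by (simp add: G_def N_def op_ring PP QQ WQ WQ')
  then have "orbit_map Q G = P"
    using inv by (simp add: orbit_map_def blinfun_compose_assoc GH flip: \<open>P \<odot> G = G \<odot> Q\<close>)
  then show ?thesis using G by (auto simp: orbit_def)
qed

lemma orbit_subset_compat_Gr:
  "Q \<in> compat_Gr A \<Longrightarrow> orbit A Q \<subseteq> compat_Gr A"
  using orbit_map_compat_Gr by (auto simp: orbit_def)

lemma mem_orbit_self: "Q \<in> orbit A Q"
  using A_group_id[of A] by (auto simp: orbit_def orbit_map_def intro!: image_eqI[of _ _ id_blinfun])

text \<open>Whether a point of the Grassmannian is in the orbit does not change within distance \<open>1/2\<close>, so the
  orbit is open and closed and contains each component that it meets.\<close>

lemma orbit_union_of_components: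
  assumes Q: "Q \<in> compat_Gr A"
  shows "\<exists>\<C>. \<C> \<subseteq> components (compat_Gr A) \<and> orbit A Q = \<Union>\<C>"
proof -
  let ?O = "orbit A Q" and ?G = "compat_Gr A"
  have "?O \<subseteq> ?G" using orbit_subset_compat_Gr[OF Q] .
  have ball: "P \<in> ?O \<longleftrightarrow> R \<in> ?O" if "P \<in> ?G" "R \<in> ?G" "dist P R < 1 / 2" for P R
  proof -
    have "P \<in> orbit A R" using near_projections_same_orbit[OF that(1,2)] that(3) by (simp add: dist_norm)
    then have "orbit A P = orbit A R" by (rule orbit_eq_if_mem)
    then show ?thesis
      using orbit_eq_if_mem[of P A Q] orbit_eq_if_mem[of R A Q] mem_orbit_self by metis
  qed
  have op: "openin (top_of_set ?G) ?O"
    unfolding openin_euclidean_subtopology_iff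
  proof (intro conjI ballI)
    fix R assume R: "R \<in> ?O"
    then have "\<forall>P\<in>?G. dist P R < 1 / 2 \<longrightarrow> P \<in> ?O" using ball \<open>?O \<subseteq> ?G\<close> by blast
    then show "\<exists>e>0. \<forall>P\<in>?G. dist P R < e \<longrightarrow> P \<in> ?O" by (intro exI[of _ "1 / 2"]) simp
  qed (rule \<open>?O \<subseteq> ?G\<close>)
  have "openin (top_of_set ?G) (?G - ?O)"
    unfolding openin_euclidean_subtopology_iff
  proof (intro conjI ballI)
    fix R assume R: "R \<in> ?G - ?O"
    then have "\<forall>P\<in>?G. dist P R < 1 / 2 \<longrightarrow> P \<in> ?G - ?O" using ball by blast
    then show "\<exists>e>0. \<forall>P\<in>?G. dist P R < e \<longrightarrow> P \<in> ?G - ?O" by (intro exI[of _ "1 / 2"]) simp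
  qed simp
  then have cl: "closedin (top_of_set ?G) ?O"
    using \<open>?O \<subseteq> ?G\<close> by (simp add: closedin_def)
  have "C \<subseteq> ?O" if "C \<in> components ?G" "C \<inter> ?O \<noteq> {}" for C
  proof -
    have C: "connected C" "C \<subseteq> ?G" using in_components_connected[OF that(1)] in_components_subset[OF that(1)] .
    have "openin (top_of_set C) (C \<inter> ?O)" "closedin (top_of_set C) (C \<inter> ?O)"
      using openin_subtopology_Int_subset[OF _ C(2), of ?O] closedin_subtopology_Int_subset[OF _ C(2), of _ ?O]
        op cl \<open>?O \<subseteq> ?G\<close> by (simp_all add: Int_absorb1)
    then have "C \<inter> ?O = C" using C(1) that(2) unfolding connected_clopen by blast
    then show ?thesis by blast
  qed
  moreover have "\<exists>C\<in>components ?G. R \<in> C" if "R \<in> ?O" for R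
    using that \<open>?O \<subseteq> ?G\<close> Union_components[of ?G] by (metis UnionE subsetD)
  ultimately have "?O = \<Union>{C \<in> components ?G. C \<inter> ?O \<noteq> {}}"
    by (intro equalityI subsetI) (auto, metis disjoint_iff)
  then show ?thesis by (intro exI[of _ "{C \<in> components ?G. C \<inter> ?O \<noteq> {}}"]) simp
qed

section \<open>Submanifold charts\<close>

lemma submanifold_chart_restrict:
  assumes chart: "submanifold_chart E M U V \<phi> \<psi> F"
    and W: "openin (top_of_set E) W" "W \<subseteq> U" and M': "M' \<inter> W = M \<inter> W"
  shows "submanifold_chart E M' W (\<phi> ` W) \<phi> \<psi> F"
proof -
  have hom: "homeomorphism U V \<phi> \<psi>" and U: "openin (top_of_set E) U" and V: "openin (top_of_set E) V"
    and sm: "smooth_on E U \<phi>" "smooth_on E V \<psi>" and F: "closed_subspace F" "F \<subseteq> E" "\<phi> ` (U \<inter> M) = V \<inter> F"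
    using chart by (auto simp: submanifold_chart_def)
  have sub: "\<phi> ` W \<subseteq> V" using hom W(2) by (auto simp: homeomorphism_def)
  have "openin (top_of_set U) W"
    using W openin_imp_subset[OF U] by (metis openin_subset_trans)
  then have "openin (top_of_set V) (\<phi> ` W)"
    using homeomorphism_imp_open_map[OF hom] by blast
  then have "openin (top_of_set E) (\<phi> ` W)"
    using V openin_trans by blast
  moreover have "homeomorphism W (\<phi> ` W) \<phi> \<psi>"
    using hom W(2) sub by (rule homeomorphism_of_subsets) simp
  moreover have "\<phi> ` (W \<inter> M') = \<phi> ` W \<inter> F"
  proof -
    have "\<phi> ` (W \<inter> M') = \<phi> ` (W \<inter> M)" using M' by (simp add: Int_commute)
    also have "\<dots> = \<phi> ` W \<inter> \<phi> ` (U \<inter> M)"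
    proof -
      have "inj_on \<phi> U" using hom by (auto simp: homeomorphism_def intro: inj_on_inverseI)
      then have "\<phi> ` (W \<inter> (U \<inter> M)) = \<phi> ` W \<inter> \<phi> ` (U \<inter> M)"
        using W(2) by (intro inj_on_image_Int) auto
      moreover have "W \<inter> (U \<inter> M) = W \<inter> M" using W(2) by blast
      ultimately show ?thesis by simp
    qed
    also have "\<dots> = \<phi> ` W \<inter> F" using F(3) sub by auto
    finally show ?thesis .
  qed
  ultimately show ?thesis
    using W(1) F sm smooth_on_subset[OF sm(1) _ W(2)] smooth_on_subset[OF sm(2) _ sub]
    by (auto simp: submanifold_chart_def)
qed

text \<open>The charts below are given on open sets of the whole operator space and preserve \<open>E\<close>.\<close>

lemma submanifold_chartI:
  fixes E :: "('a::complex_hilbert \<Rightarrow>\<^sub>L 'a) set"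
  assumes O: "open O1" "open O2" and sm: "smooth_on UNIV O1 \<phi>" "smooth_on UNIV O2 \<psi>"
    and \<phi>: "\<And>x. x \<in> E \<Longrightarrow> x \<in> O1 \<Longrightarrow> \<phi> x \<in> E" "\<And>x. x \<in> O1 \<Longrightarrow> \<phi> x \<in> O2" "\<And>x. x \<in> O1 \<Longrightarrow> \<psi> (\<phi> x) = x"
    and \<psi>: "\<And>y. y \<in> E \<Longrightarrow> y \<in> O2 \<Longrightarrow> \<psi> y \<in> E" "\<And>y. y \<in> O2 \<Longrightarrow> \<psi> y \<in> O1" "\<And>y. y \<in> O2 \<Longrightarrow> \<phi> (\<psi> y) = y"
    and F: "closed_subspace F" "F \<subseteq> E" and M: "M \<subseteq> E"
    and MF: "\<And>x. x \<in> M \<Longrightarrow> x \<in> O1 \<Longrightarrow> \<phi> x \<in> F" "\<And>y. y \<in> F \<Longrightarrow> y \<in> O2 \<Longrightarrow> \<psi> y \<in> M"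
  shows "submanifold_chart E M (E \<inter> O1) (E \<inter> O2) \<phi> \<psi> F"
proof -
  have "homeomorphism (E \<inter> O1) (E \<inter> O2) \<phi> \<psi>"
    by (rule homeomorphismI)
      (use assms in \<open>auto intro: continuous_on_subset[OF smooth_on_imp_continuous_on]\<close>)
  moreover have "\<phi> ` (E \<inter> O1 \<inter> M) = E \<inter> O2 \<inter> F"
  proof
    show "\<phi> ` (E \<inter> O1 \<inter> M) \<subseteq> E \<inter> O2 \<inter> F" using \<phi> MF by auto
    show "E \<inter> O2 \<inter> F \<subseteq> \<phi> ` (E \<inter> O1 \<inter> M)"
    proof
      fix y assume "y \<in> E \<inter> O2 \<inter> F"
      then show "y \<in> \<phi> ` (E \<inter> O1 \<inter> M)"
        using \<psi> MF by (intro image_eqI[of _ _ "\<psi> y"]) auto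
    qed
  qed
  ultimately show ?thesis
    using O F smooth_on_subset[OF sm(1), of E "E \<inter> O1"] smooth_on_subset[OF sm(2), of E "E \<inter> O2"]
    by (auto simp: submanifold_chart_def openin_open_Int)
qed

section \<open>Cayley charts of the group\<close>

text \<open>The Cayley transform of \<open>p\<^sup>-\<^sup>1 G\<close>; it sends \<open>p\<close> to \<open>0\<close>.\<close>

definition cayley_chart :: "('a::complex_hilbert \<Rightarrow>\<^sub>L 'a) \<Rightarrow> ('a \<Rightarrow>\<^sub>L 'a) \<Rightarrow> ('a \<Rightarrow>\<^sub>L 'a)"
  where "cayley_chart p G = (op_inv p \<odot> G - id_blinfun) \<odot> op_inv (op_inv p \<odot> G + id_blinfun)"

definition cayley_param :: "('a::complex_hilbert \<Rightarrow>\<^sub>L 'a) \<Rightarrow> ('a \<Rightarrow>\<^sub>L 'a) \<Rightarrow> ('a \<Rightarrow>\<^sub>L 'a)"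
  where "cayley_param p X = p \<odot> (id_blinfun + X) \<odot> op_inv (id_blinfun - X)"

definition cayley_dom :: "('a::complex_hilbert \<Rightarrow>\<^sub>L 'a) \<Rightarrow> ('a \<Rightarrow>\<^sub>L 'a) set"
  where "cayley_dom p = {G. op_invertible G \<and> op_invertible (op_inv p \<odot> G + id_blinfun)}"

text \<open>The first condition is for the denominator of \<open>cayley_param\<close>, the second makes its values invertible.\<close>

definition cayley_cod :: "('a::complex_hilbert \<Rightarrow>\<^sub>L 'a) set"
  where "cayley_cod = {X. op_invertible (id_blinfun - X) \<and> op_invertible (id_blinfun + X)}"

lemma open_cayley_dom: "open (cayley_dom p)"
proof -
  have "open {G \<in> {G. op_invertible G}. op_invertible (op_inv p \<odot> G + id_blinfun)}"
    by (intro open_op_invertible_preimage open_op_invertible continuous_intros)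
  then show ?thesis by (simp add: cayley_dom_def)
qed

lemma open_cayley_cod: "open cayley_cod"
proof -
  have "open {X \<in> {X \<in> UNIV. op_invertible (id_blinfun - X)}. op_invertible (id_blinfun + X)}"
    by (intro open_op_invertible_preimage open_UNIV continuous_intros)
  then show ?thesis by (simp add: cayley_cod_def)
qed

text \<open>With \<open>a = (W + 1)\<^sup>-\<^sup>1\<close> the transform \<open>X = (W - 1) a\<close> satisfies \<open>1 - X = 2 a\<close> and \<open>1 + X = 2 W a\<close>. So both are
  invertible, and their quotient gives back \<open>W\<close>.\<close>

lemma cayley_chart_eqs:
  assumes p: "op_invertible p" and G: "G \<in> cayley_dom p"
  defines "X \<equiv> cayley_chart p G" and "W \<equiv> op_inv p \<odot> G" and "a \<equiv> op_inv (op_inv p \<odot> G + id_blinfun)"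
  shows "id_blinfun - X = 2 *\<^sub>R a" "id_blinfun + X = 2 *\<^sub>R (W \<odot> a)"
    "op_invertible a" "op_inv a = W + id_blinfun" "op_invertible W"
proof -
  have W1: "op_invertible (W + id_blinfun)" and Gi: "op_invertible G"
    using G by (auto simp: cayley_dom_def W_def)
  have "id_blinfun = (W + id_blinfun) \<odot> a"
    using W1 by (simp add: a_def W_def op_inv_right)
  then have e: "W \<odot> a + a = id_blinfun" by (simp add: op_ring)
  have "X = W \<odot> a - a" by (simp add: X_def cayley_chart_def W_def a_def op_ring)
  then show "id_blinfun - X = 2 *\<^sub>R a" "id_blinfun + X = 2 *\<^sub>R (W \<odot> a)"
    by (simp_all add: scaleR_2 flip: e)
  show "op_invertible a" "op_inv a = W + id_blinfun"
    using W1 by (simp_all add: a_def W_def op_invertible_op_inv op_inv_op_inv)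
  show "op_invertible W" unfolding W_def by (intro op_invertible_compose op_invertible_op_inv p Gi)
qed

lemma cayley_chart_in_cod:
  assumes "op_invertible p" "G \<in> cayley_dom p"
  shows "cayley_chart p G \<in> cayley_cod"
  using cayley_chart_eqs[OF assms]
  by (simp add: cayley_cod_def op_invertible_scaleR op_invertible_compose)

lemma cayley_param_chart:
  assumes "op_invertible p" "G \<in> cayley_dom p"
  shows "cayley_param p (cayley_chart p G) = G"
proof -
  note e = cayley_chart_eqs[OF assms]
  define W where "W = op_inv p \<odot> G"
  have "cayley_param p (cayley_chart p G) = p \<odot> W \<odot> (op_inv (W + id_blinfun) \<odot> op_inv (op_inv (W + id_blinfun)))"
    unfolding cayley_param_def e(1,2) using e(3)
    by (simp add: W_def op_inv_scaleR op_mult.scaleR_left op_mult.scaleR_right blinfun_compose_assoc)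
  also have "\<dots> = p \<odot> W" by (simp add: W_def op_inv_right[OF e(3)])
  finally show ?thesis using assms(1) by (simp add: W_def op_cancel)
qed

lemma cayley_param_eqs:
  assumes p: "op_invertible p" and X: "X \<in> cayley_cod"
  shows "op_inv p \<odot> cayley_param p X + id_blinfun = 2 *\<^sub>R op_inv (id_blinfun - X)"
    "op_inv p \<odot> cayley_param p X - id_blinfun = 2 *\<^sub>R (X \<odot> op_inv (id_blinfun - X))"
    "op_invertible (cayley_param p X)"
proof -
  have i: "op_invertible (id_blinfun - X)" "op_invertible (id_blinfun + X)" using X by (auto simp: cayley_cod_def)
  define a where "a = op_inv (id_blinfun - X)"
  have "(id_blinfun - X) \<odot> a = id_blinfun" using i by (simp add: a_def op_inv_right)
  then have e: "id_blinfun = a - X \<odot> a" by (simp add: op_ring)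
  have "op_inv p \<odot> cayley_param p X = a + X \<odot> a"
    using p by (simp add: cayley_param_def a_def op_ring op_cancel)
  then show "op_inv p \<odot> cayley_param p X + id_blinfun = 2 *\<^sub>R op_inv (id_blinfun - X)"
    "op_inv p \<odot> cayley_param p X - id_blinfun = 2 *\<^sub>R (X \<odot> op_inv (id_blinfun - X))"
    unfolding a_def[symmetric] by (subst e, simp add: scaleR_2)+
  show "op_invertible (cayley_param p X)"
    unfolding cayley_param_def by (intro op_invertible_compose op_invertible_op_inv p i)
qed

lemma cayley_param_in_dom:
  assumes "op_invertible p" "X \<in> cayley_cod"
  shows "cayley_param p X \<in> cayley_dom p"
  using cayley_param_eqs[OF assms] assms(2)
  by (simp add: cayley_dom_def cayley_cod_def op_invertible_scaleR op_invertible_op_inv)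

lemma cayley_chart_param:
  assumes "op_invertible p" "X \<in> cayley_cod"
  shows "cayley_chart p (cayley_param p X) = X"
  using assms(2) unfolding cayley_chart_def cayley_param_eqs[OF assms]
  by (simp add: cayley_cod_def op_inv_scaleR op_invertible_op_inv op_inv_op_inv op_cancel
      op_mult.scaleR_left op_mult.scaleR_right blinfun_compose_assoc)

text \<open>Passing to the adjoint replaces \<open>W = p\<^sup>-\<^sup>1 G\<close> by its inverse, and \<open>(W - 1) (W + 1)\<^sup>-\<^sup>1\<close> then changes its sign.\<close>

lemma cayley_chart_in_A_skew:
  assumes p: "p \<in> A_group A" and G: "G \<in> A_group A" "G \<in> cayley_dom p"
  shows "cayley_chart p G \<in> A_skew A"
proof -
  have pi: "op_invertible p" using p by (simp add: A_group_eq)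
  define W where "W = op_inv p \<odot> G"
  have W: "op_invertible W" "A_adjoint A W (op_inv W)"
    using A_group_compose[OF A_group_op_inv[OF p] G(1)] by (auto simp: W_def A_group_eq)
  have W1: "op_invertible (W + id_blinfun)" using G(2) by (simp add: W_def cayley_dom_def)
  define a where "a = op_inv (W + id_blinfun)"
  have aW: "a \<odot> W = W \<odot> a"
    unfolding a_def by (rule op_inv_commute[OF W1]) (simp add: op_ring)
  have eq: "op_inv W + id_blinfun = op_inv W \<odot> (W + id_blinfun)"
    using W(1) by (simp add: op_ring op_cancel)
  then have inv': "op_invertible (op_inv W + id_blinfun)" "op_inv (op_inv W + id_blinfun) = a \<odot> W"
    using W(1) W1 by (simp_all add: op_invertible_compose op_inv_compose op_invertible_op_inv op_inv_op_inv a_def)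
  have "A_adjoint A ((W - id_blinfun) \<odot> op_inv (W + id_blinfun))
      (op_inv (op_inv W + id_blinfun) \<odot> (op_inv W - id_blinfun))"
    by (intro A_adjoint_intros W W1 inv')
  moreover have "op_inv (op_inv W + id_blinfun) \<odot> (op_inv W - id_blinfun) = - ((W - id_blinfun) \<odot> op_inv (W + id_blinfun))"
    using W(1) unfolding inv' a_def[symmetric] by (simp add: op_ring op_cancel) (rule aW)
  ultimately show ?thesis
    by (simp add: A_skew_def cayley_chart_def W_def)
qed

text \<open>\<open>1 + X\<close> and \<open>1 - X\<close> are adjoint to each other and commute, so the adjoint of \<open>(1 + X) (1 - X)\<^sup>-\<^sup>1\<close> is its inverse.\<close>

lemma cayley_param_in_A_group:
  assumes p: "p \<in> A_group A" and X: "X \<in> A_skew A" "X \<in> cayley_cod"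
  shows "cayley_param p X \<in> A_group A"
proof -
  have i: "op_invertible (id_blinfun - X)" "op_invertible (id_blinfun + X)" using X by (auto simp: cayley_cod_def)
  have X': "A_adjoint A X (- X)" using X by (simp add: A_skew_def)
  have p': "op_invertible p" "A_adjoint A p (op_inv p)" using p by (auto simp: A_group_eq)
  have plus: "A_adjoint A (id_blinfun + X) (id_blinfun - X)"
    using A_adjoint_add[OF A_adjoint_id X'] by simp
  have minus: "A_adjoint A (id_blinfun - X) (id_blinfun + X)"
    using A_adjoint_diff[OF A_adjoint_id X'] by simp
  have "A_adjoint A (cayley_param p X) (op_inv (id_blinfun + X) \<odot> ((id_blinfun - X) \<odot> op_inv p))"
    unfolding cayley_param_def by (intro A_adjoint_compose A_adjoint_op_inv p' plus minus i)
  also have "op_inv (id_blinfun + X) \<odot> ((id_blinfun - X) \<odot> op_inv p) = op_inv (cayley_param p X)"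
  proof -
    have "op_inv (id_blinfun + X) \<odot> (id_blinfun - X) = (id_blinfun - X) \<odot> op_inv (id_blinfun + X)"
      by (rule op_inv_commute[OF i(2)]) (simp add: op_ring)
    then show ?thesis
      using i p'(1)
      by (simp add: cayley_param_def op_inv_compose op_invertible_compose op_invertible_op_inv op_inv_op_inv
          flip: blinfun_compose_assoc)
  qed
  finally show ?thesis
    using cayley_param_eqs(3)[OF p'(1) X(2)] by (simp add: A_group_eq)
qed

lemma smooth_on_cayley_param: "smooth_on UNIV cayley_cod (cayley_param p)"
  unfolding cayley_param_def by (intro smooth_on_intros) (auto simp: cayley_cod_def)

lemma A_group_chart:
  assumes p: "p \<in> A_group A"
  shows "submanifold_chart bounded_ops (A_group A) (bounded_ops \<inter> cayley_dom p) (bounded_ops \<inter> cayley_cod)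
    (cayley_chart p) (cayley_param p) (A_skew A)"
proof -
  have p': "op_invertible p" "p \<in> bounded_ops" "op_inv p \<in> bounded_ops"
    using p by (auto simp: A_group_eq A_adjoint_def)
  note bo = compose_in_bounded_ops op_inv_in_bounded_ops id_in_bounded_ops
    subspace_add[OF subspace_bounded_ops] subspace_diff[OF subspace_bounded_ops]
  show ?thesis
  proof (rule submanifold_chartI)
    show "open (cayley_dom p)" "open (cayley_cod :: ('a \<Rightarrow>\<^sub>L 'a) set)"
      by (rule open_cayley_dom open_cayley_cod)+
    show "smooth_on UNIV (cayley_dom p) (cayley_chart p)"
      unfolding cayley_chart_def by (intro smooth_on_intros) (auto simp: cayley_dom_def)
    show "smooth_on UNIV cayley_cod (cayley_param p)"
      by (rule smooth_on_cayley_param)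
    show "cayley_chart p G \<in> bounded_ops" if "G \<in> bounded_ops" "G \<in> cayley_dom p" for G
      using that unfolding cayley_chart_def cayley_dom_def by (auto intro!: bo p')
    show "cayley_param p X \<in> bounded_ops" if "X \<in> bounded_ops" "X \<in> cayley_cod" for X
      using that unfolding cayley_param_def cayley_cod_def by (auto intro!: bo p')
    show "closed_subspace (A_skew A)"
      unfolding A_skew_eq_scaleR by (rule closed_subspace_A_adjoint)
    show "A_skew A \<subseteq> bounded_ops" "A_group A \<subseteq> bounded_ops"
      by (auto simp: A_skew_def A_group_eq A_adjoint_def)
    show "cayley_chart p G \<in> A_skew A" if "G \<in> A_group A" "G \<in> cayley_dom p" for G
      using cayley_chart_in_A_skew[OF p that] .
    show "cayley_param p X \<in> A_group A" if "X \<in> A_skew A" "X \<in> cayley_cod" for X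
      using cayley_param_in_A_group[OF p that] .
  qed (use p'(1) in \<open>auto simp: cayley_chart_in_cod cayley_param_chart cayley_param_in_dom cayley_chart_param\<close>)
qed

lemma cayley_param_0 [simp]: "cayley_param p 0 = p"
  by (simp add: cayley_param_def)

lemma zero_in_cayley_cod: "0 \<in> cayley_cod"
  by (simp add: cayley_cod_def op_invertible_id)

lemma self_in_cayley_dom: "op_invertible p \<Longrightarrow> p \<in> cayley_dom p"
  and cayley_chart_self: "op_invertible p \<Longrightarrow> cayley_chart p p = 0"
  using op_invertible_scaleR[OF op_invertible_id, of 2]
  by (simp_all add: cayley_dom_def cayley_chart_def op_cancel scaleR_2)

lemma A_group_submanifold:
  shows "submanifold bounded_ops (A_group A)"
  unfolding submanifold_def
proof (intro conjI ballI)
  show "closed_subspace (bounded_ops :: ('a \<Rightarrow>\<^sub>L 'a) set)"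
    using subspace_bounded_ops closed_bounded_ops by (simp add: closed_subspace_def)
  show "A_group A \<subseteq> bounded_ops" by (auto simp: A_group_eq A_adjoint_def)
  fix p assume p: "p \<in> A_group A"
  then have "p \<in> bounded_ops \<inter> cayley_dom p" using self_in_cayley_dom by (auto simp: A_group_eq A_adjoint_def)
  then show "\<exists>U V \<phi> \<psi> F. p \<in> U \<and> submanifold_chart bounded_ops (A_group A) U V \<phi> \<psi> F"
    using A_group_chart[OF p] by blast
qed

section \<open>Block factorizations and the charts of the compatible Grassmannian\<close>

definition coproj :: "('a::complex_hilbert \<Rightarrow>\<^sub>L 'a) \<Rightarrow> ('a \<Rightarrow>\<^sub>L 'a)"
  where "coproj Q = id_blinfun - Q"

text \<open>\<open>X\<close> is a block with range in that of the projection \<open>E\<close> and vanishing on the kernel of \<open>F\<close>.\<close>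

definition block :: "('a::complex_hilbert \<Rightarrow>\<^sub>L 'a) \<Rightarrow> ('a \<Rightarrow>\<^sub>L 'a) \<Rightarrow> ('a \<Rightarrow>\<^sub>L 'a) \<Rightarrow> bool"
  where "block E F X \<longleftrightarrow> E \<odot> X = X \<and> X \<odot> F = X"

text \<open>The upper left block of \<open>B\<close>, made into an operator on the whole space by the identity on the
  complement, so that invertibility of the block is invertibility of an operator.\<close>

definition pivot :: "('a::complex_hilbert \<Rightarrow>\<^sub>L 'a) \<Rightarrow> ('a \<Rightarrow>\<^sub>L 'a) \<Rightarrow> ('a \<Rightarrow>\<^sub>L 'a)"
  where "pivot Q B = Q \<odot> B \<odot> Q + coproj Q"

text \<open>Together with \<open>upper\<close> and \<open>schur\<close> the factors of the block \<open>LDU\<close> factorization of \<open>B\<close> with pivot \<open>Q B Q\<close>.\<close>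

definition lower :: "('a::complex_hilbert \<Rightarrow>\<^sub>L 'a) \<Rightarrow> ('a \<Rightarrow>\<^sub>L 'a) \<Rightarrow> ('a \<Rightarrow>\<^sub>L 'a)"
  where "lower Q B = coproj Q \<odot> B \<odot> Q \<odot> op_inv (pivot Q B)"

definition upper :: "('a::complex_hilbert \<Rightarrow>\<^sub>L 'a) \<Rightarrow> ('a \<Rightarrow>\<^sub>L 'a) \<Rightarrow> ('a \<Rightarrow>\<^sub>L 'a)"
  where "upper Q B = op_inv (pivot Q B) \<odot> (Q \<odot> B \<odot> coproj Q)"

definition schur :: "('a::complex_hilbert \<Rightarrow>\<^sub>L 'a) \<Rightarrow> ('a \<Rightarrow>\<^sub>L 'a) \<Rightarrow> ('a \<Rightarrow>\<^sub>L 'a)"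
  where "schur Q B = coproj Q \<odot> B \<odot> coproj Q - lower Q B \<odot> (Q \<odot> B \<odot> coproj Q)"

text \<open>The sum of the four blocks of the chart: the off-diagonal ones are the factors \<open>lower\<close> and \<open>upper\<close>, the
  diagonal ones measure how far the pivot and the Schur complement are from their values at idempotents.\<close>

definition gr_chart :: "('a::complex_hilbert \<Rightarrow>\<^sub>L 'a) \<Rightarrow> ('a \<Rightarrow>\<^sub>L 'a) \<Rightarrow> ('a \<Rightarrow>\<^sub>L 'a)"
  where "gr_chart Q B = lower Q B + upper Q B +
    (Q \<odot> B \<odot> Q - Q \<odot> op_inv (id_blinfun + upper Q B \<odot> lower Q B)) + schur Q B"

text \<open>The bound on the Schur complement excludes nonzero idempotents.\<close>

definition gr_dom :: "('a::complex_hilbert \<Rightarrow>\<^sub>L 'a) \<Rightarrow> ('a \<Rightarrow>\<^sub>L 'a) set"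
  where "gr_dom Q = {B. op_invertible (pivot Q B) \<and>
    op_invertible (id_blinfun + upper Q B \<odot> lower Q B) \<and> norm (schur Q B) < 1}"

text \<open>For the projection with range the graph of \<open>K\<close> and kernel the graph of \<open>- L\<close>, the upper left block is the
  inverse of \<open>1 + L K\<close>; here \<open>K\<close> and \<open>L\<close> are the off-diagonal blocks of \<open>Z\<close>.\<close>

definition gr_gram :: "('a::complex_hilbert \<Rightarrow>\<^sub>L 'a) \<Rightarrow> ('a \<Rightarrow>\<^sub>L 'a) \<Rightarrow> ('a \<Rightarrow>\<^sub>L 'a)"
  where "gr_gram Q Z = id_blinfun + Q \<odot> Z \<odot> coproj Q \<odot> (coproj Q \<odot> Z \<odot> Q)"

definition gr_pivot :: "('a::complex_hilbert \<Rightarrow>\<^sub>L 'a) \<Rightarrow> ('a \<Rightarrow>\<^sub>L 'a) \<Rightarrow> ('a \<Rightarrow>\<^sub>L 'a)"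
  where "gr_pivot Q Z = Q \<odot> Z \<odot> Q + Q \<odot> op_inv (gr_gram Q Z)"

definition gr_param :: "('a::complex_hilbert \<Rightarrow>\<^sub>L 'a) \<Rightarrow> ('a \<Rightarrow>\<^sub>L 'a) \<Rightarrow> ('a \<Rightarrow>\<^sub>L 'a)"
  where "gr_param Q Z = (id_blinfun + coproj Q \<odot> Z \<odot> Q) \<odot>
    (gr_pivot Q Z + coproj Q \<odot> Z \<odot> coproj Q) \<odot> (id_blinfun + Q \<odot> Z \<odot> coproj Q)"

definition gr_cod :: "('a::complex_hilbert \<Rightarrow>\<^sub>L 'a) \<Rightarrow> ('a \<Rightarrow>\<^sub>L 'a) set"
  where "gr_cod Q = {Z. op_invertible (gr_gram Q Z) \<and> op_invertible (gr_pivot Q Z + coproj Q) \<and>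
    norm (coproj Q \<odot> Z \<odot> coproj Q) < 1}"

lemma compose_assoc_eq: "X \<odot> Y = R \<Longrightarrow> X \<odot> (Y \<odot> Z) = R \<odot> Z"
  by (simp flip: blinfun_compose_assoc)

lemma blockD:
  assumes "block E F X"
  shows "E \<odot> X = X" "X \<odot> F = X" "E \<odot> (X \<odot> Z) = X \<odot> Z" "X \<odot> (F \<odot> Z) = X \<odot> Z"
  using assms compose_assoc_eq by (auto simp: block_def)

lemma block_orthogonal:
  assumes "block E F X" "block F' G Y" "F \<odot> F' = 0"
  shows "X \<odot> Y = 0" "X \<odot> (Y \<odot> Z) = 0"
proof -
  have "X \<odot> Y = X \<odot> (F \<odot> F') \<odot> Y" using assms(1,2) by (metis block_def blinfun_compose_assoc)
  then show "X \<odot> Y = 0" using assms(3) by simp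
  then show "X \<odot> (Y \<odot> Z) = 0" using compose_assoc_eq[of X Y 0] by simp
qed

context
  fixes Q P :: "'a::complex_hilbert \<Rightarrow>\<^sub>L 'a"
  assumes QQ: "Q \<odot> Q = Q"
  defines "P \<equiv> coproj Q"
begin

lemma proj_ring: "Q \<odot> Q = Q" "P \<odot> P = P" "Q \<odot> P = 0" "P \<odot> Q = 0" "Q + P = id_blinfun"
  using QQ by (simp_all add: P_def coproj_def op_ring)

lemmas proj_ring' = proj_ring(1-4) proj_ring(1-4)[THEN compose_assoc_eq]

lemma blocks: "block Q Q (Q \<odot> X \<odot> Q)" "block Q P (Q \<odot> X \<odot> P)" "block P Q (P \<odot> X \<odot> Q)" "block P P (P \<odot> X \<odot> P)"
  by (simp_all add: block_def op_ring proj_ring')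

lemma block_proj: "block Q Q Q" "block P P P"
  by (simp_all add: block_def proj_ring)

lemma block_decomp: "X = Q \<odot> X \<odot> Q + Q \<odot> X \<odot> P + P \<odot> X \<odot> Q + P \<odot> X \<odot> P"
proof -
  have "X = (Q + P) \<odot> X \<odot> (Q + P)" by (simp add: proj_ring(5))
  then show ?thesis by (simp add: op_ring algebra_simps)
qed

text \<open>The products of the four kinds of blocks with each other and with the projections, as rewrite rules.\<close>

lemma block_ring:
  assumes K: "block P Q K" and L: "block Q P L" and M: "block Q Q M" and N: "block P P N"
  shows "Q \<odot> K = 0" "P \<odot> K = K" "K \<odot> Q = K" "K \<odot> P = 0" "Q \<odot> L = L" "P \<odot> L = 0" "L \<odot> Q = 0" "L \<odot> P = L"
    "Q \<odot> M = M" "P \<odot> M = 0" "M \<odot> Q = M" "M \<odot> P = 0" "Q \<odot> N = 0" "P \<odot> N = N" "N \<odot> Q = 0" "N \<odot> P = N"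
    "K \<odot> K = 0" "L \<odot> L = 0" "K \<odot> N = 0" "M \<odot> K = 0" "L \<odot> M = 0" "N \<odot> L = 0" "M \<odot> N = 0" "N \<odot> M = 0"
  using blockD(1,2)[OF K] blockD(1,2)[OF L] blockD(1,2)[OF M] blockD(1,2)[OF N]
    block_orthogonal(1)[OF _ _ proj_ring(3)] block_orthogonal(1)[OF _ _ proj_ring(4)] assms block_proj
  by metis+

lemma op_inv_block_ring:
  assumes M: "block Q Q M" and a: "op_invertible (M + P)"
  shows "op_inv (M + P) \<odot> M = Q" "M \<odot> op_inv (M + P) = Q"
    "op_inv (M + P) \<odot> Q = Q \<odot> op_inv (M + P)"
    "op_inv (M + P) \<odot> P = P" "P \<odot> op_inv (M + P) = P"
proof -
  have MQ: "M \<odot> Q = M" "Q \<odot> M = M" "M \<odot> P = 0" "P \<odot> M = 0"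
    using M blockD block_orthogonal(1)[OF _ _ proj_ring(3)] block_orthogonal(1)[OF _ _ proj_ring(4)] block_proj by metis+
  have "(M + P) \<odot> Q = M" "Q \<odot> (M + P) = M" "(M + P) \<odot> P = P" "P \<odot> (M + P) = P"
    by (simp_all add: op_ring MQ proj_ring)
  then show "op_inv (M + P) \<odot> M = Q" "M \<odot> op_inv (M + P) = Q"
    "op_inv (M + P) \<odot> P = P" "P \<odot> op_inv (M + P) = P"
    using a by (metis op_inv_left_assoc, metis blinfun_compose_assoc blinfun_compose_id(2) op_inv_right,
       metis op_inv_left_assoc, metis blinfun_compose_assoc blinfun_compose_id(2) op_inv_right)
  show "op_inv (M + P) \<odot> Q = Q \<odot> op_inv (M + P)"
    by (rule op_inv_commute[OF a]) (simp add: op_ring MQ proj_ring)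
qed

lemma blocks_of_ldu:
  assumes K: "block P Q K" and L: "block Q P L" and M: "block Q Q M" and N: "block P P N"
    and B: "B = (id_blinfun + K) \<odot> (M + N) \<odot> (id_blinfun + L)"
  shows "Q \<odot> B \<odot> Q = M" "Q \<odot> B \<odot> P = M \<odot> L" "P \<odot> B \<odot> Q = K \<odot> M" "P \<odot> B \<odot> P = K \<odot> M \<odot> L + N"
  by (simp_all add: B op_ring block_ring[OF K L M N] block_ring[OF K L M N, THEN compose_assoc_eq])

lemma ldu_unique:
  assumes K: "block P Q K" and L: "block Q P L" and M: "block Q Q M" and N: "block P P N"
    and B: "B = (id_blinfun + K) \<odot> (M + N) \<odot> (id_blinfun + L)"
    and inv: "op_invertible (M + P)"
  shows "pivot Q B = M + P" "lower Q B = K" "upper Q B = L" "schur Q B = N"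
proof -
  note b = blocks_of_ldu[OF K L M N B]
  note i = op_inv_block_ring[OF M inv]
  show *: "pivot Q B = M + P" using b by (simp add: pivot_def P_def)
  show **: "lower Q B = K"
    using b(3) i block_ring[OF K L M N] unfolding lower_def * P_def[symmetric]
    by (simp add: blinfun_compose_assoc)
  show "upper Q B = L"
    using b(2) i block_ring[OF K L M N] unfolding upper_def * P_def[symmetric]
    by (simp flip: blinfun_compose_assoc)
  show "schur Q B = N"
    using b(2,4) unfolding schur_def ** P_def[symmetric] by (simp add: blinfun_compose_assoc)
qed

lemma ldu_blocks:
  assumes "op_invertible (pivot Q B)"
  shows "block P Q (lower Q B)" "block Q P (upper Q B)" "block P P (schur Q B)"
proof -
  note i = op_inv_block_ring[OF blocks(1), folded pivot_def[of Q, folded P_def], OF assms]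
  note i' = i[THEN compose_assoc_eq]
  show l: "block P Q (lower Q B)" and u: "block Q P (upper Q B)"
    unfolding block_def lower_def upper_def P_def[symmetric]
    by (simp_all add: blinfun_compose_assoc proj_ring' i i')
  show "block P P (schur Q B)"
    unfolding block_def schur_def P_def[symmetric]
    by (simp add: op_ring proj_ring' blockD[OF l])
qed

lemma ldu_exists:
  assumes "op_invertible (pivot Q B)"
  shows "B = (id_blinfun + lower Q B) \<odot> (Q \<odot> B \<odot> Q + schur Q B) \<odot> (id_blinfun + upper Q B)"
proof -
  note i = op_inv_block_ring[OF blocks(1), folded pivot_def[of Q, folded P_def], OF assms]
  let ?M = "Q \<odot> B \<odot> Q"
  note b = block_ring[OF ldu_blocks(1,2)[OF assms] blocks(1)[of B] ldu_blocks(3)[OF assms]]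
  have KM: "lower Q B \<odot> ?M = P \<odot> B \<odot> Q"
    using i(1) by (simp add: lower_def P_def[symmetric] blinfun_compose_assoc proj_ring')
  have MU: "?M \<odot> upper Q B = Q \<odot> B \<odot> P"
    unfolding upper_def P_def[symmetric] using i(2)[THEN compose_assoc_eq, of "Q \<odot> B \<odot> P"]
    by (simp add: blinfun_compose_assoc proj_ring')
  have KMU: "lower Q B \<odot> (Q \<odot> B \<odot> P) = P \<odot> B \<odot> P - schur Q B"
    by (simp add: schur_def P_def)
  have "(id_blinfun + lower Q B) \<odot> (?M + schur Q B) \<odot> (id_blinfun + upper Q B)
      = ?M + ?M \<odot> upper Q B + lower Q B \<odot> ?M + lower Q B \<odot> (?M \<odot> upper Q B) + schur Q B
        + (schur Q B \<odot> upper Q B + lower Q B \<odot> schur Q B + lower Q B \<odot> schur Q B \<odot> upper Q B)"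
    by (simp only: op_mult.add_left op_mult.add_right blinfun_compose_id blinfun_compose_assoc) (simp add: algebra_simps)
  also have "\<dots> = ?M + Q \<odot> B \<odot> P + P \<odot> B \<odot> Q + (P \<odot> B \<odot> P - schur Q B) + schur Q B"
    unfolding KM MU KMU using b(19,22) by simp
  also have "\<dots> = B" using block_decomp[of B] by (simp add: algebra_simps)
  finally show ?thesis ..
qed

text \<open>\<open>L K\<close> is a block of type \<open>Q Q\<close>.\<close>

lemma gram_commute:
  assumes K: "block P Q K" and L: "block Q P L" and inv: "op_invertible (id_blinfun + L \<odot> K)"
  shows "op_inv (id_blinfun + L \<odot> K) \<odot> Q = Q \<odot> op_inv (id_blinfun + L \<odot> K)"
  by (intro op_inv_commute[OF inv]) (simp add: op_ring blockD[OF K] blockD[OF L])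

lemma block_gram:
  assumes K: "block P Q K" and L: "block Q P L" and inv: "op_invertible (id_blinfun + L \<odot> K)"
  shows "block Q Q (Q \<odot> op_inv (id_blinfun + L \<odot> K))"
  using gram_commute[OF assms] by (simp add: block_def blinfun_compose_assoc proj_ring')

lemma gr_param_blocks:
  assumes "Z \<in> gr_cod Q"
  shows "block P Q (P \<odot> Z \<odot> Q)" "block Q P (Q \<odot> Z \<odot> P)" "block Q Q (gr_pivot Q Z)" "block P P (P \<odot> Z \<odot> P)"
    "gr_param Q Z = (id_blinfun + P \<odot> Z \<odot> Q) \<odot> (gr_pivot Q Z + P \<odot> Z \<odot> P) \<odot> (id_blinfun + Q \<odot> Z \<odot> P)"
    "op_invertible (gr_pivot Q Z + P)"
proof -
  have inv: "op_invertible (id_blinfun + Q \<odot> Z \<odot> P \<odot> (P \<odot> Z \<odot> Q))"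
    using assms by (simp add: gr_cod_def gr_gram_def P_def)
  have "block Q Q (X + Y)" if "block Q Q X" "block Q Q Y" for X Y
    using that by (simp add: block_def op_ring)
  then show "block Q Q (gr_pivot Q Z)"
    unfolding gr_pivot_def gr_gram_def P_def[symmetric] using blocks(1) block_gram[OF blocks(3,2) inv] by blast
  show "op_invertible (gr_pivot Q Z + P)"
    using assms by (simp add: gr_cod_def P_def)
qed (simp_all add: blocks gr_param_def P_def[symmetric])

lemma gr_param_ldu:
  assumes "Z \<in> gr_cod Q"
  shows "pivot Q (gr_param Q Z) = gr_pivot Q Z + P" "lower Q (gr_param Q Z) = P \<odot> Z \<odot> Q"
    "upper Q (gr_param Q Z) = Q \<odot> Z \<odot> P" "schur Q (gr_param Q Z) = P \<odot> Z \<odot> P"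
    "Q \<odot> gr_param Q Z \<odot> Q = gr_pivot Q Z"
  using ldu_unique[OF gr_param_blocks[OF assms]] blocks_of_ldu[OF gr_param_blocks(1-5)[OF assms]] by auto

lemma gr_param_in_dom: "Z \<in> gr_cod Q \<Longrightarrow> gr_param Q Z \<in> gr_dom Q"
  using gr_param_ldu[of Z] by (simp add: gr_dom_def gr_cod_def gr_gram_def P_def)

lemma gr_chart_param:
  assumes "Z \<in> gr_cod Q"
  shows "gr_chart Q (gr_param Q Z) = Z"
proof -
  have "gr_chart Q (gr_param Q Z) = P \<odot> Z \<odot> Q + Q \<odot> Z \<odot> P + Q \<odot> Z \<odot> Q + P \<odot> Z \<odot> P"
    unfolding gr_chart_def gr_param_ldu[OF assms] by (simp add: gr_pivot_def gr_gram_def P_def)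
  then show ?thesis using block_decomp[of Z] by (simp add: algebra_simps)
qed

lemma gr_chart_blocks:
  assumes "B \<in> gr_dom Q"
  shows "P \<odot> gr_chart Q B \<odot> Q = lower Q B" "Q \<odot> gr_chart Q B \<odot> P = upper Q B"
    "P \<odot> gr_chart Q B \<odot> P = schur Q B"
    "Q \<odot> gr_chart Q B \<odot> Q = Q \<odot> B \<odot> Q - Q \<odot> op_inv (id_blinfun + upper Q B \<odot> lower Q B)"
proof -
  have inv: "op_invertible (pivot Q B)" "op_invertible (id_blinfun + upper Q B \<odot> lower Q B)"
    using assms by (auto simp: gr_dom_def)
  note K = ldu_blocks(1)[OF inv(1)] and L = ldu_blocks(2)[OF inv(1)] and N = ldu_blocks(3)[OF inv(1)]
  define M where "M = Q \<odot> B \<odot> Q - Q \<odot> op_inv (id_blinfun + upper Q B \<odot> lower Q B)"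
  have M: "block Q Q M"
    unfolding M_def using blocks(1)[of B] block_gram[OF K L inv(2)] by (simp add: block_def op_mult.diff_left op_mult.diff_right)
  have eq: "gr_chart Q B = lower Q B + upper Q B + M + schur Q B" by (simp add: gr_chart_def M_def)
  show "P \<odot> gr_chart Q B \<odot> Q = lower Q B" "Q \<odot> gr_chart Q B \<odot> P = upper Q B"
    "P \<odot> gr_chart Q B \<odot> P = schur Q B"
    "Q \<odot> gr_chart Q B \<odot> Q = Q \<odot> B \<odot> Q - Q \<odot> op_inv (id_blinfun + upper Q B \<odot> lower Q B)"
    unfolding M_def[symmetric] unfolding eq using block_ring[OF K L M N]
    by (simp_all add: op_mult.add_left op_mult.add_right)
qed

lemma gr_chart_pivot:
  assumes "B \<in> gr_dom Q"
  shows "gr_gram Q (gr_chart Q B) = id_blinfun + upper Q B \<odot> lower Q B" "gr_pivot Q (gr_chart Q B) = Q \<odot> B \<odot> Q"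
  using gr_chart_blocks[OF assms] by (simp_all add: gr_gram_def gr_pivot_def P_def)

lemma gr_chart_in_cod: "B \<in> gr_dom Q \<Longrightarrow> gr_chart Q B \<in> gr_cod Q"
  using gr_chart_blocks[of B] gr_chart_pivot[of B] by (simp add: gr_cod_def gr_dom_def pivot_def P_def)

lemma gr_param_chart:
  assumes "B \<in> gr_dom Q"
  shows "gr_param Q (gr_chart Q B) = B"
proof -
  have "gr_param Q (gr_chart Q B) = (id_blinfun + lower Q B) \<odot> (Q \<odot> B \<odot> Q + schur Q B) \<odot> (id_blinfun + upper Q B)"
    unfolding gr_param_def P_def[symmetric] gr_chart_blocks[OF assms] gr_chart_pivot[OF assms] ..
  then show ?thesis using ldu_exists[of B] assms by (simp add: gr_dom_def)
qed

lemma codiagonal_iff: "Q \<odot> X + X \<odot> Q = X \<longleftrightarrow> Q \<odot> X \<odot> Q = 0 \<and> P \<odot> X \<odot> P = 0"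
proof
  assume *: "Q \<odot> X + X \<odot> Q = X"
  have "Q \<odot> (Q \<odot> X + X \<odot> Q) \<odot> Q = Q \<odot> X \<odot> Q" by (simp only: *)
  moreover have "P \<odot> (Q \<odot> X + X \<odot> Q) \<odot> P = P \<odot> X \<odot> P" by (simp only: *)
  ultimately show "Q \<odot> X \<odot> Q = 0 \<and> P \<odot> X \<odot> P = 0"
    by (simp add: op_mult.add_left op_mult.add_right blinfun_compose_assoc proj_ring')
next
  assume *: "Q \<odot> X \<odot> Q = 0 \<and> P \<odot> X \<odot> P = 0"
  then have X: "X = Q \<odot> X \<odot> P + P \<odot> X \<odot> Q" using block_decomp[of X] by simp
  show "Q \<odot> X + X \<odot> Q = X"
    by (subst (1 2 3) X) (simp add: op_mult.add_left op_mult.add_right blinfun_compose_assoc proj_ring')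
qed

text \<open>The outer factors have the inverses \<open>1 - K\<close> and \<open>1 - L\<close>. Cancelling them turns \<open>B B = B\<close> into
  \<open>(M + N) (1 + L) (1 + K) (M + N) = M + N\<close>, which is then compared block by block.\<close>

lemma idempotent_ldu_iff:
  assumes K: "block P Q K" and L: "block Q P L" and M: "block Q Q M" and N: "block P P N"
    and B: "B = (id_blinfun + K) \<odot> (M + N) \<odot> (id_blinfun + L)"
  shows "B \<odot> B = B \<longleftrightarrow> M \<odot> (id_blinfun + L \<odot> K) \<odot> M = M \<and> M \<odot> L \<odot> N = 0 \<and> N \<odot> K \<odot> M = 0 \<and> N \<odot> N = N"
proof -
  note r = block_ring[OF K L M N] and r' = block_ring[OF K L M N, THEN compose_assoc_eq]
  define H where "H = (M + N) \<odot> (id_blinfun + L) \<odot> (id_blinfun + K) \<odot> (M + N)"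
  have "(id_blinfun - K) \<odot> (id_blinfun + K) = id_blinfun" "(id_blinfun + L) \<odot> (id_blinfun - L) = id_blinfun"
    by (simp_all add: op_ring r)
  then have cancel: "(id_blinfun - K) \<odot> ((id_blinfun + K) \<odot> X \<odot> (id_blinfun + L)) \<odot> (id_blinfun - L) = X" for X
    by (metis blinfun_compose_assoc blinfun_compose_id)
  have "B \<odot> B = (id_blinfun + K) \<odot> H \<odot> (id_blinfun + L)"
    by (simp only: B H_def blinfun_compose_assoc)
  then have "B \<odot> B = B \<longleftrightarrow> H = M + N"
    using cancel[of H] cancel[of "M + N"] B by metis
  also have H: "H = M \<odot> (id_blinfun + L \<odot> K) \<odot> M + M \<odot> L \<odot> N + N \<odot> K \<odot> M + N \<odot> N"
    by (simp add: H_def op_ring r r' algebra_simps)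
  also have "\<dots> = M + N \<longleftrightarrow> M \<odot> (id_blinfun + L \<odot> K) \<odot> M = M \<and> M \<odot> L \<odot> N = 0 \<and> N \<odot> K \<odot> M = 0 \<and> N \<odot> N = N"
  proof
    assume *: "M \<odot> (id_blinfun + L \<odot> K) \<odot> M + M \<odot> L \<odot> N + N \<odot> K \<odot> M + N \<odot> N = M + N"
    have "E \<odot> (M \<odot> (id_blinfun + L \<odot> K) \<odot> M + M \<odot> L \<odot> N + N \<odot> K \<odot> M + N \<odot> N) \<odot> F = E \<odot> (M + N) \<odot> F" for E F
      by (simp only: *)
    from this[of Q Q] this[of Q P] this[of P Q] this[of P P]
    show "M \<odot> (id_blinfun + L \<odot> K) \<odot> M = M \<and> M \<odot> L \<odot> N = 0 \<and> N \<odot> K \<odot> M = 0 \<and> N \<odot> N = N"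
      by (simp add: op_mult.add_left op_mult.add_right blinfun_compose_assoc r r')
  qed simp
  finally show ?thesis .
qed

text \<open>The Schur complement of an idempotent is idempotent and, having norm less than \<open>1\<close>, vanishes. The
  equation for the pivot block says that it is the inverse of the Gram operator \<open>1 + L K\<close>.\<close>

lemma gr_chart_codiagonal:
  assumes B: "B \<in> gr_dom Q" "B \<odot> B = B"
  shows "Q \<odot> gr_chart Q B + gr_chart Q B \<odot> Q = gr_chart Q B"
proof -
  have inv: "op_invertible (pivot Q B)" "op_invertible (id_blinfun + upper Q B \<odot> lower Q B)"
    and small: "norm (schur Q B) < 1"
    using B by (auto simp: gr_dom_def)
  let ?K = "lower Q B" and ?L = "upper Q B" and ?M = "Q \<odot> B \<odot> Q" and ?N = "schur Q B"
  let ?g = "id_blinfun + ?L \<odot> ?K"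
  note K = ldu_blocks(1)[OF inv(1)] and L = ldu_blocks(2)[OF inv(1)] and N = ldu_blocks(3)[OF inv(1)]
  have *: "?M \<odot> ?g \<odot> ?M = ?M" and NN: "?N \<odot> ?N = ?N"
    using idempotent_ldu_iff[OF K L blocks(1) N ldu_exists[OF inv(1)]] B(2) by auto
  have "norm ?N \<le> norm ?N * norm ?N" using norm_blinfun_compose[of ?N ?N] NN by simp
  then have "norm ?N * (1 - norm ?N) \<le> 0" by (simp add: right_diff_distrib)
  then have N0: "?N = 0" using small by (simp add: mult_le_0_iff)
  note i = op_inv_block_ring[OF blocks(1), folded pivot_def[of Q, folded P_def], OF inv(1)]
  have "?g \<odot> ?M = Q"
  proof -
    have "Q \<odot> ?g \<odot> ?M = op_inv (pivot Q B) \<odot> (?M \<odot> ?g \<odot> ?M)"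
      using i(1) by (metis blinfun_compose_assoc)
    then have "Q \<odot> ?g \<odot> ?M = Q" using * i(1) by simp
    moreover have "Q \<odot> ?g = ?g \<odot> Q" by (simp add: op_ring blockD[OF K] blockD[OF L])
    ultimately have "?g \<odot> (Q \<odot> ?M) = Q" by (metis blinfun_compose_assoc)
    then show ?thesis by (simp add: blinfun_compose_assoc proj_ring')
  qed
  then have "?M = op_inv ?g \<odot> Q" using inv(2) by (metis op_inv_left_assoc)
  then have "?M = Q \<odot> op_inv ?g" using gram_commute[OF K L inv(2)] by simp
  then show ?thesis
    unfolding codiagonal_iff gr_chart_blocks[OF B(1)] using N0 by simp
qed

lemma gr_param_idempotent:
  assumes Z: "Z \<in> gr_cod Q" "Q \<odot> Z + Z \<odot> Q = Z"
  shows "gr_param Q Z \<odot> gr_param Q Z = gr_param Q Z"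
proof -
  have Z0: "Q \<odot> Z \<odot> Q = 0" "P \<odot> Z \<odot> P = 0" using Z(2) codiagonal_iff by auto
  have inv: "op_invertible (id_blinfun + Q \<odot> Z \<odot> P \<odot> (P \<odot> Z \<odot> Q))"
    using Z(1) by (simp add: gr_cod_def gr_gram_def P_def)
  let ?g = "id_blinfun + Q \<odot> Z \<odot> P \<odot> (P \<odot> Z \<odot> Q)"
  have M: "gr_pivot Q Z = Q \<odot> op_inv ?g"
    unfolding gr_pivot_def Z0(1) by (simp add: gr_gram_def P_def)
  have "gr_pivot Q Z \<odot> ?g \<odot> gr_pivot Q Z = gr_pivot Q Z"
  proof -
    have "gr_pivot Q Z \<odot> ?g \<odot> gr_pivot Q Z = Q \<odot> (op_inv ?g \<odot> (?g \<odot> (Q \<odot> op_inv ?g)))"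
      unfolding M by (simp only: blinfun_compose_assoc)
    also have "\<dots> = gr_pivot Q Z"
      unfolding M op_inv_left_assoc[OF inv] by (simp only: proj_ring')
    finally show ?thesis .
  qed
  then show ?thesis
    using idempotent_ldu_iff[OF gr_param_blocks(1-5)[OF Z(1)]] unfolding Z0(2) by simp
qed

lemma gr_dom_self: "Q \<in> gr_dom Q" and gr_self: "pivot Q Q = id_blinfun" "lower Q Q = 0" "upper Q Q = 0" "schur Q Q = 0"
proof -
  show p: "pivot Q Q = id_blinfun" and l: "lower Q Q = 0" and u: "upper Q Q = 0" and s: "schur Q Q = 0"
    unfolding pivot_def lower_def upper_def schur_def P_def[symmetric] using proj_ring by simp_all
  show "Q \<in> gr_dom Q" by (simp add: gr_dom_def p l u s op_invertible_id)
qed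

end

section \<open>Smoothness and symmetry of the charts of the Grassmannian\<close>

lemma smooth_on_pivot:
  assumes "smooth_on UNIV U f"
  shows "smooth_on UNIV U (\<lambda>x. pivot Q (f x))"
  unfolding pivot_def by (intro smooth_on_intros assms)

lemma smooth_on_ldu:
  assumes f: "smooth_on UNIV U f" "\<And>x. x \<in> U \<Longrightarrow> op_invertible (pivot Q (f x))"
  shows "smooth_on UNIV U (\<lambda>x. lower Q (f x))" "smooth_on UNIV U (\<lambda>x. upper Q (f x))"
    "smooth_on UNIV U (\<lambda>x. schur Q (f x))"
  unfolding lower_def upper_def schur_def by (intro smooth_on_intros smooth_on_pivot f; assumption)+

lemma smooth_on_gr_chart:
  assumes f: "smooth_on UNIV U f" "\<And>x. x \<in> U \<Longrightarrow> f x \<in> gr_dom Q"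
  shows "smooth_on UNIV U (\<lambda>x. gr_chart Q (f x))"
  unfolding gr_chart_def
  by (intro smooth_on_intros smooth_on_ldu f(1)) (use f(2) in \<open>auto simp: gr_dom_def\<close>)

lemma open_gr_dom: "open (gr_dom Q)"
proof -
  let ?U = "{B. op_invertible (pivot Q B)}"
  note s = smooth_on_imp_continuous_on[OF smooth_on_ldu(1)[OF smooth_on_id]]
    smooth_on_imp_continuous_on[OF smooth_on_ldu(2)[OF smooth_on_id]]
    smooth_on_imp_continuous_on[OF smooth_on_ldu(3)[OF smooth_on_id]]
  have U: "open ?U"
    using open_op_invertible_preimage[OF open_UNIV smooth_on_imp_continuous_on[OF smooth_on_pivot[OF smooth_on_id]]] by simp
  have "open {B \<in> {B \<in> ?U. op_invertible (id_blinfun + upper Q B \<odot> lower Q B)}. norm (schur Q B) < 1}"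
    by (intro open_op_invertible_preimage open_norm_less_preimage U continuous_intros s) auto
  then show ?thesis by (simp add: gr_dom_def conj_assoc)
qed

lemma smooth_on_gr_gram: "smooth_on UNIV U (gr_gram Q)"
  unfolding gr_gram_def by (intro smooth_on_intros)

lemma smooth_on_gr_pivot:
  "(\<And>Z. Z \<in> U \<Longrightarrow> op_invertible (gr_gram Q Z)) \<Longrightarrow> smooth_on UNIV U (gr_pivot Q)"
  unfolding gr_pivot_def by (intro smooth_on_intros smooth_on_gr_gram)

lemma smooth_on_gr_param: "smooth_on UNIV (gr_cod Q) (gr_param Q)"
  unfolding gr_param_def by (intro smooth_on_intros smooth_on_gr_pivot) (auto simp: gr_cod_def)

lemma open_gr_cod: "open (gr_cod Q)"
proof -
  let ?U = "{Z. op_invertible (gr_gram Q Z)}"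
  have U: "open ?U"
    using open_op_invertible_preimage[OF open_UNIV smooth_on_imp_continuous_on[OF smooth_on_gr_gram]] by simp
  have "open {Z \<in> {Z \<in> ?U. op_invertible (gr_pivot Q Z + coproj Q)}. norm (coproj Q \<odot> Z \<odot> coproj Q) < 1}"
    by (intro open_op_invertible_preimage open_norm_less_preimage U continuous_intros
        smooth_on_imp_continuous_on[OF smooth_on_gr_pivot]) auto
  then show ?thesis by (simp add: gr_cod_def conj_assoc)
qed

lemma A_adjoint_coproj: "A_adjoint A Q Q \<Longrightarrow> A_adjoint A (coproj Q) (coproj Q)"
  unfolding coproj_def by (intro A_adjoint_intros)

text \<open>Passing to adjoints reverses products, which exchanges the formulas for \<open>lower\<close> and \<open>upper\<close>.\<close>

lemma A_adjoint_ldu: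
  assumes Q: "A_adjoint A Q Q" and B: "A_adjoint A B B" and inv: "op_invertible (pivot Q B)"
  shows "A_adjoint A (lower Q B) (upper Q B)" "A_adjoint A (upper Q B) (lower Q B)"
    "A_adjoint A (schur Q B) (schur Q B)"
proof -
  note Q' = A_adjoint_coproj[OF Q]
  have "A_adjoint A (pivot Q B) (Q \<odot> (B \<odot> Q) + coproj Q)"
    unfolding pivot_def by (intro A_adjoint_intros Q B Q')
  then have piv: "A_adjoint A (pivot Q B) (pivot Q B)" by (simp add: pivot_def blinfun_compose_assoc)
  have "A_adjoint A (lower Q B) (op_inv (pivot Q B) \<odot> (Q \<odot> (B \<odot> coproj Q)))"
    unfolding lower_def by (intro A_adjoint_intros Q B Q' piv inv)
  then show l: "A_adjoint A (lower Q B) (upper Q B)" by (simp add: upper_def blinfun_compose_assoc)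
  have "A_adjoint A (upper Q B) (coproj Q \<odot> (B \<odot> Q) \<odot> op_inv (pivot Q B))"
    unfolding upper_def by (intro A_adjoint_intros Q B Q' piv inv)
  then show u: "A_adjoint A (upper Q B) (lower Q B)" by (simp add: lower_def blinfun_compose_assoc)
  have "A_adjoint A (schur Q B) (coproj Q \<odot> (B \<odot> coproj Q) - coproj Q \<odot> (B \<odot> Q) \<odot> upper Q B)"
    unfolding schur_def by (intro A_adjoint_intros Q B Q' l)
  then show "A_adjoint A (schur Q B) (schur Q B)"
    by (simp add: schur_def lower_def upper_def blinfun_compose_assoc)
qed

lemma gr_chart_symmetric:
  assumes Q: "A_adjoint A Q Q" "Q \<odot> Q = Q" and B: "A_adjoint A B B" "B \<in> gr_dom Q"
  shows "A_adjoint A (gr_chart Q B) (gr_chart Q B)"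
proof -
  have inv: "op_invertible (pivot Q B)" "op_invertible (id_blinfun + upper Q B \<odot> lower Q B)"
    using B by (auto simp: gr_dom_def)
  note l = A_adjoint_ldu[OF Q(1) B(1) inv(1)]
  have "A_adjoint A (gr_chart Q B) (upper Q B + lower Q B +
    (Q \<odot> (B \<odot> Q) - op_inv (id_blinfun + upper Q B \<odot> lower Q B) \<odot> Q) + schur Q B)"
    unfolding gr_chart_def by (intro A_adjoint_intros Q B l inv)
  then show ?thesis
    using gram_commute[OF Q(2) ldu_blocks(1,2)[OF Q(2) inv(1)] inv(2)]
    by (simp add: gr_chart_def blinfun_compose_assoc add.commute)
qed

lemma gr_param_symmetric:
  assumes Q: "A_adjoint A Q Q" "Q \<odot> Q = Q" and Z: "A_adjoint A Z Z" "Z \<in> gr_cod Q"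
  shows "A_adjoint A (gr_param Q Z) (gr_param Q Z)"
proof -
  note Q' = A_adjoint_coproj[OF Q(1)]
  have inv: "op_invertible (gr_gram Q Z)" using Z by (auto simp: gr_cod_def)
  have "A_adjoint A (gr_gram Q Z) (id_blinfun + Q \<odot> (Z \<odot> coproj Q) \<odot> (coproj Q \<odot> (Z \<odot> Q)))"
    unfolding gr_gram_def by (intro A_adjoint_intros Q Z Q')
  then have g: "A_adjoint A (gr_gram Q Z) (gr_gram Q Z)" by (simp add: gr_gram_def blinfun_compose_assoc)
  have "A_adjoint A (gr_pivot Q Z) (Q \<odot> (Z \<odot> Q) + op_inv (gr_gram Q Z) \<odot> Q)"
    unfolding gr_pivot_def by (intro A_adjoint_intros Q Z g inv)
  moreover have "op_inv (gr_gram Q Z) \<odot> Q = Q \<odot> op_inv (gr_gram Q Z)"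
    using gram_commute[OF Q(2) blocks(3,2)[OF Q(2)] inv[unfolded gr_gram_def]] by (simp add: gr_gram_def)
  ultimately have p: "A_adjoint A (gr_pivot Q Z) (gr_pivot Q Z)" by (simp add: gr_pivot_def blinfun_compose_assoc)
  have "A_adjoint A (gr_param Q Z) ((id_blinfun + coproj Q \<odot> (Z \<odot> Q)) \<odot>
      ((gr_pivot Q Z + coproj Q \<odot> (Z \<odot> coproj Q)) \<odot> (id_blinfun + Q \<odot> (Z \<odot> coproj Q))))"
    unfolding gr_param_def by (intro A_adjoint_intros Q Z Q' p)
  then show ?thesis by (simp add: gr_param_def blinfun_compose_assoc)
qed

section \<open>Codiagonal operators and tangent spaces\<close>

definition gr_tangent :: "('a::complex_hilbert \<Rightarrow>\<^sub>L 'a) \<Rightarrow> ('a \<Rightarrow>\<^sub>L 'a) \<Rightarrow> ('a \<Rightarrow>\<^sub>L 'a) set"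
  where "gr_tangent A Q = {X \<in> A_symmetric A. Q \<odot> X + X \<odot> Q = X}"

text \<open>The map \<open>X \<mapsto> Q X + X Q - 2 Q X Q\<close> projects onto the codiagonal operators along the commutant of \<open>Q\<close>, and
  it preserves the symmetry type. The sign \<open>r = 1\<close> concerns the tangent spaces of the Grassmannian,
  \<open>r = - 1\<close> the kernel of the derivative of the orbit map.\<close>

lemma codiagonal_complemented:
  fixes r :: real
  assumes Q: "A_adjoint A Q Q" "Q \<odot> Q = Q"
  defines "E \<equiv> {X. A_adjoint A X (r *\<^sub>R X)}"
  shows "complemented_in E {X \<in> E. Q \<odot> X + X \<odot> Q = X}" "complemented_in E {X \<in> E. Q \<odot> X = X \<odot> Q}"
proof -
  let ?F = "{X \<in> E. Q \<odot> X + X \<odot> Q = X}" and ?K = "{X \<in> E. Q \<odot> X = X \<odot> Q}"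
  have E: "subspace E" "closed E"
    using closed_subspace_A_adjoint[of A r] by (auto simp: E_def closed_subspace_def)
  have "closed (E \<inter> {X. Q \<odot> X + X \<odot> Q = X})" "closed (E \<inter> {X. Q \<odot> X = X \<odot> Q})"
    by (intro closed_Int E closed_Collect_eq continuous_intros)+
  then have cl: "closed ?F" "closed ?K" by (simp_all add: Int_def)
  have "subspace ?F" "subspace ?K"
    using E(1) by (auto simp: subspace_def op_mult.zero_right op_mult.zero_left op_ring
        scaleR_add_right[symmetric] algebra_simps)
  then have sub: "closed_subspace ?F" "closed_subspace ?K" using cl by (auto simp: closed_subspace_def)
  have int: "?F \<inter> ?K = {0}"
  proof -
    have "X = 0" if "Q \<odot> X + X \<odot> Q = X" "Q \<odot> X = X \<odot> Q" for X
    proof -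
      have "Q \<odot> (Q \<odot> X + X \<odot> Q) = Q \<odot> X" by (simp only: that(1))
      then have "Q \<odot> (X \<odot> Q) = 0" by (simp add: op_ring compose_assoc_eq[OF Q(2)])
      then have "Q \<odot> X = 0" using compose_assoc_eq[OF Q(2), of X] that(2) by simp
      then show "X = 0" using that by simp
    qed
    then show ?thesis using E(1) by (auto simp: subspace_0)
  qed
  have dec: "\<exists>x\<in>?F. \<exists>y\<in>?K. X = x + y" if X: "X \<in> E" for X
  proof -
    define C where "C = Q \<odot> X + X \<odot> Q - 2 *\<^sub>R (Q \<odot> X \<odot> Q)"
    have X': "A_adjoint A X (r *\<^sub>R X)" using X by (simp add: E_def)
    have "A_adjoint A C (r *\<^sub>R X \<odot> Q + Q \<odot> (r *\<^sub>R X) - 2 *\<^sub>R (Q \<odot> (r *\<^sub>R X \<odot> Q)))"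
      unfolding C_def by (intro A_adjoint_intros Q X')
    then have C: "C \<in> E"
      by (simp add: E_def C_def op_mult.scaleR_left op_mult.scaleR_right blinfun_compose_assoc
          scaleR_add_right scaleR_diff_right add.commute mult.commute)
    moreover have "Q \<odot> C + C \<odot> Q = C"
      unfolding C_def by (simp add: op_ring Q(2) compose_assoc_eq[OF Q(2)] scaleR_2)
    moreover have "X - C \<in> E" using E(1) X C by (simp add: subspace_diff)
    moreover have "Q \<odot> (X - C) = (X - C) \<odot> Q"
      unfolding C_def by (simp add: op_ring Q(2) compose_assoc_eq[OF Q(2)] scaleR_2)
    ultimately show ?thesis by (intro bexI[of _ C] bexI[of _ "X - C"]) auto
  qed
  then have sum: "{x + y |x y. x \<in> ?F \<and> y \<in> ?K} = E"
    using E(1) by (auto simp: subspace_add) blast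
  have comm: "{x + y |x y. x \<in> ?K \<and> y \<in> ?F} = {x + y |x y. x \<in> ?F \<and> y \<in> ?K}"
    by (auto simp: add.commute) (metis add.commute)+
  have sum': "{x + y |x y. x \<in> ?K \<and> y \<in> ?F} = E" using comm sum by (rule trans)
  show "complemented_in E ?F"
    unfolding complemented_in_def using sub int sum by (intro conjI exI[of _ ?K]; (assumption | blast))
  have "?K \<inter> ?F = {0}" using int by (simp add: Int_commute)
  then show "complemented_in E ?K"
    unfolding complemented_in_def using sub sum' by (intro conjI exI[of _ ?F]; (assumption | blast))
qed

lemma gr_tangent_complemented:
  assumes "Q \<in> compat_Gr A"
  shows "complemented_in (A_symmetric A) (gr_tangent A Q)"
  using codiagonal_complemented(1)[of A Q 1] assms
  unfolding gr_tangent_def A_symmetric_eq_scaleR by (simp add: compat_Gr_eq A_symmetric_eq)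

lemma gr_submanifold_chart:
  assumes Q: "Q \<in> compat_Gr A"
  shows "submanifold_chart (A_symmetric A) (compat_Gr A) (A_symmetric A \<inter> gr_dom Q) (A_symmetric A \<inter> gr_cod Q)
    (gr_chart Q) (gr_param Q) (gr_tangent A Q)"
proof -
  have Q': "A_adjoint A Q Q" "Q \<odot> Q = Q" using Q by (auto simp: compat_Gr_eq A_symmetric_eq)
  show ?thesis
  proof (rule submanifold_chartI)
    show "smooth_on UNIV (gr_dom Q) (gr_chart Q)" using smooth_on_gr_chart[OF smooth_on_id] by blast
    show "closed_subspace (gr_tangent A Q)" "gr_tangent A Q \<subseteq> A_symmetric A"
      using gr_tangent_complemented[OF assms] by (auto simp: complemented_in_def)
    show "gr_chart Q B \<in> A_symmetric A" if "B \<in> A_symmetric A" "B \<in> gr_dom Q" for B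
      using that gr_chart_symmetric[OF Q'] by (simp add: A_symmetric_eq)
    show "gr_param Q Z \<in> A_symmetric A" if "Z \<in> A_symmetric A" "Z \<in> gr_cod Q" for Z
      using that gr_param_symmetric[OF Q'] by (simp add: A_symmetric_eq)
    show "gr_chart Q B \<in> gr_tangent A Q" if "B \<in> compat_Gr A" "B \<in> gr_dom Q" for B
      using that gr_chart_symmetric[OF Q'] gr_chart_codiagonal[OF Q'(2)]
      by (simp add: gr_tangent_def compat_Gr_eq A_symmetric_eq)
    show "gr_param Q Z \<in> compat_Gr A" if "Z \<in> gr_tangent A Q" "Z \<in> gr_cod Q" for Z
      using that gr_param_symmetric[OF Q'] gr_param_idempotent[OF Q'(2)]
      by (simp add: gr_tangent_def compat_Gr_eq A_symmetric_eq)
  qed (auto simp: open_gr_dom open_gr_cod smooth_on_gr_param compat_Gr_eq gr_chart_in_cod[OF Q'(2)]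
      gr_param_chart[OF Q'(2)] gr_chart_param[OF Q'(2)] gr_param_in_dom[OF Q'(2)])
qed

text \<open>This is why the group acts infinitesimally transitively: a tangent vector \<open>X\<close> is the commutator of \<open>Q\<close>
  with the skew operator \<open>X Q - Q X\<close>.\<close>

lemma double_commutator:
  fixes Q X :: "'a::complex_hilbert \<Rightarrow>\<^sub>L 'a"
  assumes Q: "Q \<odot> Q = Q" and X: "Q \<odot> X + X \<odot> Q = X"
  shows "(X \<odot> Q - Q \<odot> X) \<odot> Q - Q \<odot> (X \<odot> Q - Q \<odot> X) = X"
proof -
  have "Q \<odot> X \<odot> Q = 0" using codiagonal_iff[OF Q] X by blast
  then have "(X \<odot> Q - Q \<odot> X) \<odot> Q - Q \<odot> (X \<odot> Q - Q \<odot> X) = Q \<odot> X + X \<odot> Q"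
    by (simp add: op_ring Q compose_assoc_eq[OF Q])
  then show ?thesis using X by simp
qed

lemma smooth_on_orbit_map:
  assumes "smooth_on UNIV U f" "\<And>x. x \<in> U \<Longrightarrow> op_invertible (f x)"
  shows "smooth_on UNIV U (\<lambda>x. orbit_map Q (f x))"
  unfolding orbit_map_def by (intro smooth_on_intros assms)

lemma smooth_on_orbit_cayley:
  assumes "smooth_on UNIV U f" "\<And>x. x \<in> U \<Longrightarrow> f x \<in> cayley_cod" "op_invertible p"
  shows "smooth_on UNIV U (\<lambda>x. orbit_map Q (cayley_param p (f x)))"
proof (rule smooth_on_orbit_map)
  show "smooth_on UNIV U (\<lambda>x. cayley_param p (f x))"
    unfolding cayley_param_def by (intro smooth_on_intros assms(1)) (use assms(2) in \<open>auto simp: cayley_cod_def\<close>)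
qed (use assms cayley_param_eqs(3) in blast)

lemma has_derivative_cayley_param: "(cayley_param p has_derivative (\<lambda>v. 2 *\<^sub>R (p \<odot> v))) (at 0)"
proof -
  have a: "((\<lambda>X. p \<odot> (id_blinfun + X)) has_derivative (\<lambda>v. p \<odot> v)) (at 0)"
    by (rule has_derivative_eq_rhs[OF has_derivative_compose_op[OF has_derivative_const
            has_derivative_add[OF has_derivative_const has_derivative_ident]]]) simp
  have "((\<lambda>X. id_blinfun - X) has_derivative (\<lambda>v. 0 - v)) (at (0 :: 'a \<Rightarrow>\<^sub>L 'a))"
    by (intro has_derivative_diff has_derivative_const has_derivative_ident)
  from has_derivative_op_inv_fun[OF this]
  have b: "((\<lambda>X. op_inv (id_blinfun - X)) has_derivative (\<lambda>v. v)) (at (0 :: 'a \<Rightarrow>\<^sub>L 'a))"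
    by (simp add: op_invertible_id op_mult.minus_left op_mult.minus_right)
  show ?thesis
    unfolding cayley_param_def
    by (rule has_derivative_eq_rhs[OF has_derivative_compose_op[OF a b]]) (simp add: scaleR_2)
qed

lemma has_derivative_orbit_map:
  assumes p: "op_invertible p"
  shows "(orbit_map Q has_derivative (\<lambda>v. v \<odot> Q \<odot> op_inv p - p \<odot> Q \<odot> op_inv p \<odot> v \<odot> op_inv p)) (at p)"
proof -
  have a: "((\<lambda>G. G \<odot> Q) has_derivative (\<lambda>v. v \<odot> Q)) (at p)"
    by (rule has_derivative_eq_rhs[OF has_derivative_compose_op[OF has_derivative_ident has_derivative_const]]) simp
  show ?thesis
    unfolding orbit_map_def
    by (rule has_derivative_eq_rhs[OF has_derivative_compose_op[OF a has_derivative_op_inv[OF p]]])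
      (simp add: op_ring)
qed

lemma has_derivative_orbit_cayley:
  assumes p: "op_invertible p"
  shows "((\<lambda>X. orbit_map Q (cayley_param p X)) has_derivative
    (\<lambda>v. 2 *\<^sub>R (p \<odot> (v \<odot> Q - Q \<odot> v) \<odot> op_inv p))) (at 0)"
  by (rule has_derivative_eq_rhs[OF has_derivative_compose[OF has_derivative_cayley_param,
          of "orbit_map Q", simplified, OF has_derivative_orbit_map[OF p]]])
    (simp add: op_ring op_cancel p scaleR_diff_right)

text \<open>Differentiating \<open>\<gamma> \<gamma> = \<gamma>\<close> shows that velocities are codiagonal. Conversely, \<open>X\<close> is the velocity of the
  curve that moves \<open>Q\<close> by the Cayley transforms of the multiples of \<open>(X Q - Q X) / 2\<close>.\<close>

lemma tangent_space_eq:
  assumes N: "N \<subseteq> compat_Gr A" "orbit A Q \<subseteq> N" and Q: "Q \<in> N"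
  shows "tangent_space N Q = gr_tangent A Q"
proof
  have Q': "A_adjoint A Q Q" "Q \<odot> Q = Q" using N Q by (auto simp: compat_Gr_eq A_symmetric_eq)
  show "tangent_space N Q \<subseteq> gr_tangent A Q"
  proof
    fix v assume "v \<in> tangent_space N Q"
    then obtain \<gamma> e where e: "0 < e" and im: "\<gamma> ` {-e<..<e} \<subseteq> N" and \<gamma>0: "\<gamma> 0 = Q"
      and d: "(\<gamma> has_vector_derivative v) (at (0::real))"
      unfolding tangent_space_def by blast
    have im': "\<gamma> ` {-e<..<e} \<subseteq> A_symmetric A" using im N by (auto simp: compat_Gr_eq)
    have cs: "closed_subspace (A_symmetric A)"
      unfolding A_symmetric_eq_scaleR by (rule closed_subspace_A_adjoint)
    have "v \<in> A_symmetric A"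
      by (rule has_vector_derivative_mem_closed_subspace[OF cs e im' d])
    moreover have "Q \<odot> v + v \<odot> Q = v"
    proof -
      have "((\<lambda>t. \<gamma> t \<odot> \<gamma> t) has_vector_derivative (Q \<odot> v + v \<odot> Q)) (at 0)"
        using bounded_bilinear.has_vector_derivative[OF bounded_bilinear_blinfun_compose d d] by (simp add: \<gamma>0)
      then have "(\<gamma> has_vector_derivative (Q \<odot> v + v \<odot> Q)) (at 0)"
      proof (rule has_vector_derivative_transform_within_open[of _ _ _ "{-e<..<e}"])
        show "\<gamma> t \<odot> \<gamma> t = \<gamma> t" if "t \<in> {-e<..<e}" for t
          using im N that by (auto simp: compat_Gr_eq image_subset_iff subset_iff)
      qed (use e in auto)
      then show ?thesis using d by (rule vector_derivative_unique_at)
    qed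
    ultimately show "v \<in> gr_tangent A Q" by (simp add: gr_tangent_def)
  qed
  show "gr_tangent A Q \<subseteq> tangent_space N Q"
  proof
    fix X assume "X \<in> gr_tangent A Q"
    then have X: "A_adjoint A X X" "Q \<odot> X + X \<odot> Q = X" by (auto simp: gr_tangent_def A_symmetric_eq)
    (* one half, since the Cayley transform has derivative 2 at 0 *)
    define Y where "Y = (1 / 2) *\<^sub>R (X \<odot> Q - Q \<odot> X)"
    have skew: "t *\<^sub>R Y \<in> A_skew A" for t
      using commutator_in_A_skew[OF X(1) Q'(1)] A_adjoint_scaleR[of A "X \<odot> Q - Q \<odot> X" _ "t * (1 / 2)"]
      by (simp add: A_skew_def Y_def flip: scaleR_minus_right)
    define \<gamma> where "\<gamma> t = orbit_map Q (cayley_param id_blinfun (t *\<^sub>R Y))" for t :: real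
    have lin: "bounded_linear (\<lambda>t::real. t *\<^sub>R Y)" by (rule bounded_linear_scaleR_left)
    have "open ((\<lambda>t::real. t *\<^sub>R Y) -` cayley_cod)"
      by (intro open_vimage open_cayley_cod continuous_intros)
    moreover have "(0::real) \<in> (\<lambda>t. t *\<^sub>R Y) -` cayley_cod" by (simp add: zero_in_cayley_cod)
    ultimately obtain e where e: "0 < e" "ball (0::real) e \<subseteq> (\<lambda>t. t *\<^sub>R Y) -` cayley_cod"
      using open_contains_ball by metis
    have cod: "t *\<^sub>R Y \<in> cayley_cod" if "t \<in> {-e<..<e}" for t
      using e(2) that by (auto simp: subset_iff)
    have "smooth_on UNIV {-e<..<e} \<gamma>"
      unfolding \<gamma>_def by (intro smooth_on_orbit_cayley smooth_on_bounded_linear lin cod op_invertible_id)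
    moreover have "\<gamma> ` {-e<..<e} \<subseteq> N"
    proof -
      have "\<gamma> t \<in> orbit A Q" if "t \<in> {-e<..<e}" for t
        using cayley_param_in_A_group[OF A_group_id skew cod[OF that]] by (simp add: \<gamma>_def orbit_def)
      then show ?thesis using N(2) by blast
    qed
    moreover have "\<gamma> 0 = Q" by (simp add: \<gamma>_def orbit_map_def)
    moreover have "(\<gamma> has_vector_derivative X) (at 0)"
    proof -
      have "(\<gamma> has_derivative (\<lambda>t. 2 *\<^sub>R (id_blinfun \<odot> ((t *\<^sub>R Y) \<odot> Q - Q \<odot> (t *\<^sub>R Y)) \<odot> op_inv id_blinfun))) (at 0)"
        unfolding \<gamma>_def
        by (rule has_derivative_compose[OF bounded_linear_imp_has_derivative[OF lin]])
          (use has_derivative_orbit_cayley[OF op_invertible_id, of Q] in simp)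
      moreover have "2 *\<^sub>R (id_blinfun \<odot> ((t *\<^sub>R Y) \<odot> Q - Q \<odot> (t *\<^sub>R Y)) \<odot> op_inv id_blinfun) = t *\<^sub>R X" for t
      proof -
        have "2 *\<^sub>R (id_blinfun \<odot> ((t *\<^sub>R Y) \<odot> Q - Q \<odot> (t *\<^sub>R Y)) \<odot> op_inv id_blinfun)
          = t *\<^sub>R ((X \<odot> Q - Q \<odot> X) \<odot> Q - Q \<odot> (X \<odot> Q - Q \<odot> X))"
          by (simp add: Y_def op_mult.scaleR_left op_mult.scaleR_right flip: scaleR_diff_right)
        then show ?thesis by (simp only: double_commutator[OF Q'(2) X(2)])
      qed
      ultimately show ?thesis by (simp add: has_vector_derivative_def)
    qed
    ultimately show "X \<in> tangent_space N Q"
      using e(1) unfolding tangent_space_def by blast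
  qed
qed

section \<open>Unions of orbits as submanifolds\<close>

text \<open>In the ball of radius \<open>1/2\<close> around \<open>Q\<close>, a union of orbits that contains \<open>Q\<close> coincides with the whole
  Grassmannian, so the charts of the latter apply.\<close>

lemma orbit_union_chart:
  assumes N: "N \<subseteq> compat_Gr A" "orbit A Q \<subseteq> N" and Q: "Q \<in> N"
  defines "W \<equiv> A_symmetric A \<inter> (gr_dom Q \<inter> ball Q (1 / 2))"
  shows "Q \<in> W"
    "submanifold_chart (A_symmetric A) N W (gr_chart Q ` W) (gr_chart Q) (gr_param Q) (gr_tangent A Q)"
proof -
  have Q': "Q \<in> compat_Gr A" using N Q by blast
  then have "Q \<odot> Q = Q" "Q \<in> A_symmetric A" by (auto simp: compat_Gr_eq)
  then show "Q \<in> W" using gr_dom_self by (simp add: W_def)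
  show "submanifold_chart (A_symmetric A) N W (gr_chart Q ` W) (gr_chart Q) (gr_param Q) (gr_tangent A Q)"
  proof (rule submanifold_chart_restrict[OF gr_submanifold_chart[OF Q']])
    show "openin (top_of_set (A_symmetric A)) W"
      unfolding W_def by (intro openin_open_Int open_Int open_gr_dom open_ball)
    show "N \<inter> W = compat_Gr A \<inter> W"
    proof -
      have "P \<in> N" if "P \<in> compat_Gr A" "P \<in> W" for P
      proof -
        have "norm (P - Q) \<le> 1 / 2" using that(2) by (simp add: W_def dist_norm norm_minus_commute)
        then show ?thesis using near_projections_same_orbit[OF that(1) Q'] N(2) by blast
      qed
      then show ?thesis using N(1) by blast
    qed
  qed (auto simp: W_def)
qed

lemma orbit_union_complemented_submanifold:
  assumes N: "N \<subseteq> compat_Gr A" "\<And>Q. Q \<in> N \<Longrightarrow> orbit A Q \<subseteq> N"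
  shows "complemented_submanifold (A_symmetric A) N"
  unfolding complemented_submanifold_def submanifold_def
proof (intro conjI ballI)
  show "closed_subspace (A_symmetric A)"
    unfolding A_symmetric_eq_scaleR by (rule closed_subspace_A_adjoint)
  show "N \<subseteq> A_symmetric A" using N(1) by (auto simp: compat_Gr_eq)
  fix Q assume Q: "Q \<in> N"
  show "\<exists>U V \<phi> \<psi> F. Q \<in> U \<and> submanifold_chart (A_symmetric A) N U V \<phi> \<psi> F"
    using orbit_union_chart[OF N(1) N(2)[OF Q] Q] by blast
  show "complemented_in (A_symmetric A) (tangent_space N Q)"
    using tangent_space_eq[OF N(1) N(2)[OF Q] Q] gr_tangent_complemented N(1) Q by auto
qed

section \<open>The orbit map as a submersion\<close>

text \<open>At \<open>Q\<close> the off-diagonal factors vanish, so the terms quadratic in them do not contribute, and the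
  derivative of each block of the chart is the corresponding block of the direction.\<close>

lemma has_derivative_gr_chart:
  assumes Q: "Q \<odot> Q = Q"
  shows "(gr_chart Q has_derivative (\<lambda>v. v)) (at Q)"
proof -
  let ?P = "coproj Q"
  note pr = proj_ring'[OF Q]
  note gs = gr_self[OF Q]
  have sandwich: "((\<lambda>B. E \<odot> B \<odot> F) has_derivative (\<lambda>v. E \<odot> v \<odot> F)) (at Q)" for E F :: "'a \<Rightarrow>\<^sub>L 'a"
    by (auto intro!: derivative_eq_intros has_derivative_compose_op simp: op_mult.zero_left op_mult.zero_right)
  have inv: "op_invertible (pivot Q Q)" by (simp add: gs op_invertible_id)
  have dp: "(pivot Q has_derivative (\<lambda>v. Q \<odot> v \<odot> Q)) (at Q)"
    unfolding pivot_def by (auto intro!: derivative_eq_intros sandwich)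
  have di: "((\<lambda>B. op_inv (pivot Q B)) has_derivative (\<lambda>v. - (Q \<odot> v \<odot> Q))) (at Q)"
    using has_derivative_op_inv_fun[OF dp inv] by (simp add: gs)
  have dl: "(lower Q has_derivative (\<lambda>v. ?P \<odot> v \<odot> Q)) (at Q)"
    unfolding lower_def
    by (rule has_derivative_eq_rhs[OF has_derivative_compose_op[OF sandwich di]]) (simp add: gs blinfun_compose_assoc pr)
  have du: "(upper Q has_derivative (\<lambda>v. Q \<odot> v \<odot> ?P)) (at Q)"
    unfolding upper_def
    by (rule has_derivative_eq_rhs[OF has_derivative_compose_op[OF di sandwich]]) (simp add: gs blinfun_compose_assoc pr)
  have ds: "(schur Q has_derivative (\<lambda>v. ?P \<odot> v \<odot> ?P)) (at Q)"
    unfolding schur_def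
    by (rule has_derivative_eq_rhs[OF has_derivative_diff[OF sandwich has_derivative_compose_op[OF dl sandwich]]])
      (simp add: gs blinfun_compose_assoc pr)
  have dg: "((\<lambda>B. id_blinfun + upper Q B \<odot> lower Q B) has_derivative (\<lambda>v. 0)) (at Q)"
    by (rule has_derivative_eq_rhs[OF has_derivative_add[OF has_derivative_const has_derivative_compose_op[OF du dl]]])
      (simp add: gs)
  have dgi: "((\<lambda>B. op_inv (id_blinfun + upper Q B \<odot> lower Q B)) has_derivative (\<lambda>v. 0)) (at Q)"
    by (rule has_derivative_eq_rhs[OF has_derivative_op_inv_fun[OF dg]]) (simp_all add: gs op_invertible_id)
  have dq: "((\<lambda>B. Q \<odot> op_inv (id_blinfun + upper Q B \<odot> lower Q B)) has_derivative (\<lambda>v. 0)) (at Q)"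
    by (rule has_derivative_eq_rhs[OF has_derivative_compose_op[OF has_derivative_const dgi]]) simp
  have "(gr_chart Q has_derivative (\<lambda>v. ?P \<odot> v \<odot> Q + Q \<odot> v \<odot> ?P + (Q \<odot> v \<odot> Q - 0) + ?P \<odot> v \<odot> ?P)) (at Q)"
    unfolding gr_chart_def by (intro has_derivative_add has_derivative_diff dl du sandwich dq ds)
  moreover have "?P \<odot> v \<odot> Q + Q \<odot> v \<odot> ?P + (Q \<odot> v \<odot> Q - 0) + ?P \<odot> v \<odot> ?P = v" for v
    using block_decomp[OF Q, of v] by (simp add: algebra_simps)
  ultimately show ?thesis by simp
qed

lemma gr_tangent_conjugate:
  assumes p: "p \<in> A_group A" and Z: "Z \<in> gr_tangent A Q"
  shows "p \<odot> Z \<odot> op_inv p \<in> gr_tangent A (orbit_map Q p)"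
proof -
  have p': "op_invertible p" "A_adjoint A p (op_inv p)" using p by (auto simp: A_group_eq)
  have Z': "A_adjoint A Z Z" "Q \<odot> Z + Z \<odot> Q = Z" using Z by (auto simp: gr_tangent_def A_symmetric_eq)
  have "A_adjoint A (p \<odot> Z \<odot> op_inv p) (op_inv (op_inv p) \<odot> (Z \<odot> op_inv p))"
    by (intro A_adjoint_intros p' Z' op_invertible_op_inv)
  then have "A_adjoint A (p \<odot> Z \<odot> op_inv p) (p \<odot> Z \<odot> op_inv p)"
    using p' by (simp add: op_inv_op_inv blinfun_compose_assoc)
  moreover have "orbit_map Q p \<odot> (p \<odot> Z \<odot> op_inv p) + (p \<odot> Z \<odot> op_inv p) \<odot> orbit_map Q p
      = p \<odot> (Q \<odot> Z + Z \<odot> Q) \<odot> op_inv p"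
    using p'(1) by (simp add: orbit_map_def op_ring op_cancel)
  ultimately show ?thesis using Z'(2) by (simp add: gr_tangent_def A_symmetric_eq)
qed

text \<open>Conjugation by \<open>p\<close> reduces surjectivity to \<open>p = 1\<close>, where \<open>double_commutator\<close> gives a preimage.\<close>

lemma orbit_map_derivative_image:
  assumes p: "p \<in> A_group A" and Q: "Q \<in> compat_Gr A"
  defines "L \<equiv> \<lambda>X. 2 *\<^sub>R (p \<odot> (X \<odot> Q - Q \<odot> X) \<odot> op_inv p)"
  shows "L ` A_skew A = gr_tangent A (orbit_map Q p)"
proof -
  have Q': "A_adjoint A Q Q" "Q \<odot> Q = Q" using Q by (auto simp: compat_Gr_eq A_symmetric_eq)
  have p': "op_invertible p" using p by (simp add: A_group_eq)
  have scale: "r *\<^sub>R Z \<in> gr_tangent A R" if "Z \<in> gr_tangent A R" for r Z R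
    using that A_adjoint_scaleR[of A Z Z r]
    by (auto simp: gr_tangent_def A_symmetric_eq op_mult.scaleR_left op_mult.scaleR_right simp flip: scaleR_add_right)
  show ?thesis
  proof
    show "L ` A_skew A \<subseteq> gr_tangent A (orbit_map Q p)"
    proof
      fix T assume "T \<in> L ` A_skew A"
      then obtain X where X: "A_adjoint A X (- X)" and T: "T = L X" by (auto simp: A_skew_def)
      have "A_adjoint A (X \<odot> Q - Q \<odot> X) (Q \<odot> (- X) - (- X) \<odot> Q)"
        by (intro A_adjoint_intros Q' X)
      then have "X \<odot> Q - Q \<odot> X \<in> gr_tangent A Q"
        by (simp add: gr_tangent_def A_symmetric_eq op_ring Q'(2) compose_assoc_eq[OF Q'(2)])
      then show "T \<in> gr_tangent A (orbit_map Q p)"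
        unfolding T L_def by (intro scale gr_tangent_conjugate[OF p])
    qed
    show "gr_tangent A (orbit_map Q p) \<subseteq> L ` A_skew A"
    proof
      fix T assume T: "T \<in> gr_tangent A (orbit_map Q p)"
      define Z where "Z = op_inv p \<odot> T \<odot> p"
      have "orbit_map (orbit_map Q p) (op_inv p) = Q"
        using p' by (simp add: orbit_map_def op_inv_op_inv op_ring op_cancel)
      then have "Z \<in> gr_tangent A Q"
        using gr_tangent_conjugate[OF A_group_op_inv[OF p] T] p' by (simp add: Z_def op_inv_op_inv)
      then have Z: "A_adjoint A Z Z" "Q \<odot> Z + Z \<odot> Q = Z" by (auto simp: gr_tangent_def A_symmetric_eq)
      define X where "X = (1 / 2) *\<^sub>R (Z \<odot> Q - Q \<odot> Z)"
      have "X \<in> A_skew A"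
        using commutator_in_A_skew[OF Z(1) Q'(1)] A_adjoint_scaleR[of A "Z \<odot> Q - Q \<odot> Z" _ "1 / 2"]
        by (simp add: A_skew_def X_def flip: scaleR_minus_right)
      moreover have "L X = T"
      proof -
        have "L X = p \<odot> ((Z \<odot> Q - Q \<odot> Z) \<odot> Q - Q \<odot> (Z \<odot> Q - Q \<odot> Z)) \<odot> op_inv p"
          by (simp add: L_def X_def op_mult.scaleR_left op_mult.scaleR_right flip: scaleR_diff_right)
        also have "\<dots> = p \<odot> Z \<odot> op_inv p" by (simp only: double_commutator[OF Q'(2) Z(2)])
        also have "\<dots> = T" using p' by (simp add: Z_def blinfun_compose_assoc op_cancel)
        finally show ?thesis .
      qed
      ultimately show "T \<in> L ` A_skew A" by blast
    qed
  qed
qed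

lemma orbit_map_submersion:
  assumes Q0: "Q0 \<in> compat_Gr A"
  shows "smooth_submersion bounded_ops (A_group A) (A_symmetric A) (orbit A Q0) (orbit_map Q0)"
  unfolding smooth_submersion_def
proof (intro conjI ballI)
  have Q0': "A_adjoint A Q0 Q0" "Q0 \<odot> Q0 = Q0" using Q0 by (auto simp: compat_Gr_eq A_symmetric_eq)
  have N: "orbit A Q0 \<subseteq> compat_Gr A" by (rule orbit_subset_compat_Gr[OF Q0])
  have orbits: "orbit A Q \<subseteq> orbit A Q0" if "Q \<in> orbit A Q0" for Q
    using orbit_eq_if_mem[OF that] by simp
  show "submanifold bounded_ops (A_group A)" by (rule A_group_submanifold)
  show "submanifold (A_symmetric A) (orbit A Q0)"
    using orbit_union_complemented_submanifold[OF N orbits] by (simp add: complemented_submanifold_def)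
  show "orbit_map Q0 ` A_group A \<subseteq> orbit A Q0" by (simp add: orbit_def)
  fix p assume p: "p \<in> A_group A"
  have p': "op_invertible p" "p \<in> bounded_ops" using p by (auto simp: A_group_eq A_adjoint_def)
  define Q where "Q = orbit_map Q0 p"
  have Q: "Q \<in> orbit A Q0" using p by (simp add: Q_def orbit_def)
  then have QQ: "Q \<odot> Q = Q" using N by (auto simp: compat_Gr_eq)
  define W where "W = A_symmetric A \<inter> (gr_dom Q \<inter> ball Q (1 / 2))"
  note chart_Q = orbit_union_chart[OF N orbits[OF Q] Q, folded W_def]
  let ?I = "{G :: 'a \<Rightarrow>\<^sub>L 'a. op_invertible G}"
  (* the chart at p is shrunk until the orbit map sends it into the domain of the chart at Q *)
  define O1 where "O1 = ?I \<inter> orbit_map Q0 -` (gr_dom Q \<inter> ball Q (1 / 2))"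
  have O1: "open O1"
    unfolding O1_def
    by (intro continuous_open_preimage open_op_invertible open_Int open_gr_dom open_ball
        smooth_on_imp_continuous_on smooth_on_orbit_map[OF smooth_on_id]) auto
  define U where "U = bounded_ops \<inter> (cayley_dom p \<inter> O1)"
  have pU: "p \<in> U"
    using p' self_in_cayley_dom[OF p'(1)] gr_dom_self[OF QQ] by (simp add: U_def O1_def Q_def[symmetric])
  have chart_p: "submanifold_chart bounded_ops (A_group A) U (cayley_chart p ` U) (cayley_chart p) (cayley_param p) (A_skew A)"
  proof (rule submanifold_chart_restrict[OF A_group_chart[OF p]])
    show "openin (top_of_set bounded_ops) U"
      unfolding U_def by (intro openin_open_Int open_Int open_cayley_dom O1)
  qed (auto simp: U_def)
  have image: "orbit_map Q0 ` (U \<inter> A_group A) \<subseteq> W"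
    using N by (auto simp: U_def O1_def W_def orbit_def compat_Gr_eq)
  let ?V = "cayley_chart p ` U" and ?f = "gr_chart Q \<circ> orbit_map Q0 \<circ> cayley_param p"
  have V: "X \<in> cayley_cod" "orbit_map Q0 (cayley_param p X) \<in> gr_dom Q" if X: "X \<in> ?V" for X
    using X p'(1) by (auto simp: U_def O1_def cayley_chart_in_cod cayley_param_chart)
  have "smooth_on UNIV ?V (\<lambda>X. gr_chart Q (orbit_map Q0 (cayley_param p X)))"
    by (intro smooth_on_gr_chart smooth_on_orbit_cayley smooth_on_id V p')
  then have smooth: "smooth_on (A_skew A) (?V \<inter> A_skew A) ?f"
    unfolding comp_def by (rule smooth_on_subset) auto
  define L where "L = (\<lambda>X. 2 *\<^sub>R (p \<odot> (X \<odot> Q0 - Q0 \<odot> X) \<odot> op_inv p))"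
  have "(gr_chart Q has_derivative (\<lambda>v. v)) (at (orbit_map Q0 (cayley_param p 0)))"
    using has_derivative_gr_chart[OF QQ] by (simp add: Q_def)
  from has_derivative_compose[OF has_derivative_orbit_cayley[OF p'(1)] this]
  have "(?f has_derivative L) (at 0)" by (simp add: comp_def L_def)
  then have deriv: "frechet_derivative_on (A_skew A) (?V \<inter> A_skew A) ?f (cayley_chart p p) L"
    unfolding cayley_chart_self[OF p'(1)] by (rule frechet_derivative_on_if_has_derivative)
  have onto: "L ` A_skew A = gr_tangent A Q"
    unfolding L_def Q_def by (rule orbit_map_derivative_image[OF p Q0])
  have "L v = 0 \<longleftrightarrow> Q0 \<odot> v = v \<odot> Q0" for v
  proof
    assume "L v = 0"
    then have "op_inv p \<odot> (p \<odot> (v \<odot> Q0 - Q0 \<odot> v) \<odot> op_inv p) \<odot> p = 0" by (simp add: L_def)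
    then show "Q0 \<odot> v = v \<odot> Q0" using p'(1) by (simp add: blinfun_compose_assoc op_cancel)
  qed (simp add: L_def)
  then have "complemented_in (A_skew A) {v \<in> A_skew A. L v = 0}"
    using codiagonal_complemented(2)[OF Q0', of "- 1"] unfolding A_skew_eq_scaleR by simp
  then show "\<exists>U V \<phi> \<psi> F U' V' \<phi>' \<psi>' F'.
      p \<in> U \<and> submanifold_chart bounded_ops (A_group A) U V \<phi> \<psi> F \<and>
      orbit_map Q0 p \<in> U' \<and> submanifold_chart (A_symmetric A) (orbit A Q0) U' V' \<phi>' \<psi>' F' \<and>
      orbit_map Q0 ` (U \<inter> A_group A) \<subseteq> U' \<and>
      smooth_on F (V \<inter> F) (\<phi>' \<circ> orbit_map Q0 \<circ> \<psi>) \<and>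
      (\<exists>L. frechet_derivative_on F (V \<inter> F) (\<phi>' \<circ> orbit_map Q0 \<circ> \<psi>) (\<phi> p) L \<and>
        L ` F = F' \<and> complemented_in F {v \<in> F. L v = 0})"
    using pU chart_p chart_Q[folded Q_def] image smooth deriv onto unfolding Q_def by blast
qed

theorem corollary4p5:
  fixes A Q0 :: "'a::complex_hilbert \<Rightarrow>\<^sub>L 'a"
  assumes "A \<in> bounded_ops"
    and "op_le 0 A" and "op_le A id_blinfun"
    and "{x. blinfun_apply A x = 0} = {0}"
    and "Q0 \<in> compat_Gr A"
  shows "complemented_submanifold (A_symmetric A) (orbit A Q0) \<and>
    smooth_submersion bounded_ops (A_group A) (A_symmetric A) (orbit A Q0) (orbit_map Q0) \<and>
    (\<exists>\<C>. \<C> \<subseteq> components (compat_Gr A) \<and> orbit A Q0 = \<Union>\<C>) \<and>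
    complemented_submanifold (A_symmetric A) (compat_Gr A)"
proof (intro conjI)
  note Q0 = assms(5)
  show "complemented_submanifold (A_symmetric A) (orbit A Q0)"
    using orbit_eq_if_mem[of _ A Q0]
    by (intro orbit_union_complemented_submanifold orbit_subset_compat_Gr Q0) simp
  show "smooth_submersion bounded_ops (A_group A) (A_symmetric A) (orbit A Q0) (orbit_map Q0)"
    by (rule orbit_map_submersion[OF Q0])
  show "\<exists>\<C>. \<C> \<subseteq> components (compat_Gr A) \<and> orbit A Q0 = \<Union>\<C>"
    by (rule orbit_union_of_components[OF Q0])
  show "complemented_submanifold (A_symmetric A) (compat_Gr A)"
    by (intro orbit_union_complemented_submanifold orbit_subset_compat_Gr order_refl)
qed

end
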